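(* Let $\mathfrak g$ be a complex semisimple Lie algebra with compact real form $\mathfrak u$ and Cartan decomposition $\mathfrak g=\mathfrak u\oplus i\mathfrak u$, with Cartan involution $\tau$; let $\mathfrak a\subset i\mathfrak u$ be maximal abelian with positive Weyl chamber $\mathfrak a^+$ and let $H\in\mathrm{cl}(\mathfrak a^+)$. Let $Y$ be a gradient vector field on the flag manifold $\mathbb F_H=\mathrm{Ad}(U)\cdot H$, and for $t\in\mathbb R$ define $$\sigma_{tY}(x)=x+t\,iY(x),\qquad x\in\mathbb F_H .$$ Then $\sigma_{tY}$ is a section of $U_{\mathrm{ad}}\cdot H\to\mathbb F_H$, and the image of $\sigma_{tY}$ is a Lagrangian submanifold of $U_{\mathrm{ad}}\cdot H$ with respect to the symplectic form $\Omega_\tau$.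
   Context: $\mathcal H_\tau(X,Y)=-\langle X,\tau Y\rangle$ is a Hermitian form on $\mathfrak g$, where $\langle\cdot,\cdot\rangle$ is the complex Cartan-Killing form of $\mathfrak g$, and $\Omega_\tau=\mathrm{Im}\,\mathcal H_\tau$; its restriction to $U_{\mathrm{ad}}\cdot H$ is a symplectic form. $U$ is the compact connected subgroup of $\mathrm{Aut}_0\,\mathfrak g$ with Lie algebra $\mathfrak u$. $U_{\mathrm{ad}}=U\times_{\mathrm{Ad}}i\mathfrak u$ is the semi-direct product, and its (transposed coadjoint) orbit through $H$ is $$U_{\mathrm{ad}}\cdot H=\bigcup_{x\in\mathrm{Ad}(U)H}\big(x+\mathrm{ad}(x)(i\mathfrak u)\big)\subset\mathfrak g,$$ with $\mathrm{ad}(x)(i\mathfrak u)\subset\mathfrak u$; the projection $U_{\mathrm{ad}}\cdot H\to\mathbb F_H$ sends $x+X$ ($X\in\mathrm{ad}(x)(i\mathfrak u)$) to $x$. The flag $\mathbb F_H\subset i\mathfrak u$ carries the $U$-invariant Riemannian metric induced by the restriction of $\langle\cdot,\cdot\rangle$ to $i\mathfrak u$ (an inner product); a vector field on $\mathbb F_H$ is viewed as a map $x\mapsto Y(x)\in T_x\mathbb F_H\subset i\mathfrak u$, and a gradient field is $Y=\mathrm{grad} f$ for a smooth $f:\mathbb F_H\to\mathbb R$. *)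

theory Defs
  imports "HOL-Analysis.Analysis"
begin

section \<open>Smooth maps and embedded submanifolds of Euclidean space\<close>

primrec Ck_on :: "nat \<Rightarrow> ('a::euclidean_space \<Rightarrow> 'b::euclidean_space) \<Rightarrow> 'a set \<Rightarrow> bool" where
  "Ck_on 0 f W \<longleftrightarrow> continuous_on W f"
| "Ck_on (Suc k) f W \<longleftrightarrow>
     (\<forall>x\<in>W. f differentiable (at x)) \<and> (\<forall>v. Ck_on k (\<lambda>x. frechet_derivative f (at x) v) W)"

text \<open>Meaningful for open sets \<open>W\<close> only.\<close>

definition smooth_on :: "('a::euclidean_space \<Rightarrow> 'b::euclidean_space) \<Rightarrow> 'a set \<Rightarrow> bool" where
  "smooth_on f W \<longleftrightarrow> (\<forall>k. Ck_on k f W)"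

definition smooth_diffeo ::
    "('a::euclidean_space \<Rightarrow> 'a) \<Rightarrow> ('a \<Rightarrow> 'a) \<Rightarrow> 'a set \<Rightarrow> 'a set \<Rightarrow> bool" where
  "smooth_diffeo \<phi> \<psi> W W' \<longleftrightarrow>
     open W \<and> open W' \<and> smooth_on \<phi> W \<and> smooth_on \<psi> W' \<and> \<phi> ` W = W' \<and> \<psi> ` W' = W \<and>
     (\<forall>x\<in>W. \<psi> (\<phi> x) = x) \<and> (\<forall>y\<in>W'. \<phi> (\<psi> y) = y)"

text \<open>Embedded submanifolds of dimension \<open>k\<close>, in terms of slice charts.\<close>

definition submanifold :: "nat \<Rightarrow> 'a::euclidean_space set \<Rightarrow> bool" where
  "submanifold k S \<longleftrightarrow>
     (\<forall>p\<in>S. \<exists>W W' \<phi> \<psi> V. smooth_diffeo \<phi> \<psi> W W' \<and> p \<in> W \<and>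
        subspace V \<and> dim V = k \<and> \<phi> ` (W \<inter> S) = W' \<inter> V)"

definition smooth_map_on :: "'a::euclidean_space set \<Rightarrow> ('a \<Rightarrow> 'b::euclidean_space) \<Rightarrow> bool" where
  "smooth_map_on S f \<longleftrightarrow>
     (\<forall>p\<in>S. \<exists>W g. open W \<and> p \<in> W \<and> smooth_on g W \<and> (\<forall>x\<in>S \<inter> W. f x = g x))"

text \<open>\<open>\<gamma>\<close> is a smooth curve in \<open>S\<close>, defined near parameter \<open>0\<close>, through \<open>p\<close> with velocity \<open>v\<close>.\<close>

definition curve_at :: "'a::euclidean_space set \<Rightarrow> 'a \<Rightarrow> 'a \<Rightarrow> (real \<Rightarrow> 'a) \<Rightarrow> bool" where
  "curve_at S p v \<gamma> \<longleftrightarrow>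
     (\<exists>e>0. smooth_on \<gamma> {-e<..<e} \<and> \<gamma> ` {-e<..<e} \<subseteq> S) \<and>
     \<gamma> 0 = p \<and> (\<gamma> has_vector_derivative v) (at 0)"

definition tangent_space :: "'a::euclidean_space set \<Rightarrow> 'a \<Rightarrow> 'a set" where
  "tangent_space S p = {v. \<exists>\<gamma>. curve_at S p v \<gamma>}"

text \<open>\<open>Y\<close> is the gradient of \<open>f : S \<rightarrow> \<real>\<close> for the Riemannian metric that the bilinear
  form \<open>g\<close> of the ambient space induces on \<open>S\<close>: \<open>df\<^sub>x v = g (Y x) v\<close>, where \<open>df\<^sub>x v\<close> is the
  derivative of \<open>f\<close> along any curve through \<open>x\<close> with velocity \<open>v\<close>.\<close>

definition is_gradient ::
    "('a::euclidean_space \<Rightarrow> 'a \<Rightarrow> real) \<Rightarrow> 'a set \<Rightarrow> ('a \<Rightarrow> real) \<Rightarrow> ('a \<Rightarrow> 'a) \<Rightarrow> bool" where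
  "is_gradient g S f Y \<longleftrightarrow>
     (\<forall>x\<in>S. Y x \<in> tangent_space S x \<and>
        (\<forall>v \<gamma>. curve_at S x v \<gamma> \<longrightarrow> ((\<lambda>s. f (\<gamma> s)) has_real_derivative g (Y x) v) (at 0)))"

definition smooth_section ::
    "('a::euclidean_space \<Rightarrow> 'a) \<Rightarrow> 'a set \<Rightarrow> 'a set \<Rightarrow> ('a \<Rightarrow> 'a) \<Rightarrow> bool" where
  "smooth_section \<pi> M B \<sigma> \<longleftrightarrow> smooth_map_on B \<sigma> \<and> (\<forall>x\<in>B. \<sigma> x \<in> M \<and> \<pi> (\<sigma> x) = x)"

text \<open>The form \<open>\<omega>\<close> has constant coefficients on the ambient vector space, so its restriction to a
  submanifold is closed; only non-degeneracy on the tangent spaces has to be required.\<close>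

definition symplectic_on ::
    "('a::euclidean_space \<Rightarrow> 'a \<Rightarrow> real) \<Rightarrow> 'a set \<Rightarrow> bool" where
  "symplectic_on \<omega> M \<longleftrightarrow>
     bilinear \<omega> \<and> (\<forall>v. \<omega> v v = 0) \<and>
     (\<forall>p\<in>M. \<forall>v\<in>tangent_space M p. (\<forall>w\<in>tangent_space M p. \<omega> v w = 0) \<longrightarrow> v = 0)"

definition lagrangian_submanifold ::
    "('a::euclidean_space \<Rightarrow> 'a \<Rightarrow> real) \<Rightarrow> 'a set \<Rightarrow> 'a set \<Rightarrow> bool" where
  "lagrangian_submanifold \<omega> M L \<longleftrightarrow>
     symplectic_on \<omega> M \<and> L \<subseteq> M \<and>
     (\<exists>k. submanifold (2 * k) M \<and> submanifold k L) \<and>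
     (\<forall>p\<in>L. \<forall>v\<in>tangent_space L p. \<forall>w\<in>tangent_space L p. \<omega> v w = 0)"


section \<open>Complex Lie algebras\<close>

text \<open>A complex Lie algebra of dimension \<open>CARD('n)\<close> is a bracket on \<open>complex ^ 'n\<close>. Note that
  \<open>subspace\<close>, \<open>span\<close> and \<open>dim\<close> refer to the real vector space structure, whereas
  \<open>vec.subspace\<close> and \<open>vec.span\<close> refer to the complex one.\<close>

type_synonym 'n bracket = "complex ^ 'n \<Rightarrow> complex ^ 'n \<Rightarrow> complex ^ 'n"

definition complex_lie_algebra :: "'n::finite bracket \<Rightarrow> bool" where
  "complex_lie_algebra br \<longleftrightarrow>
     (\<forall>x. Vector_Spaces.linear (*s) (*s) (br x)) \<and>
     (\<forall>y. Vector_Spaces.linear (*s) (*s) (\<lambda>x. br x y)) \<and>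
     (\<forall>x. br x x = 0) \<and>
     (\<forall>x y z. br x (br y z) + br y (br z x) + br z (br x y) = 0)"

definition lie_ideal :: "'n::finite bracket \<Rightarrow> (complex ^ 'n) set \<Rightarrow> bool" where
  "lie_ideal br I \<longleftrightarrow> vec.subspace I \<and> (\<forall>x. \<forall>y\<in>I. br x y \<in> I)"

definition derived_algebra :: "'n::finite bracket \<Rightarrow> (complex ^ 'n) set \<Rightarrow> (complex ^ 'n) set" where
  "derived_algebra br I = vec.span {br x y | x y. x \<in> I \<and> y \<in> I}"

definition solvable :: "'n::finite bracket \<Rightarrow> (complex ^ 'n) set \<Rightarrow> bool" where
  "solvable br I \<longleftrightarrow> (\<exists>m. (derived_algebra br ^^ m) I = {0})"

definition semisimple :: "'n::finite bracket \<Rightarrow> bool" where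
  "semisimple br \<longleftrightarrow> (\<forall>I. lie_ideal br I \<and> solvable br I \<longrightarrow> I = {0})"

definition killing :: "'n::finite bracket \<Rightarrow> complex ^ 'n \<Rightarrow> complex ^ 'n \<Rightarrow> complex" where
  "killing br X Y = trace (matrix (br X) ** matrix (br Y))"

definition i_times :: "(complex ^ 'n::finite) set \<Rightarrow> (complex ^ 'n) set" where
  "i_times S = (\<lambda>X. \<i> *s X) ` S"

definition real_form :: "'n::finite bracket \<Rightarrow> (complex ^ 'n) set \<Rightarrow> bool" where
  "real_form br u \<longleftrightarrow>
     subspace u \<and> (\<forall>X\<in>u. \<forall>Y\<in>u. br X Y \<in> u) \<and>
     u \<inter> i_times u = {0} \<and> (\<forall>Z. \<exists>X\<in>u. \<exists>Y\<in>i_times u. Z = X + Y)"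

text \<open>On a real form the Killing form of the complex algebra is real-valued and coincides with the
  Killing form of the real form, since a real basis of \<open>u\<close> is a complex basis of the whole
  algebra. Compactness means that it is negative definite.\<close>

definition compact_real_form :: "'n::finite bracket \<Rightarrow> (complex ^ 'n) set \<Rightarrow> bool" where
  "compact_real_form br u \<longleftrightarrow>
     real_form br u \<and> (\<forall>X\<in>u. X \<noteq> 0 \<longrightarrow> Re (killing br X X) < 0)"

definition cartan_involution :: "(complex ^ 'n::finite) set \<Rightarrow> complex ^ 'n \<Rightarrow> complex ^ 'n" where
  "cartan_involution u Z =
     (THE W. \<exists>X\<in>u. \<exists>Y\<in>i_times u. Z = X + Y \<and> W = X - Y)"

definition hermitian_form ::
    "'n::finite bracket \<Rightarrow> (complex ^ 'n) set \<Rightarrow> complex ^ 'n \<Rightarrow> complex ^ 'n \<Rightarrow> complex" where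
  "hermitian_form br u X Y = - killing br X (cartan_involution u Y)"

definition Omega ::
    "'n::finite bracket \<Rightarrow> (complex ^ 'n) set \<Rightarrow> complex ^ 'n \<Rightarrow> complex ^ 'n \<Rightarrow> real" where
  "Omega br u X Y = Im (hermitian_form br u X Y)"

definition abelian_subspace :: "'n::finite bracket \<Rightarrow> (complex ^ 'n) set \<Rightarrow> bool" where
  "abelian_subspace br b \<longleftrightarrow> subspace b \<and> (\<forall>A\<in>b. \<forall>B\<in>b. br A B = 0)"

definition maximal_abelian ::
    "'n::finite bracket \<Rightarrow> (complex ^ 'n) set \<Rightarrow> (complex ^ 'n) set \<Rightarrow> bool" where
  "maximal_abelian br s a \<longleftrightarrow>
     a \<subseteq> s \<and> abelian_subspace br a \<and>
     (\<forall>b. b \<subseteq> s \<and> abelian_subspace br b \<and> a \<subseteq> b \<longrightarrow> b = a)"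

text \<open>A root is a functional on \<open>a\<close>; here it is given by any linear extension to the whole space,
  only its values on \<open>a\<close> being relevant.\<close>

definition is_root ::
    "'n::finite bracket \<Rightarrow> (complex ^ 'n) set \<Rightarrow> (complex ^ 'n \<Rightarrow> real) \<Rightarrow> bool" where
  "is_root br a \<alpha> \<longleftrightarrow>
     linear \<alpha> \<and> (\<exists>A\<in>a. \<alpha> A \<noteq> 0) \<and>
     (\<exists>X. X \<noteq> 0 \<and> (\<forall>A\<in>a. br A X = complex_of_real (\<alpha> A) *s X))"

definition weyl_chamber ::
    "'n::finite bracket \<Rightarrow> (complex ^ 'n) set \<Rightarrow> (complex ^ 'n) set \<Rightarrow> bool" where
  "weyl_chamber br a c \<longleftrightarrow> c \<in> components {A \<in> a. \<forall>\<alpha>. is_root br a \<alpha> \<longrightarrow> \<alpha> A \<noteq> 0}"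


section \<open>The flag manifold and the orbit of the semidirect product\<close>

definition exp_ad :: "'n::finite bracket \<Rightarrow> complex ^ 'n \<Rightarrow> complex ^ 'n \<Rightarrow> complex ^ 'n" where
  "exp_ad br X Z = (\<Sum>k. (br X ^^ k) Z /\<^sub>R fact k)"

text \<open>The connected Lie subgroup of the automorphism group with Lie algebra \<open>ad u\<close>, i.e. the group
  generated by the exponentials of \<open>ad X\<close> with \<open>X \<in> u\<close>. It is closed under inverses since
  \<open>exp_ad br (- X)\<close> is the inverse of \<open>exp_ad br X\<close>. Its elements are automorphisms of the Lie
  algebra, and its adjoint action is evaluation.\<close>

inductive_set U_group :: "'n::finite bracket \<Rightarrow> (complex ^ 'n) set \<Rightarrow> (complex ^ 'n \<Rightarrow> complex ^ 'n) set"
  for br :: "'n bracket" and u :: "(complex ^ 'n) set" where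
  "id \<in> U_group br u"
| "X \<in> u \<Longrightarrow> \<theta> \<in> U_group br u \<Longrightarrow> exp_ad br X \<circ> \<theta> \<in> U_group br u"

definition flag :: "'n::finite bracket \<Rightarrow> (complex ^ 'n) set \<Rightarrow> complex ^ 'n \<Rightarrow> (complex ^ 'n) set" where
  "flag br u H = {\<theta> H | \<theta>. \<theta> \<in> U_group br u}"

text \<open>The orbit through \<open>H\<close> of the semidirect product of \<open>U\<close> and \<open>i u\<close>: the affine spaces
  \<open>x + ad x (i u)\<close> over the points \<open>x\<close> of the flag manifold.\<close>

definition Uad_orbit ::
    "'n::finite bracket \<Rightarrow> (complex ^ 'n) set \<Rightarrow> complex ^ 'n \<Rightarrow> (complex ^ 'n) set" where
  "Uad_orbit br u H = (\<Union>x\<in>flag br u H. {x + X | X. X \<in> br x ` i_times u})"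

definition Uad_proj ::
    "'n::finite bracket \<Rightarrow> (complex ^ 'n) set \<Rightarrow> complex ^ 'n \<Rightarrow> complex ^ 'n \<Rightarrow> complex ^ 'n" where
  "Uad_proj br u H p = (THE x. x \<in> flag br u H \<and> (\<exists>X \<in> br x ` i_times u. p = x + X))"

text \<open>The Killing form is real-valued on \<open>i_times u\<close>, where the flag and its tangent vectors lie, so
  its real part is the Riemannian metric.\<close>

definition gradient_field ::
    "'n::finite bracket \<Rightarrow> (complex ^ 'n) set \<Rightarrow> complex ^ 'n \<Rightarrow> (complex ^ 'n \<Rightarrow> complex ^ 'n) \<Rightarrow> bool" where
  "gradient_field br u H Y \<longleftrightarrow>
     (\<exists>f :: complex ^ 'n \<Rightarrow> real. smooth_map_on (flag br u H) f \<and>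
        is_gradient (\<lambda>v w. Re (killing br v w)) (flag br u H) f Y)"

definition sigma_section :: "real \<Rightarrow> (complex ^ 'n::finite \<Rightarrow> complex ^ 'n) \<Rightarrow> complex ^ 'n \<Rightarrow> complex ^ 'n" where
  "sigma_section t Y x = x + t *\<^sub>R (\<i> *s Y x)"

end

theory Submission
  imports Defs "HOL-Computational_Algebra.Fundamental_Theorem_Algebra"
begin

text \<open>Since \<open>[x, i u] = i [x, u]\<close> and \<open>[x, u]\<close> is the tangent space of the flag at \<open>x\<close>, the orbit of the
  semidirect product is the tangent bundle \<open>{x + i v}\<close> of the flag inside \<open>i u \<oplus> u\<close>, and on
  \<open>i u \<oplus> u\<close> one has \<open>\<Omega> (a + i b) (a' + i b') = \<langle>b, a'\<rangle> - \<langle>a, b'\<rangle>\<close>. A tangent vector of the image of the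
  section is \<open>a + t i DY a\<close>, so the image is isotropic when \<open>DY\<close> is symmetric on tangent
  vectors. For a gradient field this follows by differentiating \<open>\<langle>Y x, [A, x]\<rangle> = Df\<^sub>x [A, x]\<close> along
  \<open>[A', x]\<close> and antisymmetrizing in \<open>A, A'\<close>: the Hessian of \<open>f\<close> cancels, and the remaining terms
  without \<open>DY\<close> cancel by the same identity for \<open>[A, A']\<close>.

  That the flag is embedded needs no compactness of the group: a point of the flag near \<open>H\<close> is conjugate,
  by a group element, to some \<open>H + Z\<close> with \<open>[H, Z] = 0\<close>, and \<open>Z = 0\<close> because \<open>ad (H + Z)\<close>
  and \<open>ad H\<close> have the same finite spectrum.\<close>

section \<open>Calculus of smooth maps\<close>

text \<open>A priori the flag is only the orbit of an abstractly generated group and might return to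
  \<open>H\<close> along infinitely many sheets. Excluding this is the main obstacle, and the
  spectrum of \<open>ad H\<close> enters there. All charts come from one map \<psi>. A vector
  \<open>y\<close> splits as \<open>P y + Q y\<close> with parts in \<open>i u\<close> and
  \<open>u\<close>, and \<open>P y\<close> splits further into \<open>[H, s (P y)]\<close>, tangent
  to the flag, and a rest \<open>Z y\<close> commuting with \<open>H\<close>. The tangential part is
  realized by moving with the group; the remaining \<open>Z y + Q y\<close> is added to
  \<open>H\<close>. Flag and orbit are invariant under the group, so for small \<open>Z y\<close>
  membership of \<open>\<psi> y\<close> is read off from \<open>Z y\<close> and \<open>Q y\<close>:
  the flag is \<open>Z y = 0\<close>, \<open>Q y = 0\<close>, and the orbit is
  \<open>Z y = 0\<close> with \<open>Q y\<close> in \<open>i [u, H]\<close>. The image of the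
  section is straightened by \<psi> followed by an ambient extension of the section. The field is
  given on the flag alone, so \<open>DY\<close> refers to a smooth extension, built as the
  tangential projection of an ambient gradient; for this the projection has to depend smoothly on
  the point.\<close>

lemma linear_basis_expansion:
  fixes f :: "'a::euclidean_space \<Rightarrow> 'b::real_vector"
  assumes "linear f"
  shows "f w = (\<Sum>b\<in>Basis. (w \<bullet> b) *\<^sub>R f b)"
proof -
  have "f w = f (\<Sum>b\<in>Basis. (w \<bullet> b) *\<^sub>R b)" by (simp add: euclidean_representation)
  also have "\<dots> = (\<Sum>b\<in>Basis. f ((w \<bullet> b) *\<^sub>R b))" by (rule linear_sum[OF assms])
  finally show ?thesis by (simp add: linear_scale[OF assms])
qed

lemma linear_inner_basis: "linear (\<lambda>w::'a::euclidean_space. w \<bullet> b)"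
  by (simp add: bounded_linear.linear bounded_linear_inner_left)

text \<open>\<open>frechet_derivative\<close> is a choice from the relation
  \<open>has_derivative\<close>, so equality of these relations gives equal derivatives even at
  points where none exists.\<close>

lemma frechet_derivative_cong_open:
  assumes "open W" "x \<in> W" "\<And>y. y \<in> W \<Longrightarrow> f y = g y"
  shows "f differentiable at x \<longleftrightarrow> g differentiable at x"
    and "frechet_derivative f (at x) = frechet_derivative g (at x)"
proof -
  have "(f has_derivative D) (at x) \<longleftrightarrow> (g has_derivative D) (at x)" for D
    using assms has_derivative_transform_within_open[of f D x UNIV W g]
      has_derivative_transform_within_open[of g D x UNIV W f] by auto
  then show "f differentiable at x \<longleftrightarrow> g differentiable at x"
    and "frechet_derivative f (at x) = frechet_derivative g (at x)"
    by (auto simp: differentiable_def frechet_derivative_def)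
qed

lemma Ck_on_cong:
  assumes "open W" "Ck_on k f W" "\<And>y. y \<in> W \<Longrightarrow> f y = g y"
  shows "Ck_on k g W"
  using assms(2,3)
proof (induction k arbitrary: f g)
  case 0
  then show ?case by (simp cong: continuous_on_cong)
next
  case (Suc k)
  have d: "f differentiable at x" "frechet_derivative f (at x) = frechet_derivative g (at x)"
    "f differentiable at x \<longleftrightarrow> g differentiable at x" if "x \<in> W" for x
    using frechet_derivative_cong_open[OF assms(1) that Suc.prems(2)] Suc.prems(1) that by auto
  have "Ck_on k (\<lambda>x. frechet_derivative g (at x) v) W" for v
    by (rule Suc.IH[of "\<lambda>x. frechet_derivative f (at x) v"]) (use Suc.prems(1) d(2) in auto)
  then show ?case using Suc.prems(1) d(3) by auto
qed

lemma Ck_on_subset: "Ck_on k f W \<Longrightarrow> W' \<subseteq> W \<Longrightarrow> Ck_on k f W'"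
  by (induction k arbitrary: f) (auto intro: continuous_on_subset)

text \<open>Replaces the chosen derivative by an explicit formula \<open>f'\<close>, so that
  inductions on the order of differentiability can work with computed derivatives.\<close>

lemma Ck_on_SucI:
  assumes "open W" "\<And>x. x \<in> W \<Longrightarrow> (f has_derivative f' x) (at x)"
    and "\<And>v. Ck_on k (\<lambda>x. f' x v) W"
  shows "Ck_on (Suc k) f W"
proof -
  have e: "frechet_derivative f (at x) = f' x" if "x \<in> W" for x
    using assms(2)[OF that] frechet_derivative_at by metis
  show ?thesis
    using assms(2) e by (auto simp: differentiable_def intro!: Ck_on_cong[OF assms(1) assms(3)])
qed

lemma Ck_on_SucD:
  assumes "Ck_on (Suc k) f W"
  shows "\<And>x. x \<in> W \<Longrightarrow> (f has_derivative frechet_derivative f (at x)) (at x)"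
    and "\<And>v. Ck_on k (\<lambda>x. frechet_derivative f (at x) v) W"
  using assms frechet_derivative_works by auto

lemma Ck_on_continuous: "Ck_on k f W \<Longrightarrow> continuous_on W f"
  by (cases k) (auto intro!: continuous_at_imp_continuous_on differentiable_imp_continuous_within)

lemma Ck_on_Suc_imp: "Ck_on (Suc k) f W \<Longrightarrow> Ck_on k f W"
proof (induction k arbitrary: f)
  case 0
  from Ck_on_continuous[OF 0] show ?case by simp
next
  case (Suc k)
  then show ?case using Ck_on.simps(2) by blast
qed

lemma Ck_on_const: "Ck_on k (\<lambda>x. c) W"
  by (induction k arbitrary: c) auto

lemma Ck_on_linear:
  assumes "open W" "linear T" "Ck_on k f W"
  shows "Ck_on k (\<lambda>x. T (f x)) W"
  using assms(3)
proof (induction k arbitrary: f)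
  case 0
  then show ?case
    using linear_continuous_on_compose[of W f T] assms(2) by (simp add: comp_def)
next
  case (Suc k)
  note D = Ck_on_SucD[OF Suc.prems]
  show ?case
  proof (rule Ck_on_SucI[OF assms(1)])
    fix x assume "x \<in> W"
    show "((\<lambda>x. T (f x)) has_derivative (\<lambda>v. T (frechet_derivative f (at x) v))) (at x)"
      using bounded_linear.has_derivative[OF linear_conv_bounded_linear[THEN iffD1, OF assms(2)] D(1)[OF \<open>x \<in> W\<close>]] .
  qed (use Suc.IH D(2) in auto)
qed

lemma Ck_on_id: "open W \<Longrightarrow> Ck_on k (\<lambda>x. x) W"
proof (cases k)
  case (Suc m)
  assume "open W"
  then show ?thesis unfolding Suc
    by (rule Ck_on_SucI[where f' = "\<lambda>x v. v"]) (auto intro: Ck_on_const)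
qed auto

lemma Ck_on_add:
  assumes "open W" "Ck_on k f W" "Ck_on k g W"
  shows "Ck_on k (\<lambda>x. f x + g x) W"
  using assms(2,3)
proof (induction k arbitrary: f g)
  case 0
  then show ?case by (auto intro: continuous_intros)
next
  case (Suc k)
  note D = Ck_on_SucD[OF Suc.prems(1)] Ck_on_SucD[OF Suc.prems(2)]
  show ?case
    by (rule Ck_on_SucI[OF assms(1) has_derivative_add[OF D(1) D(3)]]) (use Suc.IH D in auto)
qed

lemma Ck_on_sum:
  assumes "open W" "\<And>i. i \<in> I \<Longrightarrow> Ck_on k (f i) W"
  shows "Ck_on k (\<lambda>x. \<Sum>i\<in>I. f i x) W"
  using assms(2)
  by (induction I rule: infinite_finite_induct) (auto intro: Ck_on_const Ck_on_add[OF assms(1)])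

lemma Ck_on_scaleR:
  fixes f :: "'a::euclidean_space \<Rightarrow> real"
  assumes "open W" "Ck_on k f W" "Ck_on k g W"
  shows "Ck_on k (\<lambda>x. f x *\<^sub>R g x) W"
  using assms(2,3)
proof (induction k arbitrary: f g)
  case 0
  then show ?case by (auto intro: continuous_intros)
next
  case (Suc k)
  note D = Ck_on_SucD[OF Suc.prems(1)] Ck_on_SucD[OF Suc.prems(2)]
  show ?case
    by (rule Ck_on_SucI[OF assms(1) has_derivative_scaleR[OF D(1) D(3)]])
      (assumption | intro Ck_on_add assms(1) Suc.IH D(2,4) Suc.prems[THEN Ck_on_Suc_imp])+
qed

lemma Ck_on_compose:
  fixes f :: "'a::euclidean_space \<Rightarrow> 'b::euclidean_space" and g :: "'b \<Rightarrow> 'c::euclidean_space"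
  assumes "open W" "open V" "Ck_on k f W" "Ck_on k g V" "f ` W \<subseteq> V"
  shows "Ck_on k (\<lambda>x. g (f x)) W"
  using assms(3-5)
proof (induction k arbitrary: f g)
  case 0
  then show ?case using continuous_on_compose2[of V g W f] by simp
next
  case (Suc k)
  note D = Ck_on_SucD[OF Suc.prems(1)] Ck_on_SucD[OF Suc.prems(2)]
  let ?f' = "\<lambda>x. frechet_derivative f (at x)" and ?g' = "\<lambda>x. frechet_derivative g (at x)"
  show ?case
  proof (rule Ck_on_SucI[OF assms(1)])
    fix x assume "x \<in> W"
    then have fx: "f x \<in> V" using Suc.prems by auto
    have lin: "linear (?g' (f x))" using D(3)[OF fx] has_derivative_linear by blast
    have "(g \<circ> f has_derivative ?g' (f x) \<circ> ?f' x) (at x)"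
      by (rule diff_chain_at[OF D(1)[OF \<open>x \<in> W\<close>] D(3)[OF fx]])
    \<comment> \<open>\<open>Ck_on\<close> speaks of derivatives in a fixed direction, whereas the
      chain rule evaluates the derivative of \<open>g\<close> in a direction depending on
      \<open>x\<close>. Expanded over the basis, each \<open>?g' (f x) b\<close> is again a
      composition with \<open>f\<close>, to which the induction hypothesis applies.\<close>
    moreover have "?g' (f x) \<circ> ?f' x = (\<lambda>v. \<Sum>b\<in>Basis. (?f' x v \<bullet> b) *\<^sub>R ?g' (f x) b)"
      unfolding comp_def by (subst linear_basis_expansion[OF lin]) rule
    ultimately show "((\<lambda>x. g (f x)) has_derivative (\<lambda>v. \<Sum>b\<in>Basis. (?f' x v \<bullet> b) *\<^sub>R ?g' (f x) b)) (at x)"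
      by (simp add: comp_def)
  next
    fix v
    have "Ck_on k (\<lambda>x. ?f' x v \<bullet> b) W" for b
      by (rule Ck_on_linear[OF assms(1) linear_inner_basis D(2)])
    moreover have "Ck_on k (\<lambda>x. ?g' (f x) b) W" for b
      by (rule Suc.IH[OF Ck_on_Suc_imp[OF Suc.prems(1)] D(4) Suc.prems(3)])
    ultimately show "Ck_on k (\<lambda>x. \<Sum>b\<in>Basis. (?f' x v \<bullet> b) *\<^sub>R ?g' (f x) b) W"
      using assms(1) by (simp only: Ck_on_sum Ck_on_scaleR)
  qed
qed

lemma smooth_on_subset: "smooth_on f W \<Longrightarrow> W' \<subseteq> W \<Longrightarrow> smooth_on f W'"
  unfolding smooth_on_def by (meson Ck_on_subset)

lemma smooth_on_const: "smooth_on (\<lambda>x. c) W"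
  by (simp add: smooth_on_def Ck_on_const)

lemma smooth_on_linear: "open W \<Longrightarrow> linear T \<Longrightarrow> smooth_on f W \<Longrightarrow> smooth_on (\<lambda>x. T (f x)) W"
  using Ck_on_linear[of W T _ f] by (simp add: smooth_on_def)

lemma smooth_on_id: "open W \<Longrightarrow> smooth_on (\<lambda>x. x) W"
  by (simp add: smooth_on_def Ck_on_id)

lemma smooth_on_add:
  "open W \<Longrightarrow> smooth_on f W \<Longrightarrow> smooth_on g W \<Longrightarrow> smooth_on (\<lambda>x. f x + g x) W"
  by (simp add: smooth_on_def Ck_on_add)

lemma smooth_on_sum:
  "open W \<Longrightarrow> (\<And>i. i \<in> I \<Longrightarrow> smooth_on (f i) W) \<Longrightarrow> smooth_on (\<lambda>x. \<Sum>i\<in>I. f i x) W"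
  by (simp add: smooth_on_def Ck_on_sum)

lemma smooth_on_scaleR:
  fixes f :: "'a::euclidean_space \<Rightarrow> real"
  shows "open W \<Longrightarrow> smooth_on f W \<Longrightarrow> smooth_on g W \<Longrightarrow> smooth_on (\<lambda>x. f x *\<^sub>R g x) W"
  by (simp add: smooth_on_def Ck_on_scaleR)

lemma smooth_on_compose:
  "open W \<Longrightarrow> open V \<Longrightarrow> smooth_on f W \<Longrightarrow> smooth_on g V \<Longrightarrow> f ` W \<subseteq> V \<Longrightarrow>
    smooth_on (\<lambda>x. g (f x)) W"
  using Ck_on_compose[of W V _ f g] by (simp add: smooth_on_def)

lemma smooth_on_continuous: "smooth_on f W \<Longrightarrow> continuous_on W f"
  unfolding smooth_on_def by (meson Ck_on_continuous)

lemma smooth_on_has_derivative: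
  "smooth_on f W \<Longrightarrow> x \<in> W \<Longrightarrow> (f has_derivative frechet_derivative f (at x)) (at x)"
  by (rule Ck_on_SucD(1)[of 0]) (auto simp only: smooth_on_def)

lemma smooth_on_frechet_derivative:
  "smooth_on f W \<Longrightarrow> smooth_on (\<lambda>x. frechet_derivative f (at x) v) W"
  unfolding smooth_on_def by (intro allI Ck_on_SucD(2)) auto

lemma smooth_on_bilinear:
  assumes "open W" "bilinear h" "smooth_on f W" "smooth_on g W"
  shows "smooth_on (\<lambda>x. h (f x) (g x)) W"
proof -
  have "h (f x) (g x) = (\<Sum>b\<in>Basis. (f x \<bullet> b) *\<^sub>R h b (g x))" for x
    by (rule linear_basis_expansion) (use assms(2) in \<open>simp add: bilinear_def\<close>)
  moreover have "smooth_on (\<lambda>x. h b (g x)) W" for b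
    by (rule smooth_on_linear) (use assms in \<open>auto simp: bilinear_def\<close>)
  moreover have "smooth_on (\<lambda>x. f x \<bullet> b) W" for b
    by (rule smooth_on_linear[OF assms(1) linear_inner_basis assms(3)])
  ultimately show ?thesis
    using assms(1) by (simp only: smooth_on_sum smooth_on_scaleR)
qed

text \<open>The derivative of \<open>B = A\<^sup>-\<^sup>1\<close> is \<open>h \<mapsto> - B (DA h) B\<close>, so \<open>B\<close> is as often differentiable as \<open>A\<close>.\<close>

lemma Ck_on_inverse_operator:
  fixes A B :: "'a::euclidean_space \<Rightarrow> 'b::euclidean_space \<Rightarrow> 'b"
  assumes "open W" "\<And>v. Ck_on k (\<lambda>x. A x v) W"
    and linA: "\<And>x. x \<in> W \<Longrightarrow> linear (A x)"
    and linB: "\<And>x. x \<in> W \<Longrightarrow> linear (B x)"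
    and AB: "\<And>x v. x \<in> W \<Longrightarrow> A x (B x v) = v"
    and BA: "\<And>x v. x \<in> W \<Longrightarrow> B x (A x v) = v"
  shows "Ck_on k (\<lambda>x. B x v) W"
proof -
  have contA: "continuous_on W (\<lambda>x. A x v)" for v
    using assms(2) Ck_on_continuous by blast
  \<comment> \<open>Continuity of the inverse comes before any derivative: near \<open>x0\<close>
    the operators \<open>A x\<close> are bounded below, being close to the invertible
    \<open>A x0\<close>.\<close>
  have contB: "((\<lambda>x. B x v) \<longlongrightarrow> B x0 v) (at x0)" if x0: "x0 \<in> W" for x0 v
  proof -
    define w where "w = B x0 v"
    define S where "S = (\<lambda>x. \<Sum>b\<in>Basis. norm (A x b - A x0 b))"
    have AW: "((\<lambda>x. A x u) \<longlongrightarrow> A x0 u) (at x0)" for u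
      using contA x0 assms(1) continuous_on_eq_continuous_at isCont_def by blast
    have S0: "(S \<longlongrightarrow> 0) (at x0)"
      unfolding S_def by (rule tendsto_null_sum, rule tendsto_norm_zero, rule LIM_zero, rule AW)
    obtain K where K: "K > 0" "\<And>u. norm (B x0 u) \<le> norm u * K"
      using linear_conv_bounded_linear linB[OF x0] bounded_linear.pos_bounded by blast
    have near: "norm (A x u - A x0 u) \<le> norm u * S x" if "x \<in> W" for x u
    proof -
      have e: "A x u = (\<Sum>b\<in>Basis. (u \<bullet> b) *\<^sub>R A x b)" if "x \<in> W" for x
        by (rule linear_basis_expansion[OF linA[OF that]])
      have "norm (A x u - A x0 u) \<le> (\<Sum>b\<in>Basis. norm ((u \<bullet> b) *\<^sub>R (A x b - A x0 b)))"
        unfolding e[OF that] e[OF x0] sum_subtractf[symmetric] scaleR_right_diff_distrib[symmetric]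
        by (rule norm_sum)
      also have "\<dots> \<le> (\<Sum>b\<in>Basis. norm u * norm (A x b - A x0 b))"
        by (intro sum_mono) (simp add: Basis_le_norm mult_right_mono)
      finally show ?thesis by (simp add: S_def sum_distrib_left)
    qed
    \<comment> \<open>With \<open>S x * K\<close> below 1/2 the term containing
      \<open>norm d\<close> is absorbed into the left-hand side; this is the origin of the factor 2
      in \<open>bound\<close>.\<close>
    have evS: "eventually (\<lambda>x. S x * K < 1/2) (at x0)"
      using tendsto_mult_left_zero[OF S0, of K] by (rule order_tendstoD) simp
    have evW: "eventually (\<lambda>x. x \<in> W) (at x0)"
      using assms(1) x0 eventually_at_topological by blast
    have bound: "eventually (\<lambda>x. norm (B x v - B x0 v) \<le> 2 * K * norm (A x w - A x0 w)) (at x0)"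
      using evS evW
    proof eventually_elim
      case (elim x)
      define d where "d = B x v - w"
      have "A x d = A x0 w - A x w"
        unfolding d_def w_def using elim AB[OF elim(2)] AB[OF x0] linear_diff[OF linA] by simp
      moreover have "norm d \<le> 2 * K * norm (A x d)"
      proof -
        have "norm (A x0 d) \<le> norm (A x d) + norm d * S x"
          using near[OF elim(2), of d] norm_triangle_ineq4[of "A x d" "A x d - A x0 d"] by simp
        moreover have "norm d \<le> norm (A x0 d) * K"
          using K(2)[of "A x0 d"] BA[OF x0] by simp
        ultimately have "norm d \<le> (norm (A x d) + norm d * S x) * K"
          using K(1) by (meson mult_right_mono order_trans less_imp_le)
        also have "\<dots> = norm (A x d) * K + norm d * (S x * K)" by (simp add: algebra_simps)
        also have "\<dots> \<le> norm (A x d) * K + norm d * (1/2)"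
          using elim(1) by (intro add_left_mono mult_left_mono) auto
        finally show ?thesis by (simp add: field_simps)
      qed
      ultimately show ?case by (simp add: d_def w_def norm_minus_commute)
    qed
    have "((\<lambda>x. 2 * K * norm (A x w - A x0 w)) \<longlongrightarrow> 2 * K * norm (A x0 w - A x0 w)) (at x0)"
      by (intro tendsto_intros AW)
    then have "((\<lambda>x. B x v - B x0 v) \<longlongrightarrow> 0) (at x0)"
      using bound by (auto intro: Lim_null_comparison)
    then show ?thesis by (rule LIM_zero_cancel)
  qed
  show ?thesis using assms(2)
  proof (induction k arbitrary: v)
    case 0
    show ?case using contB assms(1)
      by (simp add: continuous_on_eq_continuous_at isCont_def)
  next
    case (Suc k)
    let ?A' = "\<lambda>w x. frechet_derivative (\<lambda>x. A x w) (at x)"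
    have IH: "Ck_on k (\<lambda>x. B x v) W" for v using Suc Ck_on_Suc_imp by blast
    note DA = Ck_on_SucD[OF Suc.prems]
    have exp: "B x w = (\<Sum>b\<in>Basis. (w \<bullet> b) *\<^sub>R B x b)" if "x \<in> W" for x w
      by (rule linear_basis_expansion[OF linB[OF that]])
    have der: "((\<lambda>x. B x v) has_derivative (\<lambda>h. - B x0 (?A' (B x0 v) x0 h))) (at x0)"
      if x0: "x0 \<in> W" for x0
    proof -
      define w where "w = B x0 v"
      define F where "F = (\<lambda>x. A x w - A x0 w)"
      have dF: "(F has_derivative ?A' w x0) (at x0)"
        unfolding F_def using has_derivative_diff[OF DA(1)[OF x0] has_derivative_const] by simp
      \<comment> \<open>The factor \<open>F x\<close> vanishes at \<open>x0\<close>, so this product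
        rule rests on the continuity of \<open>B\<close> and not on the differentiability that is
        being proved.\<close>
      have prod: "((\<lambda>x. (F x \<bullet> b) *\<^sub>R B x b) has_derivative (\<lambda>h. (?A' w x0 h \<bullet> b) *\<^sub>R B x0 b)) (at x0)"
        for b
      proof -
        define \<phi> where "\<phi> = (\<lambda>x. F x \<bullet> b)"
        define \<phi>' where "\<phi>' = (\<lambda>h. ?A' w x0 h \<bullet> b)"
        have d: "(\<phi> has_derivative \<phi>') (at x0)"
          unfolding \<phi>_def \<phi>'_def by (rule has_derivative_inner_left[OF dF])
        have \<phi>0: "\<phi> x0 = 0" by (simp add: \<phi>_def F_def)
        have m: "((\<lambda>x. \<phi> x *\<^sub>R B x0 b) has_derivative (\<lambda>h. \<phi>' h *\<^sub>R B x0 b)) (at x0)"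
          by (rule has_derivative_scaleR_left[OF d])
        have "((\<lambda>x. \<phi> x *\<^sub>R (B x b - B x0 b)) has_derivative (\<lambda>h. 0)) (at x0)"
        proof -
          obtain C where C: "C > 0" "\<And>h. norm (\<phi>' h) \<le> norm h * C"
            using bounded_linear.pos_bounded[OF has_derivative_bounded_linear[OF d]] by auto
          have q: "((\<lambda>x. (\<phi> x - \<phi>' (x - x0)) / norm (x - x0)) \<longlongrightarrow> 0) (at x0)"
            by (rule tendsto_norm_zero_cancel) (use d \<phi>0 in \<open>simp add: has_derivative_iff_norm\<close>)
          have bd: "eventually (\<lambda>x. norm (\<phi> x / norm (x - x0)) \<le> 1 + C) (at x0)"
          proof -
            have "eventually (\<lambda>x. norm ((\<phi> x - \<phi>' (x - x0)) / norm (x - x0)) < 1) (at x0)"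
              using tendsto_norm_zero[OF q] by (rule order_tendstoD) simp
            moreover have "eventually (\<lambda>x. x \<noteq> x0) (at x0)" by (simp add: eventually_at_filter)
            ultimately show ?thesis
            proof eventually_elim
              case (elim x)
              have "norm (\<phi>' (x - x0) / norm (x - x0)) \<le> C"
                using C(2)[of "x - x0"] elim(2) by (simp add: divide_simps mult.commute)
              moreover have eq: "\<phi> x / norm (x - x0) =
                  (\<phi> x - \<phi>' (x - x0)) / norm (x - x0) + \<phi>' (x - x0) / norm (x - x0)"
                by (simp add: diff_divide_distrib)
              have "norm (\<phi> x / norm (x - x0)) \<le>
                  norm ((\<phi> x - \<phi>' (x - x0)) / norm (x - x0)) + norm (\<phi>' (x - x0) / norm (x - x0))"
                by (subst eq) (rule norm_triangle_ineq)
              ultimately show ?case using elim(1) by argo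
            qed
          qed
          have lim: "((\<lambda>x. (1 + C) * norm (B x b - B x0 b)) \<longlongrightarrow> 0) (at x0)"
            by (intro tendsto_mult_right_zero tendsto_norm_zero LIM_zero contB[OF x0])
          have "((\<lambda>x. norm (\<phi> x *\<^sub>R (B x b - B x0 b)) / norm (x - x0)) \<longlongrightarrow> 0) (at x0)"
          proof (rule Lim_null_comparison[OF _ lim])
            show "eventually (\<lambda>x. norm (norm (\<phi> x *\<^sub>R (B x b - B x0 b)) / norm (x - x0))
                \<le> (1 + C) * norm (B x b - B x0 b)) (at x0)"
              using bd
            proof eventually_elim
              case (elim x)
              then have "norm (\<phi> x / norm (x - x0)) * norm (B x b - B x0 b) \<le> (1 + C) * norm (B x b - B x0 b)"
                by (intro mult_right_mono) auto
              then show ?case by (simp add: abs_mult)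
            qed
          qed
          then show ?thesis using \<phi>0
            by (simp add: has_derivative_iff_norm bounded_linear_zero)
        qed
        from has_derivative_add[OF m this]
        have "((\<lambda>x. \<phi> x *\<^sub>R B x b) has_derivative (\<lambda>h. \<phi>' h *\<^sub>R B x0 b)) (at x0)"
          by (simp add: scaleR_right_diff_distrib)
        then show ?thesis unfolding \<phi>_def \<phi>'_def .
      qed
      \<comment> \<open>Since \<open>A x0 w = v\<close>, one has
        \<open>B x v = w - B x (F x)\<close>, where \<open>B x\<close> is applied to a quantity that
        vanishes at \<open>x0\<close>.\<close>
      have "((\<lambda>x. w - (\<Sum>b\<in>Basis. (F x \<bullet> b) *\<^sub>R B x b)) has_derivative
          (\<lambda>h. 0 - (\<Sum>b\<in>Basis. (?A' w x0 h \<bullet> b) *\<^sub>R B x0 b))) (at x0)"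
        by (intro has_derivative_diff has_derivative_const has_derivative_sum prod)
      then have "((\<lambda>x. w - (\<Sum>b\<in>Basis. (F x \<bullet> b) *\<^sub>R B x b)) has_derivative
          (\<lambda>h. - B x0 (?A' w x0 h))) (at x0)"
        by (simp only: exp[OF x0, symmetric] diff_0)
      then show ?thesis unfolding w_def[symmetric]
      proof (rule has_derivative_transform_within_open[OF _ assms(1) x0])
        fix x assume x: "x \<in> W"
        have "B x (F x) = w - B x v"
          using linear_diff[OF linB[OF x]] BA[OF x] AB[OF x0] by (simp add: F_def w_def)
        then show "w - (\<Sum>b\<in>Basis. (F x \<bullet> b) *\<^sub>R B x b) = B x v"
          by (simp only: exp[OF x, symmetric]) simp
      qed
    qed
    show ?case
    proof (rule Ck_on_SucI[OF assms(1) der])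
      fix h
      have A'exp: "?A' w x h = (\<Sum>c\<in>Basis. (w \<bullet> c) *\<^sub>R ?A' c x h)" if x: "x \<in> W" for w x
      proof -
        have "((\<lambda>x. \<Sum>c\<in>Basis. (w \<bullet> c) *\<^sub>R A x c) has_derivative (\<lambda>h. \<Sum>c\<in>Basis. (w \<bullet> c) *\<^sub>R ?A' c x h)) (at x)"
          by (intro has_derivative_sum has_derivative_scaleR_right DA(1)[OF x])
        then have "((\<lambda>x. A x w) has_derivative (\<lambda>h. \<Sum>c\<in>Basis. (w \<bullet> c) *\<^sub>R ?A' c x h)) (at x)"
        proof (rule has_derivative_transform_within_open[OF _ assms(1) x])
          fix y assume y: "y \<in> W"
          show "(\<Sum>c\<in>Basis. (w \<bullet> c) *\<^sub>R A y c) = A y w"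
            by (rule linear_basis_expansion[OF linA[OF y], symmetric])
        qed
        from frechet_derivative_at[OF this, symmetric] show ?thesis by (rule fun_cong)
      qed
      \<comment> \<open>Both the direction \<open>B x v\<close> and the outer \<open>B x\<close>
        vary with \<open>x\<close>. After expansion every factor is covered by the induction
        hypothesis or is a derivative of \<open>A\<close> with fixed arguments.\<close>
      have e: "- (\<Sum>b\<in>Basis. ((\<Sum>c\<in>Basis. (B x v \<bullet> c) *\<^sub>R ?A' c x h) \<bullet> b) *\<^sub>R B x b)
          = - B x (?A' (B x v) x h)" if "x \<in> W" for x
        by (simp only: exp[OF that, symmetric] A'exp[OF that, of "B x v"])
      have c: "Ck_on k (\<lambda>x. B x v \<bullet> c) W" for c
        by (rule Ck_on_linear[OF assms(1) linear_inner_basis IH])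
      have "Ck_on k (\<lambda>x. \<Sum>c\<in>Basis. (B x v \<bullet> c) *\<^sub>R ?A' c x h) W"
        by (simp only: Ck_on_sum Ck_on_scaleR assms(1) c DA(2))
      from Ck_on_linear[OF assms(1) linear_inner_basis this]
      have "Ck_on k (\<lambda>x. \<Sum>b\<in>Basis. ((\<Sum>c\<in>Basis. (B x v \<bullet> c) *\<^sub>R ?A' c x h) \<bullet> b) *\<^sub>R B x b) W"
        by (simp only: Ck_on_sum Ck_on_scaleR assms(1) IH)
      from Ck_on_linear[OF assms(1) _ this, of uminus]
      show "Ck_on k (\<lambda>x. - B x (?A' (B x v) x h)) W"
        by (intro Ck_on_cong[OF assms(1) _ e]) (simp_all add: linear_iff)
    qed
  qed
qed

section \<open>Smooth inverse functions and slice charts\<close>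

lemma smooth_inverse_function:
  fixes \<psi> :: "'a::euclidean_space \<Rightarrow> 'a"
  assumes "open N" "c \<in> N" "smooth_on \<psi> N" "(\<psi> has_derivative D) (at c)" "inj D"
  obtains W W' \<phi> where "smooth_diffeo \<phi> \<psi> W W'" "c \<in> W'" "W' \<subseteq> N"
proof -
  define \<psi>' where "\<psi>' = (\<lambda>x. Blinfun (frechet_derivative \<psi> (at x)))"
  have der: "(\<psi> has_derivative frechet_derivative \<psi> (at x)) (at x)" if "x \<in> N" for x
    by (rule smooth_on_has_derivative[OF assms(3) that])
  have app: "blinfun_apply (\<psi>' x) = frechet_derivative \<psi> (at x)" if "x \<in> N" for x
    unfolding \<psi>'_def by (rule bounded_linear_Blinfun_apply[OF has_derivative_bounded_linear[OF der[OF that]]])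
  have cont: "continuous_on N \<psi>'"
  proof (rule continuous_on_blinfun_componentwise)
    fix i :: 'a
    have "continuous_on N (\<lambda>x. frechet_derivative \<psi> (at x) i)"
      by (rule smooth_on_continuous[OF smooth_on_frechet_derivative[OF assms(3)]])
    then show "continuous_on N (\<lambda>x. blinfun_apply (\<psi>' x) i)"
      by (simp add: app cong: continuous_on_cong)
  qed
  have Dc: "frechet_derivative \<psi> (at c) = D"
    by (rule frechet_derivative_at[OF assms(4), symmetric])
  obtain D' where D': "linear D'" "\<And>x. D' (D x) = x"
    using linear_injective_left_inverse[OF has_derivative_linear[OF assms(4)] assms(5)]
    by (metis comp_apply id_apply)
  have "Blinfun D' o\<^sub>L \<psi>' c = id_blinfun"
    by (rule blinfun_eqI)
      (simp add: app[OF assms(2)] Dc bounded_linear_Blinfun_apply linear_conv_bounded_linear[THEN iffD1, OF D'(1)] D'(2))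
  from inverse_function_theorem[OF assms(1) _ cont assms(2) this, of \<psi>]
  obtain W' W \<phi> \<phi>' where W: "open W'" "W' \<subseteq> N" "c \<in> W'" "open W" "\<psi> c \<in> W"
    and hom: "homeomorphism W' W \<psi> \<phi>"
    and d: "\<And>y. y \<in> W \<Longrightarrow> (\<phi> has_derivative (\<phi>' y)) (at y)"
    and i: "\<And>y. y \<in> W \<Longrightarrow> \<phi>' y = inv (blinfun_apply (\<psi>' (\<phi> y)))"
    and b: "\<And>y. y \<in> W \<Longrightarrow> bij (blinfun_apply (\<psi>' (\<phi> y)))"
    using der app by metis
  have \<phi>W: "\<phi> y \<in> N" if "y \<in> W" for y
    using hom that W(2) by (auto simp: homeomorphism_def)
  \<comment> \<open>Bootstrapping: \<open>\<phi>' y\<close> is the inverse of the derivative of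
    \<psi> at \<open>\<phi> y\<close>, a family that is as often differentiable as \<phi>. Each
    order of \<phi> therefore passes to its derivative and yields the next one.\<close>
  have "Ck_on k \<phi> W" for k
  proof (induction k)
    case 0
    show ?case using hom by (simp add: homeomorphism_def)
  next
    case (Suc k)
    show ?case
    proof (rule Ck_on_SucI[OF W(4) d])
      fix v
      have "Ck_on k (\<lambda>y. frechet_derivative \<psi> (at (\<phi> y)) w) W" for w
        using smooth_on_frechet_derivative[OF assms(3), of w] \<phi>W
        by (intro Ck_on_compose[OF W(4) assms(1) Suc]) (auto simp: smooth_on_def)
      then show "Ck_on k (\<lambda>y. \<phi>' y v) W"
      proof (rule Ck_on_inverse_operator[OF W(4)])
        fix y assume y: "y \<in> W"
        show "linear (frechet_derivative \<psi> (at (\<phi> y)))"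
          by (rule has_derivative_linear[OF der[OF \<phi>W[OF y]]])
        show "linear (\<phi>' y)" by (rule has_derivative_linear[OF d[OF y]])
        fix w
        show "frechet_derivative \<psi> (at (\<phi> y)) (\<phi>' y w) = w"
          unfolding i[OF y] app[OF \<phi>W[OF y], symmetric]
          by (rule surj_f_inv_f[OF bij_is_surj[OF b[OF y]]])
        show "\<phi>' y (frechet_derivative \<psi> (at (\<phi> y)) w) = w"
          unfolding i[OF y] app[OF \<phi>W[OF y], symmetric]
          by (rule inv_f_f[OF bij_is_inj[OF b[OF y]]])
      qed
    qed
  qed
  then have "smooth_diffeo \<phi> \<psi> W W'"
    using W hom smooth_on_subset[OF assms(3) W(2)]
    by (auto simp: smooth_diffeo_def smooth_on_def homeomorphism_def)
  then show thesis using W that by blast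
qed

lemma smooth_curve_has_vector_derivative_linear:
  assumes "(\<gamma> has_vector_derivative v) (at 0)" "(f has_derivative D) (at (\<gamma> 0))"
  shows "((\<lambda>s. f (\<gamma> s)) has_vector_derivative D v) (at 0)"
proof -
  have "(f \<circ> \<gamma> has_derivative D \<circ> (\<lambda>s. s *\<^sub>R v)) (at 0)"
    using assms by (intro diff_chain_at) (auto simp: has_vector_derivative_def)
  moreover have "D \<circ> (\<lambda>s. s *\<^sub>R v) = (\<lambda>s. s *\<^sub>R D v)"
    using linear_scale[OF has_derivative_linear[OF assms(2)]] by (auto simp: fun_eq_iff)
  ultimately show ?thesis by (simp add: has_vector_derivative_def comp_def)
qed

text \<open>The velocity is a limit of difference quotients, which lie in \<open>V\<close>, and a
  subspace of a Euclidean space is closed.\<close>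

lemma velocity_in_subspace:
  fixes \<gamma> :: "real \<Rightarrow> 'a::euclidean_space"
  assumes "(\<gamma> has_vector_derivative v) (at 0)" "subspace V"
    and "eventually (\<lambda>s. \<gamma> s \<in> V) (at 0)" "\<gamma> 0 \<in> V"
  shows "v \<in> V"
proof -
  have "((\<lambda>h. (\<gamma> (0 + h) - \<gamma> 0) /\<^sub>R h) \<longlongrightarrow> v) (at 0)"
  proof -
    have "((\<lambda>h. norm (\<gamma> h - \<gamma> 0 - h *\<^sub>R v) / norm h) \<longlongrightarrow> 0) (at 0)"
      using assms(1) by (simp add: has_vector_derivative_def has_derivative_iff_norm)
    then have "((\<lambda>h. (\<gamma> h - \<gamma> 0) /\<^sub>R h - v) \<longlongrightarrow> 0) (at 0)"
    proof (rule tendsto_norm_zero_cancel[OF Lim_transform_eventually])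
      have "norm (\<gamma> h - \<gamma> 0 - h *\<^sub>R v) / norm h = norm ((\<gamma> h - \<gamma> 0) /\<^sub>R h - v)" if "h \<noteq> 0" for h
      proof -
        have "(\<gamma> h - \<gamma> 0) /\<^sub>R h - v = (\<gamma> h - \<gamma> 0 - h *\<^sub>R v) /\<^sub>R h"
          using that by (simp add: scaleR_right_diff_distrib)
        then show ?thesis by (simp add: divide_inverse_commute)
      qed
      then show "eventually (\<lambda>h. norm (\<gamma> h - \<gamma> 0 - h *\<^sub>R v) / norm h = norm ((\<gamma> h - \<gamma> 0) /\<^sub>R h - v)) (at 0)"
        by (simp add: eventually_at_filter)
    qed
    then show ?thesis by (simp add: LIM_zero_cancel)
  qed
  moreover have "eventually (\<lambda>h. (\<gamma> (0 + h) - \<gamma> 0) /\<^sub>R h \<in> V) (at 0)"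
    using assms(3) by eventually_elim (simp add: assms subspace_diff subspace_scale)
  ultimately show ?thesis
    using Lim_in_closed_set[OF closed_subspace[OF assms(2)]] by (metis at_neq_bot)
qed

text \<open>The parametrization \<psi> is inverted to a chart. The equivalence \<open>slice\<close>
  also says that no other sheet of \<open>S\<close> meets the image of \<open>N\<close>. For the
  tangent space, a curve in \<open>S\<close> is carried into \<open>V\<close> by the chart, and
  conversely the straight lines in \<open>V\<close> are pushed forward by \<psi>.\<close>

lemma slice_chart:
  fixes \<psi> :: "'a::euclidean_space \<Rightarrow> 'a"
  assumes "open N" "c \<in> N" "smooth_on \<psi> N" and D: "(\<psi> has_derivative D) (at c)" and "inj D"
    and V: "subspace V" "c \<in> V" and slice: "\<And>y. y \<in> N \<Longrightarrow> \<psi> y \<in> S \<longleftrightarrow> y \<in> V"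
  shows "\<exists>W W' \<phi> \<psi>'. smooth_diffeo \<phi> \<psi>' W W' \<and> \<psi> c \<in> W \<and> \<phi> ` (W \<inter> S) = W' \<inter> V"
    and "tangent_space S (\<psi> c) = D ` V"
proof -
  obtain W W' \<phi> where diffeo: "smooth_diffeo \<phi> \<psi> W W'" and c: "c \<in> W'" and sub: "W' \<subseteq> N"
    using smooth_inverse_function[OF assms(1-5)] .
  have o: "open W" "open W'" and img: "\<phi> ` W = W'" "\<psi> ` W' = W"
    and inv: "\<And>x. x \<in> W \<Longrightarrow> \<psi> (\<phi> x) = x" "\<And>y. y \<in> W' \<Longrightarrow> \<phi> (\<psi> y) = y"
    and sm: "smooth_on \<phi> W" "smooth_on \<psi> W'"
    using diffeo by (auto simp: smooth_diffeo_def)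
  have pW: "\<psi> c \<in> W" using c img by auto
  have W'V: "\<phi> x \<in> V \<longleftrightarrow> x \<in> S" if "x \<in> W" for x
    using slice[of "\<phi> x"] that inv(1) img sub by auto
  have "\<phi> ` (W \<inter> S) = W' \<inter> V"
  proof
    show "\<phi> ` (W \<inter> S) \<subseteq> W' \<inter> V" using W'V img by auto
    show "W' \<inter> V \<subseteq> \<phi> ` (W \<inter> S)"
    proof
      fix y assume y: "y \<in> W' \<inter> V"
      then have "\<psi> y \<in> S" using slice[of y] sub by auto
      moreover have "y = \<phi> (\<psi> y)" "\<psi> y \<in> W" using y inv(2) img(2) by auto
      ultimately show "y \<in> \<phi> ` (W \<inter> S)" by blast
    qed
  qed
  then show "\<exists>W W' \<phi> \<psi>'. smooth_diffeo \<phi> \<psi>' W W' \<and> \<psi> c \<in> W \<and> \<phi> ` (W \<inter> S) = W' \<inter> V"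
    using diffeo pW by blast
  show "tangent_space S (\<psi> c) = D ` V"
  proof (intro equalityI subsetI)
    fix v assume "v \<in> tangent_space S (\<psi> c)"
    then obtain \<gamma> e where e: "e > 0" "smooth_on \<gamma> {-e<..<e}" "\<gamma> ` {-e<..<e} \<subseteq> S"
      and \<gamma>: "\<gamma> 0 = \<psi> c" "(\<gamma> has_vector_derivative v) (at 0)"
      by (auto simp: tangent_space_def curve_at_def)
    let ?D\<phi> = "frechet_derivative \<phi> (at (\<psi> c))"
    have d\<phi>: "(\<phi> has_derivative ?D\<phi>) (at (\<psi> c))"
      by (rule smooth_on_has_derivative[OF sm(1) pW])
    have "((\<lambda>s. \<phi> (\<gamma> s)) has_vector_derivative ?D\<phi> v) (at 0)"
      by (rule smooth_curve_has_vector_derivative_linear[OF \<gamma>(2)]) (use d\<phi> \<gamma>(1) in simp)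
    moreover have "eventually (\<lambda>s. \<phi> (\<gamma> s) \<in> V) (at 0)"
    proof -
      have "isCont \<gamma> 0" using \<gamma>(2) by (rule has_vector_derivative_continuous)
      then have "(\<gamma> \<longlongrightarrow> \<psi> c) (at 0)" by (simp add: isCont_def \<gamma>(1))
      then have "eventually (\<lambda>s. \<gamma> s \<in> W) (at 0)" using o(1) pW by (rule topological_tendstoD)
      moreover have "eventually (\<lambda>s. s \<in> {-e<..<e}) (at (0::real))"
        by (rule eventually_at_in_open') (use e(1) in auto)
      ultimately show ?thesis
        by eventually_elim (use W'V e(3) in auto)
    qed
    ultimately have "?D\<phi> v \<in> V"
      by (rule velocity_in_subspace[OF _ V(1)]) (use \<gamma> inv c V in auto)
    moreover have "D (?D\<phi> v) = v"
    proof -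
      have "(\<psi> \<circ> \<phi> has_derivative D \<circ> ?D\<phi>) (at (\<psi> c))"
        by (rule diff_chain_at[OF d\<phi>]) (use D inv c in simp)
      then have "((\<lambda>x. x) has_derivative D \<circ> ?D\<phi>) (at (\<psi> c))"
        by (rule has_derivative_transform_within_open[OF _ o(1) pW]) (use inv in auto)
      then have "D \<circ> ?D\<phi> = (\<lambda>x. x)" using has_derivative_unique has_derivative_ident by blast
      then show ?thesis by (metis comp_apply)
    qed
    ultimately show "v \<in> D ` V" by (metis imageI)
  next
    fix v assume "v \<in> D ` V"
    then obtain w where w: "w \<in> V" "v = D w" by blast
    have "isCont (\<lambda>s. c + s *\<^sub>R w) (0::real)" by (intro continuous_intros)
    then have "((\<lambda>s. c + s *\<^sub>R w) \<longlongrightarrow> c) (at (0::real))" by (simp add: isCont_def)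
    then have "eventually (\<lambda>s. c + s *\<^sub>R w \<in> W') (at (0::real))" using o(2) c by (rule topological_tendstoD)
    then obtain e where e: "e > 0" "\<And>s. s \<noteq> 0 \<Longrightarrow> \<bar>s\<bar> < e \<Longrightarrow> c + s *\<^sub>R w \<in> W'"
      by (auto simp: eventually_at)
    have in': "c + s *\<^sub>R w \<in> W'" if "s \<in> {-e<..<e}" for s
      using e(2)[of s] that c by (cases "s = 0") auto
    have "smooth_on (\<lambda>s. c + s *\<^sub>R w) {-e<..<e}"
      by (intro smooth_on_add smooth_on_const smooth_on_scaleR smooth_on_id) auto
    then have "smooth_on (\<lambda>s. \<psi> (c + s *\<^sub>R w)) {-e<..<e}"
      by (rule smooth_on_compose[OF _ o(2) _ sm(2), rotated]) (use in' in auto)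
    moreover have "(\<lambda>s. \<psi> (c + s *\<^sub>R w)) ` {-e<..<e} \<subseteq> S"
    proof (rule image_subsetI)
      fix s assume "s \<in> {-e<..<e}"
      then have "c + s *\<^sub>R w \<in> N" using in' sub by auto
      then show "\<psi> (c + s *\<^sub>R w) \<in> S" using slice V w by (simp add: subspace_add subspace_scale)
    qed
    moreover have "((\<lambda>s. \<psi> (c + s *\<^sub>R w)) has_vector_derivative D w) (at 0)"
      by (rule smooth_curve_has_vector_derivative_linear)
        (use D in \<open>auto intro!: derivative_eq_intros\<close>)
    ultimately have "curve_at S (\<psi> c) v (\<lambda>s. \<psi> (c + s *\<^sub>R w))"
      using e(1) w(2) by (auto simp: curve_at_def)
    then show "v \<in> tangent_space S (\<psi> c)" by (auto simp: tangent_space_def)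
  qed
qed

section \<open>Symmetry of second derivatives\<close>

lemma second_difference_mean_value:
  fixes g :: "'a::euclidean_space \<Rightarrow> real"
  assumes "smooth_on g W" "h > 0"
    and W: "\<And>s r. 0 \<le> s \<Longrightarrow> s \<le> h \<Longrightarrow> 0 \<le> r \<Longrightarrow> r \<le> h \<Longrightarrow> x + s *\<^sub>R a + r *\<^sub>R b \<in> W"
  obtains s r where "0 < s" "s < h" "0 < r" "r < h"
    "g (x + h *\<^sub>R a + h *\<^sub>R b) - g (x + h *\<^sub>R a) - g (x + h *\<^sub>R b) + g x =
      h * h * frechet_derivative (\<lambda>y. frechet_derivative g (at y) a) (at (x + s *\<^sub>R a + r *\<^sub>R b)) b"
proof -
  let ?g' = "\<lambda>y. frechet_derivative g (at y) a"
  have dir: "((\<lambda>s. f (p + s *\<^sub>R v)) has_real_derivative frechet_derivative f (at (p + s *\<^sub>R v)) v) (at s)"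
    if "smooth_on f W" "p + s *\<^sub>R v \<in> W" for f :: "'a \<Rightarrow> real" and p v s
  proof -
    note d = smooth_on_has_derivative[OF that]
    have "((\<lambda>s. p + s *\<^sub>R v) has_derivative (\<lambda>h. h *\<^sub>R v)) (at s)"
      by (auto intro!: derivative_eq_intros)
    from diff_chain_at[OF this d]
    show ?thesis
      using linear_scale[OF has_derivative_linear[OF d]]
      by (simp add: has_field_derivative_def comp_def mult.commute[of _ "frechet_derivative f _ v"])
  qed
  define \<phi> where "\<phi> = (\<lambda>s. g ((x + h *\<^sub>R b) + s *\<^sub>R a) - g (x + s *\<^sub>R a))"
  have "\<exists>s>0. s < h \<and> \<phi> h - \<phi> 0 = (h - 0) * (?g' ((x + h *\<^sub>R b) + s *\<^sub>R a) - ?g' (x + s *\<^sub>R a))"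
  proof (rule MVT2[OF assms(2)])
    fix s assume s: "0 \<le> s" "s \<le> h"
    show "(\<phi> has_real_derivative (?g' ((x + h *\<^sub>R b) + s *\<^sub>R a) - ?g' (x + s *\<^sub>R a))) (at s)"
      unfolding \<phi>_def using W[OF s, of h] W[OF s, of 0] assms(2)
      by (intro DERIV_diff dir[OF assms(1)]) (auto simp: algebra_simps)
  qed
  then obtain s where s: "0 < s" "s < h"
    and eq1: "\<phi> h - \<phi> 0 = h * (?g' ((x + s *\<^sub>R a) + h *\<^sub>R b) - ?g' ((x + s *\<^sub>R a) + 0 *\<^sub>R b))"
    by (auto simp: algebra_simps)
  have "\<exists>r>0. r < h \<and> ?g' ((x + s *\<^sub>R a) + h *\<^sub>R b) - ?g' ((x + s *\<^sub>R a) + 0 *\<^sub>R b) =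
      (h - 0) * frechet_derivative ?g' (at ((x + s *\<^sub>R a) + r *\<^sub>R b)) b"
    by (rule MVT2[OF assms(2)], rule dir[OF smooth_on_frechet_derivative[OF assms(1)]]) (use W s in auto)
  then show thesis using that s eq1 unfolding \<phi>_def by (auto simp: algebra_simps)
qed

text \<open>The second difference over a small parallelogram is symmetric in \<open>a\<close> and
  \<open>b\<close>. The mean value theorem expresses it by either mixed derivative at some nearby
  point, and continuity forbids distinct values at \<open>x\<close>.\<close>

lemma symmetric_second_derivative:
  fixes g :: "'a::euclidean_space \<Rightarrow> real"
  assumes "smooth_on g W" "open W" "x \<in> W"
  shows "frechet_derivative (\<lambda>y. frechet_derivative g (at y) a) (at x) b =
    frechet_derivative (\<lambda>y. frechet_derivative g (at y) b) (at x) a"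
proof (rule ccontr)
  define F where "F = (\<lambda>a b y. frechet_derivative (\<lambda>y. frechet_derivative g (at y) a) (at y) b)"
  assume "\<not> ?thesis"
  then have ne: "F a b x \<noteq> F b a x" by (simp add: F_def)
  \<comment> \<open>Half the distance, so that the two balls of radius \<epsilon> around the mixed
    derivatives are disjoint.\<close>
  define \<epsilon> where "\<epsilon> = dist (F a b x) (F b a x) / 2"
  have "\<epsilon> > 0" using ne by (simp add: \<epsilon>_def)
  have c: "isCont (F a b) x" for a b
    using smooth_on_continuous[OF smooth_on_frechet_derivative[OF smooth_on_frechet_derivative[OF assms(1)]]]
      assms(2,3) by (simp add: F_def continuous_on_eq_continuous_at)
  have "eventually (\<lambda>y. dist (F a b y) (F a b x) < \<epsilon> \<and> dist (F b a y) (F b a x) < \<epsilon> \<and> y \<in> W) (nhds x)"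
    using c[of a b] c[of b a] \<open>\<epsilon> > 0\<close> assms(2,3)
    by (intro eventually_conj tendstoD[of "F _ _"] eventually_nhds_in_open)
      (auto simp: isCont_def tendsto_nhds_iff continuous_at_imp_continuous_at_within)
  then obtain d where d: "d > 0"
    "\<And>y. dist y x < d \<Longrightarrow> dist (F a b y) (F a b x) < \<epsilon> \<and> dist (F b a y) (F b a x) < \<epsilon> \<and> y \<in> W"
    by (auto simp: eventually_nhds_metric)
  \<comment> \<open>Small enough for the parallelogram of side parameters up to \<open>h\<close> to
    stay within distance \<open>d\<close> of \<open>x\<close>, in either order of \<open>a\<close>
    and \<open>b\<close>; the summand 1 keeps the denominator positive when both vectors
    vanish.\<close>
  define h where "h = d / (2 * (norm a + norm b + 1))"
  have n: "norm a + norm b + 1 > 0" by (smt (verit) norm_ge_zero)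
  have "h > 0" using d(1) n by (simp add: h_def)
  have near: "dist (x + s *\<^sub>R a' + r *\<^sub>R b') x < d"
    if "0 \<le> s" "s \<le> h" "0 \<le> r" "r \<le> h" "{a', b'} = {a, b}" for s r a' b'
  proof -
    have "dist (x + s *\<^sub>R a' + r *\<^sub>R b') x = norm (s *\<^sub>R a' + r *\<^sub>R b')" by (simp add: dist_norm add.assoc)
    also have "\<dots> \<le> norm (s *\<^sub>R a') + norm (r *\<^sub>R b')" by (rule norm_triangle_ineq)
    also have "\<dots> \<le> h * norm a' + h * norm b'"
      using that by (auto intro!: add_mono mult_right_mono)
    also have "\<dots> \<le> h * norm a + h * norm b + h * norm a + h * norm b"
      using that(5) \<open>h > 0\<close> by (auto simp: doubleton_eq_iff)
    also have "\<dots> < h * (2 * (norm a + norm b + 1))"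
      using \<open>h > 0\<close> by (simp add: algebra_simps)
    also have "\<dots> = d" using n by (simp add: h_def)
    finally show ?thesis .
  qed
  obtain s r where sr: "0 < s" "s < h" "0 < r" "r < h"
    "g (x + h *\<^sub>R a + h *\<^sub>R b) - g (x + h *\<^sub>R a) - g (x + h *\<^sub>R b) + g x = h * h * F a b (x + s *\<^sub>R a + r *\<^sub>R b)"
    unfolding F_def by (rule second_difference_mean_value[OF assms(1) \<open>h > 0\<close>, of x a b]) (use near d(2) in auto)
  obtain s' r' where sr': "0 < s'" "s' < h" "0 < r'" "r' < h"
    "g (x + h *\<^sub>R b + h *\<^sub>R a) - g (x + h *\<^sub>R b) - g (x + h *\<^sub>R a) + g x = h * h * F b a (x + s' *\<^sub>R b + r' *\<^sub>R a)"
    unfolding F_def by (rule second_difference_mean_value[OF assms(1) \<open>h > 0\<close>, of x b a])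
      (use d(2)[OF near] in \<open>auto simp: insert_commute\<close>)
  have "g (x + h *\<^sub>R a + h *\<^sub>R b) = g (x + h *\<^sub>R b + h *\<^sub>R a)" by (simp add: algebra_simps)
  with sr(5) sr'(5) have "h * h * F a b (x + s *\<^sub>R a + r *\<^sub>R b) = h * h * F b a (x + s' *\<^sub>R b + r' *\<^sub>R a)"
    by linarith
  then have eq: "F a b (x + s *\<^sub>R a + r *\<^sub>R b) = F b a (x + s' *\<^sub>R b + r' *\<^sub>R a)" using \<open>h > 0\<close> by simp
  have "dist (F a b (x + s *\<^sub>R a + r *\<^sub>R b)) (F a b x) < \<epsilon>"
    "dist (F b a (x + s' *\<^sub>R b + r' *\<^sub>R a)) (F b a x) < \<epsilon>"
    using d(2)[OF near[of s r a b]] d(2)[OF near[of s' r' b a]] sr sr' by auto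
  then show False unfolding eq \<epsilon>_def
    using dist_triangle3[of "F a b x" "F b a x" "F b a (x + s' *\<^sub>R b + r' *\<^sub>R a)"] by (simp add: dist_commute)
qed

lemma curve_at_eventually:
  assumes "curve_at S p v \<gamma>" "open W" "p \<in> W"
  shows "eventually (\<lambda>s. \<gamma> s \<in> S \<inter> W) (nhds 0)"
proof -
  obtain e where e: "e > 0" "\<gamma> ` {-e<..<e} \<subseteq> S" and \<gamma>: "\<gamma> 0 = p" "(\<gamma> has_vector_derivative v) (at 0)"
    using assms(1) by (auto simp: curve_at_def)
  have "(\<gamma> \<longlongrightarrow> p) (nhds 0)"
    using has_vector_derivative_continuous[OF \<gamma>(2)] \<gamma>(1) by (simp add: isCont_def tendsto_nhds_iff)
  then have "eventually (\<lambda>s. \<gamma> s \<in> W) (nhds 0)" using assms(2,3) by (rule topological_tendstoD)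
  moreover have "eventually (\<lambda>s. s \<in> {-e<..<e}) (nhds 0)"
    by (rule eventually_nhds_in_open) (use e in auto)
  ultimately show ?thesis by eventually_elim (use e in auto)
qed

text \<open>Product rule for a derivative evaluated on a moving vector: the Hessian with the
  direction frozen, plus the first derivative applied to the change of direction. It serves to
  differentiate \<open>Df\<close> along the fields \<open>[A, x]\<close>.\<close>

lemma has_derivative_frechet_derivative_apply:
  fixes g :: "'a::euclidean_space \<Rightarrow> real"
  assumes "smooth_on g W" "open W" "x \<in> W" "(w has_derivative w') (at x)"
  shows "((\<lambda>y. frechet_derivative g (at y) (w y)) has_derivative
    (\<lambda>h. frechet_derivative (\<lambda>y. frechet_derivative g (at y) (w x)) (at x) h
      + frechet_derivative g (at x) (w' h))) (at x)"
proof -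
  let ?d = "\<lambda>v y. frechet_derivative g (at y) v"
  have lin: "linear (frechet_derivative g (at y))" if "y \<in> W" for y
    by (rule has_derivative_linear[OF smooth_on_has_derivative[OF assms(1) that]])
  have d: "(?d v has_derivative frechet_derivative (?d v) (at x)) (at x)" for v
    by (rule smooth_on_has_derivative[OF smooth_on_frechet_derivative[OF assms(1)] assms(3)])
  have exp: "?d v y = (\<Sum>b\<in>Basis. (v \<bullet> b) *\<^sub>R ?d b y)" if "y \<in> W" for v y
    by (rule linear_basis_expansion[OF lin[OF that]])
  have "((\<lambda>y. \<Sum>b\<in>Basis. (w y \<bullet> b) *\<^sub>R ?d b y) has_derivative
      (\<lambda>h. \<Sum>b\<in>Basis. (w x \<bullet> b) *\<^sub>R frechet_derivative (?d b) (at x) h + (w' h \<bullet> b) *\<^sub>R ?d b x)) (at x)"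
    by (intro has_derivative_sum has_derivative_scaleR has_derivative_inner_left assms(4) d)
  then have "((\<lambda>y. ?d (w y) y) has_derivative
      (\<lambda>h. \<Sum>b\<in>Basis. (w x \<bullet> b) *\<^sub>R frechet_derivative (?d b) (at x) h + (w' h \<bullet> b) *\<^sub>R ?d b x)) (at x)"
    by (rule has_derivative_transform_within_open[OF _ assms(2,3)]) (rule exp[symmetric])
  moreover have "frechet_derivative (?d (w x)) (at x) =
      (\<lambda>h. \<Sum>b\<in>Basis. (w x \<bullet> b) *\<^sub>R frechet_derivative (?d b) (at x) h)"
  proof (rule frechet_derivative_at[symmetric])
    have "((\<lambda>y. \<Sum>b\<in>Basis. (w x \<bullet> b) *\<^sub>R ?d b y) has_derivative
      (\<lambda>h. \<Sum>b\<in>Basis. (w x \<bullet> b) *\<^sub>R frechet_derivative (?d b) (at x) h)) (at x)"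
      by (intro has_derivative_sum has_derivative_scaleR_right d)
    then show "(?d (w x) has_derivative
      (\<lambda>h. \<Sum>b\<in>Basis. (w x \<bullet> b) *\<^sub>R frechet_derivative (?d b) (at x) h)) (at x)"
      by (rule has_derivative_transform_within_open[OF _ assms(2,3)]) (rule exp[symmetric])
  qed
  ultimately show ?thesis by (simp only: sum.distrib exp[OF assms(3), symmetric])
qed

section \<open>Exponentials of linear operators\<close>

definition op_exp :: "('a::euclidean_space \<Rightarrow> 'a) \<Rightarrow> 'a \<Rightarrow> 'a" where
  "op_exp N z = (\<Sum>k. (N ^^ k) z /\<^sub>R fact k)"

lemma linear_funpow:
  fixes N :: "'a::real_vector \<Rightarrow> 'a"
  assumes "linear N"
  shows "linear (N ^^ k)"
proof (induction k)
  case 0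
  show ?case by (simp add: linear_iff)
next
  case (Suc k)
  then show ?case using linear_compose[OF Suc assms] by (simp add: comp_def)
qed

lemma summable_op_exp:
  fixes N :: "'a::euclidean_space \<Rightarrow> 'a"
  assumes "linear N"
  shows "summable (\<lambda>k. norm ((N ^^ k) z /\<^sub>R fact k))"
proof -
  obtain C where C: "C \<ge> 0" "\<And>v. norm (N v) \<le> norm v * C"
    using bounded_linear.nonneg_bounded[OF linear_conv_bounded_linear[THEN iffD1, OF assms]] by auto
  have "norm ((N ^^ k) z) \<le> C ^ k * norm z" for k
  proof (induction k)
    case (Suc k)
    have "norm ((N ^^ Suc k) z) \<le> norm ((N ^^ k) z) * C" using C(2) by simp
    also have "\<dots> \<le> (C ^ k * norm z) * C" using Suc C(1) by (rule mult_right_mono)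
    finally show ?case by (simp add: mult_ac)
  qed simp
  then have "inverse (fact k) * norm ((N ^^ k) z) \<le> inverse (fact k) * (C ^ k * norm z)" for k
    by (rule mult_left_mono) simp
  then have "norm (norm ((N ^^ k) z /\<^sub>R fact k)) \<le> (C ^ k /\<^sub>R fact k) * norm z" for k
    by (simp add: mult.assoc)
  then show ?thesis
    by (rule summable_comparison_test'[OF summable_mult2[OF summable_exp_generic]])
qed

lemma op_exp_sums: "linear N \<Longrightarrow> (\<lambda>k. (N ^^ k) z /\<^sub>R fact k) sums op_exp N z"
  unfolding op_exp_def by (rule summable_sums[OF summable_norm_cancel[OF summable_op_exp]])

text \<open>The relation passes through every term of the series. With \<open>M\<close> a complex
  scalar it gives complex linearity, with \<open>M\<close> the operator itself it lets the operator
  commute with its exponentials.\<close>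

lemma op_exp_intertwine:
  assumes "linear N" "linear M" "\<And>z. M (N z) = N' (M z)"
  shows "M (op_exp N z) = op_exp N' (M z)"
proof -
  have "M ((N ^^ k) z) = (N' ^^ k) (M z)" for k by (induction k) (simp_all add: assms(3))
  then have "(\<lambda>k. (N' ^^ k) (M z) /\<^sub>R fact k) sums M (op_exp N z)"
    using bounded_linear.sums[OF linear_conv_bounded_linear[THEN iffD1, OF assms(2)] op_exp_sums[OF assms(1), of z]]
    by (simp add: linear_scale[OF assms(2)])
  then show ?thesis unfolding op_exp_def by (rule sums_unique)
qed

lemma linear_op_exp:
  assumes "linear N"
  shows "linear (op_exp N)"
proof (rule linearI)
  fix x y :: 'a and r :: real
  have "(\<lambda>k. (N ^^ k) x /\<^sub>R fact k + (N ^^ k) y /\<^sub>R fact k) sums (op_exp N x + op_exp N y)"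
    by (intro sums_add op_exp_sums assms)
  then show "op_exp N (x + y) = op_exp N x + op_exp N y"
    using sums_unique2[OF op_exp_sums[OF assms, of "x + y"]]
    by (simp add: linear_add[OF linear_funpow[OF assms]] scaleR_add_right)
  have "(\<lambda>k. r *\<^sub>R ((N ^^ k) x /\<^sub>R fact k)) sums (r *\<^sub>R op_exp N x)"
    by (intro sums_scaleR_right op_exp_sums assms)
  then show "op_exp N (r *\<^sub>R x) = r *\<^sub>R op_exp N x"
    using sums_unique2[OF op_exp_sums[OF assms, of "r *\<^sub>R x"]]
    by (simp add: linear_scale[OF linear_funpow[OF assms]] scaleR_left_commute mult.commute)
qed

lemma op_exp_in_subspace:
  assumes "linear N" "subspace V" "\<And>v. v \<in> V \<Longrightarrow> N v \<in> V" "z \<in> V"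
  shows "op_exp N z \<in> V"
proof -
  have "(N ^^ k) z \<in> V" for k using assms by (induction k) auto
  then have "(\<Sum>k<n. (N ^^ k) z /\<^sub>R fact k) \<in> V" for n
    by (intro subspace_sum[OF assms(2)] subspace_scale[OF assms(2)])
  then show ?thesis
    using op_exp_sums[OF assms(1), of z] unfolding sums_def
    by (rule closed_sequentially[OF closed_subspace[OF assms(2)]])
qed

lemma op_exp_0: "op_exp (\<lambda>z. 0) (z :: 'a::euclidean_space) = z"
proof -
  let ?Z = "\<lambda>z :: 'a. 0 :: 'a"
  have "(\<lambda>k. (?Z ^^ k) z /\<^sub>R fact k) sums (\<Sum>k\<in>{0}. (?Z ^^ k) z /\<^sub>R fact k)"
  proof (rule sums_finite)
    fix k :: nat assume "k \<notin> {0}"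
    then show "(?Z ^^ k) z /\<^sub>R fact k = 0" by (cases k) auto
  qed simp
  then show ?thesis unfolding op_exp_def by (simp add: sums_iff)
qed

lemma op_exp_has_vector_derivative:
  assumes "linear N"
  shows "((\<lambda>s. op_exp (\<lambda>z. s *\<^sub>R N z) z) has_vector_derivative op_exp (\<lambda>z. s *\<^sub>R N z) (N z)) (at s)"
proof -
  have linN: "linear (\<lambda>z. s *\<^sub>R N z)" for s using assms linear_compose_scale_right by blast
  have pow: "((\<lambda>z. s *\<^sub>R N z) ^^ k) v = s ^ k *\<^sub>R (N ^^ k) v" for s k v
    by (induction k) (simp_all add: linear_scale[OF assms])
  \<comment> \<open>Each coordinate is an ordinary real power series in \<open>s\<close>, so
    differentiation under the sum is available; the factor \<open>k + 1\<close> it produces cancels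
    in the factorial and leaves the series for \<open>N z\<close>.\<close>
  have comp: "(\<lambda>k. (((N ^^ k) v \<bullet> b) / fact k) * s ^ k) sums (op_exp (\<lambda>z. s *\<^sub>R N z) v \<bullet> b)" for v b s
    using bounded_linear.sums[OF bounded_linear_inner_left op_exp_sums[OF linN[of s], of v], of b]
    by (simp add: pow divide_inverse mult_ac)
  have "((\<lambda>s. op_exp (\<lambda>z. s *\<^sub>R N z) z \<bullet> b) has_real_derivative
      (op_exp (\<lambda>z. s *\<^sub>R N z) (N z) \<bullet> b)) (at s)" for b
  proof -
    let ?c = "\<lambda>k. ((N ^^ k) z \<bullet> b) / fact k"
    have "((\<lambda>s. \<Sum>k. ?c k * s ^ k) has_real_derivative (\<Sum>k. diffs ?c k * s ^ k)) (at s)"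
      by (rule termdiffs_strong_converges_everywhere) (rule sums_summable[OF comp])
    moreover have "diffs ?c k = ((N ^^ k) (N z) \<bullet> b) / fact k" for k
      by (simp add: diffs_def funpow_swap1 field_simps del: of_nat_Suc)
    ultimately show ?thesis by (simp add: sums_unique[OF comp])
  qed
  then have "((\<lambda>s. op_exp (\<lambda>z. s *\<^sub>R N z) z \<bullet> b) has_derivative
      (\<lambda>h. (h *\<^sub>R op_exp (\<lambda>z. s *\<^sub>R N z) (N z)) \<bullet> b)) (at s)" for b
    by (simp add: has_field_derivative_def mult.commute[of _ "_ \<bullet> _"])
  then show ?thesis
    unfolding has_vector_derivative_def
    by (subst has_derivative_componentwise_within) blast
qed

text \<open>The operator varies by a scalar factor alone, so the exponent commutes with its own
  derivative and the usual formula holds. Charts are products of such one-parameter factors for this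
  reason.\<close>

lemma op_exp_has_derivative:
  fixes N :: "'b::euclidean_space \<Rightarrow> 'b" and w :: "'a::euclidean_space \<Rightarrow> 'b"
  assumes "linear N" "(f has_derivative f') (at x)" "(w has_derivative w') (at x)"
  shows "((\<lambda>x. op_exp (\<lambda>z. f x *\<^sub>R N z) (w x)) has_derivative
    (\<lambda>h. f' h *\<^sub>R op_exp (\<lambda>z. f x *\<^sub>R N z) (N (w x)) + op_exp (\<lambda>z. f x *\<^sub>R N z) (w' h))) (at x)"
proof -
  let ?e = "\<lambda>s. op_exp (\<lambda>z. s *\<^sub>R N z)"
  have linE: "linear (?e s)" for s
    by (rule linear_op_exp) (use assms(1) linear_compose_scale_right in blast)
  have eN: "linear (\<lambda>v. ?e s (N v))" for s
    using linear_compose[OF assms(1) linE[of s]] by (simp add: comp_def)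
  have d: "((\<lambda>x. ?e (f x) b) has_derivative (\<lambda>h. f' h *\<^sub>R ?e (f x) (N b))) (at x)" for b
    using diff_chain_at[OF assms(2), of "\<lambda>s. ?e s b"] op_exp_has_vector_derivative[OF assms(1), of b "f x"]
    by (simp add: has_vector_derivative_def comp_def)
  have "((\<lambda>x. \<Sum>b\<in>Basis. (w x \<bullet> b) *\<^sub>R ?e (f x) b) has_derivative
      (\<lambda>h. \<Sum>b\<in>Basis. (w x \<bullet> b) *\<^sub>R (f' h *\<^sub>R ?e (f x) (N b)) + (w' h \<bullet> b) *\<^sub>R ?e (f x) b)) (at x)"
    by (intro has_derivative_sum has_derivative_scaleR has_derivative_inner_left assms(3) d)
  moreover have "(\<Sum>b\<in>Basis. (w x \<bullet> b) *\<^sub>R (f' h *\<^sub>R ?e (f x) (N b)) + (w' h \<bullet> b) *\<^sub>R ?e (f x) b) =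
      f' h *\<^sub>R ?e (f x) (N (w x)) + ?e (f x) (w' h)" for h
    unfolding linear_basis_expansion[OF eN, of _ "w x"] linear_basis_expansion[OF linE, of _ "w' h"]
    by (simp add: sum.distrib scaleR_sum_right scaleR_left_commute mult.commute)
  moreover have "(\<Sum>b\<in>Basis. (w x \<bullet> b) *\<^sub>R ?e (f x) b) = ?e (f x) (w x)" for x
    by (rule linear_basis_expansion[OF linE, symmetric])
  ultimately show ?thesis by (simp only:)
qed

lemma smooth_on_op_exp:
  fixes N :: "'b::euclidean_space \<Rightarrow> 'b" and w :: "'a::euclidean_space \<Rightarrow> 'b"
  assumes "linear N" "open W" "smooth_on f W" "smooth_on w W"
  shows "smooth_on (\<lambda>x. op_exp (\<lambda>z. f x *\<^sub>R N z) (w x)) W"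
proof -
  let ?e = "\<lambda>s. op_exp (\<lambda>z. s *\<^sub>R N z)"
  have linE: "linear (?e s)" for s
    by (rule linear_op_exp) (use assms(1) linear_compose_scale_right in blast)
  have "Ck_on k (\<lambda>s. ?e s b) UNIV" for k b
  proof (induction k arbitrary: b)
    case 0
    show ?case
      using has_vector_derivative_continuous[OF op_exp_has_vector_derivative[OF assms(1)]]
      by (simp add: continuous_on_eq_continuous_at)
  next
    case (Suc k)
    show ?case
    proof (rule Ck_on_SucI[where f' = "\<lambda>s h. h *\<^sub>R ?e s (N b)"])
      show "((\<lambda>s. ?e s b) has_derivative (\<lambda>h. h *\<^sub>R ?e s (N b))) (at s)" for s
        using op_exp_has_vector_derivative[OF assms(1)] by (simp add: has_vector_derivative_def)
      show "Ck_on k (\<lambda>s. h *\<^sub>R ?e s (N b)) UNIV" for h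
        by (intro Ck_on_scaleR Ck_on_const Suc) auto
    qed auto
  qed
  then have "smooth_on (\<lambda>s. ?e s b) UNIV" for b by (simp add: smooth_on_def)
  then have e: "smooth_on (\<lambda>x. ?e (f x) b) W" for b
    using smooth_on_compose[OF assms(2) open_UNIV assms(3)] by blast
  have "smooth_on (\<lambda>x. w x \<bullet> b) W" for b
    by (rule smooth_on_linear[OF assms(2) linear_inner_basis assms(4)])
  then have "smooth_on (\<lambda>x. \<Sum>b\<in>Basis. (w x \<bullet> b) *\<^sub>R ?e (f x) b) W"
    using e assms(2) by (simp only: smooth_on_sum smooth_on_scaleR)
  then show ?thesis by (simp only: linear_basis_expansion[OF linE, symmetric])
qed

text \<open>Along a solution the curve \<open>exp (- s N) (\<gamma> s)\<close> has derivative zero.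
  Both the inverse of an exponential and its compatibility with the bracket are obtained from
  this.\<close>

lemma op_exp_ode_unique:
  assumes "linear N" "\<And>s. (\<gamma> has_vector_derivative N (\<gamma> s)) (at s)"
  shows "op_exp (\<lambda>z. (- s) *\<^sub>R N z) (\<gamma> s) = \<gamma> 0"
proof -
  let ?e = "\<lambda>s. op_exp (\<lambda>z. s *\<^sub>R N z)"
  have linE: "linear (?e s)" for s
    by (rule linear_op_exp) (use assms(1) linear_compose_scale_right in blast)
  have "((\<lambda>s. ?e (- s) (\<gamma> s)) has_derivative (\<lambda>h. 0)) (at s within UNIV)" for s
  proof -
    have "((\<lambda>s. - s) has_derivative (\<lambda>h. - h)) (at s)" by (auto intro!: derivative_eq_intros)
    from op_exp_has_derivative[OF assms(1) this assms(2)[unfolded has_vector_derivative_def]]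
    show ?thesis by (simp only: linear_scale[OF linE]) simp
  qed
  then obtain c where "\<And>s. ?e (- s) (\<gamma> s) = c"
    using has_derivative_zero_constant[of UNIV "\<lambda>s. ?e (- s) (\<gamma> s)"] by auto
  from this[of s] this[of 0] show ?thesis by (simp add: op_exp_0)
qed

lemma op_exp_minus:
  assumes "linear N"
  shows "op_exp (\<lambda>z. - N z) (op_exp N z) = z"
proof -
  have "((\<lambda>s. op_exp (\<lambda>z. s *\<^sub>R N z) z) has_vector_derivative N (op_exp (\<lambda>z. s *\<^sub>R N z) z)) (at s)" for s
    using op_exp_has_vector_derivative[OF assms]
      op_exp_intertwine[of "\<lambda>z. s *\<^sub>R N z" N "\<lambda>z. s *\<^sub>R N z" z]
    by (simp add: assms linear_compose_scale_right linear_scale[OF assms])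
  from op_exp_ode_unique[OF assms this, of 1] show ?thesis by (simp add: op_exp_0)
qed

section \<open>Spectral theory of complex linear operators\<close>

abbreviation clinear :: "(complex ^ 'n::finite \<Rightarrow> complex ^ 'n) \<Rightarrow> bool" where
  "clinear N \<equiv> Vector_Spaces.linear (*s) (*s) N"

lemma scaleR_eq_vector_scalar_mult: "r *\<^sub>R (v :: complex ^ 'n) = complex_of_real r *s v"
  by (simp add: vec_eq_iff) (simp add: scaleR_conv_of_real)

lemma clinearI:
  "(\<And>x y. N (x + y) = N x + N y) \<Longrightarrow> (\<And>c x. N (c *s x) = c *s N x) \<Longrightarrow> clinear N"
  by unfold_locales auto

lemma clinear_add: "clinear N \<Longrightarrow> N (x + y) = N x + N y"
  and clinear_scale: "clinear N \<Longrightarrow> N (c *s x) = c *s N x"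
  and clinear_zero: "clinear N \<Longrightarrow> N 0 = 0"
  and clinear_diff: "clinear N \<Longrightarrow> N (x - y) = N x - N y"
  and clinear_minus: "clinear N \<Longrightarrow> N (- x) = - N x"
  by (rule vec.linear_add vec.linear_scale vec.linear_0 vec.linear_diff vec.linear_neg, assumption)+

lemma clinear_imp_linear: "clinear N \<Longrightarrow> linear N"
  by (rule linearI) (simp_all add: clinear_add clinear_scale scaleR_eq_vector_scalar_mult)

lemma clinear_compose: "clinear M \<Longrightarrow> clinear N \<Longrightarrow> clinear (\<lambda>x. M (N x))"
  by (intro clinearI) (simp_all add: clinear_add clinear_scale)

lemma clinear_funpow: "clinear N \<Longrightarrow> clinear (N ^^ k)"
proof (induction k)
  case 0
  show ?case by (intro clinearI) auto
next
  case (Suc k)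
  then show ?case using clinear_compose[of N "N ^^ k"] by (simp add: comp_def)
qed

text \<open>The powers of \<open>N\<close> up to the dimension of the matrix space are too many to
  be independent. Counting the real dimension gives real coefficients, so the polynomials derived
  from them respect the real subspaces \<open>u\<close> and \<open>i u\<close>.\<close>

lemma annihilating_coefficients:
  fixes N :: "complex ^ 'n \<Rightarrow> complex ^ 'n"
  assumes "clinear N"
  obtains n :: nat and c :: "nat \<Rightarrow> real" and k where "k \<le> n" "c k \<noteq> 0"
    "\<And>v. (\<Sum>i\<le>n. c i *\<^sub>R (N ^^ i) v) = 0"
proof -
  define n where "n = DIM(complex ^ 'n ^ 'n)"
  define m where "m = (\<lambda>i. matrix (N ^^ i))"
  have "\<exists>c :: nat \<Rightarrow> real. (\<exists>k\<le>n. c k \<noteq> 0) \<and> (\<Sum>i\<le>n. c i *\<^sub>R m i) = 0"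
  proof (cases "inj_on m {..n}")
    case True
    then have "card (m ` {..n}) > DIM(complex ^ 'n ^ 'n)" by (simp add: card_image n_def)
    then have "dependent (m ` {..n})" by (intro dependent_biggerset) auto
    then obtain d v where d: "v \<in> m ` {..n}" "d v \<noteq> 0" "(\<Sum>v\<in>m ` {..n}. d v *\<^sub>R v) = 0"
      using dependent_finite[of "m ` {..n}"] by auto
    then have "(\<Sum>i\<le>n. d (m i) *\<^sub>R m i) = 0" using sum.reindex[OF True, of "\<lambda>v. d v *\<^sub>R v"] by simp
    then show ?thesis using d by (intro exI[of _ "\<lambda>i. d (m i)"]) auto
  next
    \<comment> \<open>If two powers coincide, the set of powers may be too small for the dimension
      count, but the difference of the two is already a relation.\<close>
    case False
    then obtain i j where ij: "i \<le> n" "j \<le> n" "i \<noteq> j" "m i = m j" by (auto simp: inj_on_def)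
    define c where "c = (\<lambda>k. if k = i then 1 else if k = j then - 1 else (0::real))"
    have "(\<Sum>k\<le>n. c k *\<^sub>R m k) = (\<Sum>k\<le>n. (if k = i then m i else 0) - (if k = j then m j else 0))"
      using ij(3) by (intro sum.cong) (auto simp: c_def)
    also have "\<dots> = 0" using ij by (simp add: sum_subtractf)
    finally show ?thesis using ij by (intro exI[of _ c]) (auto simp: c_def intro!: exI[of _ i])
  qed
  then obtain c k where c: "k \<le> n" "c k \<noteq> 0" "(\<Sum>i\<le>n. c i *\<^sub>R m i) = 0" by blast
  have "(\<Sum>i\<le>n. c i *\<^sub>R (N ^^ i) v) = 0" for v
  proof -
    have lin: "linear (\<lambda>A :: complex ^ 'n ^ 'n. A *v v)"
      by (rule linearI) (simp_all add: matrix_vector_mult_def vec_eq_iff scaleR_sum_right distrib_right sum.distrib)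
    have "(\<Sum>i\<le>n. c i *\<^sub>R (N ^^ i) v) = (\<Sum>i\<le>n. (c i *\<^sub>R m i) *v v)"
      unfolding linear_scale[OF lin] by (simp add: m_def matrix_works[OF clinear_funpow[OF assms]])
    also have "\<dots> = (\<Sum>i\<le>n. c i *\<^sub>R m i) *v v"
      by (rule linear_sum[OF lin, symmetric])
    finally show ?thesis by (simp add: c(3))
  qed
  then show thesis using that c by blast
qed

text \<open>After removal of its lowest power, the annihilating polynomial has a nonzero constant
  coefficient. As all powers of \<open>N\<close> have kernel inside that of \<open>N\<close>, the
  value of the reduced polynomial at \<open>v\<close> is killed by \<open>N\<close>; solving for
  \<open>v\<close> expresses it modulo the kernel by a polynomial without constant term.\<close>

lemma range_projection_coefficients:
  fixes N :: "complex ^ 'n \<Rightarrow> complex ^ 'n"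
  assumes "clinear N" "\<And>v. N (N v) = 0 \<Longrightarrow> N v = 0"
  obtains m :: nat and d :: "nat \<Rightarrow> real" where "\<And>v. N (v - (\<Sum>i<m. d i *\<^sub>R (N ^^ Suc i) v)) = 0"
proof -
  obtain n c k where c: "k \<le> n" "c k \<noteq> 0" and ann: "\<And>v. (\<Sum>i\<le>n. c i *\<^sub>R (N ^^ i) v) = 0"
    using annihilating_coefficients[OF assms(1)] by metis
  define j where "j = (LEAST j. c j \<noteq> 0)"
  have cj: "c j \<noteq> 0" "j \<le> n" "\<And>i. i < j \<Longrightarrow> c i = 0"
    unfolding j_def using c LeastI[of "\<lambda>j. c j \<noteq> 0" k] Least_le[of "\<lambda>j. c j \<noteq> 0" k] not_less_Least by auto
  have ker: "(N ^^ i) w = 0 \<Longrightarrow> N w = 0" for i w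
  proof (induction i)
    case (Suc i)
    show ?case
    proof (cases i)
      case (Suc l)
      with Suc.prems assms(2)[of "(N ^^ l) w"] Suc.IH show ?thesis by simp
    qed (use Suc in auto)
  qed (simp add: clinear_zero[OF assms(1)])
  \<comment> \<open>Coefficients of the reduced polynomial divided by minus its constant coefficient
    \<open>c j\<close>; the shift by one accounts for the missing constant term.\<close>
  define d where "d = (\<lambda>i. - c (Suc i + j) / c j)"
  have "N (v - (\<Sum>i<n - j. d i *\<^sub>R (N ^^ Suc i) v)) = 0" for v
  proof -
    define w where "w = (\<Sum>i\<le>n - j. c (i + j) *\<^sub>R (N ^^ i) v)"
    have "(\<Sum>i\<le>n. c i *\<^sub>R (N ^^ i) v) = (\<Sum>i\<in>{j..n}. c i *\<^sub>R (N ^^ i) v)"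
      using cj(3) by (intro sum.mono_neutral_right) (auto simp: not_le)
    also have "\<dots> = (\<Sum>i\<in>{0..n - j}. c (i + j) *\<^sub>R (N ^^ (i + j)) v)"
      using cj(2) sum.shift_bounds_cl_nat_ivl[of "\<lambda>i. c i *\<^sub>R (N ^^ i) v" 0 j "n - j"] by simp
    also have "\<dots> = (N ^^ j) w"
      unfolding w_def linear_sum[OF linear_funpow[OF clinear_imp_linear[OF assms(1)]], of j]
      by (simp add: linear_scale[OF linear_funpow[OF clinear_imp_linear[OF assms(1)]]]
          atLeast0AtMost add.commute[of _ j] funpow_add)
    finally have "N w = 0" using ann ker by simp
    moreover have "w = c j *\<^sub>R (v - (\<Sum>i<n - j. d i *\<^sub>R (N ^^ Suc i) v))"
      using cj(1) unfolding w_def d_def lessThan_Suc_atMost[symmetric] sum.lessThan_Suc_shift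
      by (simp add: scaleR_diff_right scaleR_add_right scaleR_sum_right sum_negf)
    ultimately show ?thesis using cj(1) by (simp add: linear_scale[OF clinear_imp_linear[OF assms(1)]])
  qed
  then show thesis using that by blast
qed

definition peval :: "(complex ^ 'n \<Rightarrow> complex ^ 'n) \<Rightarrow> complex poly \<Rightarrow> complex ^ 'n \<Rightarrow> complex ^ 'n" where
  "peval N p v = (\<Sum>i\<le>degree p. coeff p i *s (N ^^ i) v)"

lemma peval_bound: "degree p \<le> m \<Longrightarrow> peval N p v = (\<Sum>i\<le>m. coeff p i *s (N ^^ i) v)"
  unfolding peval_def by (rule sum.mono_neutral_left) (auto simp: coeff_eq_0)

lemma peval_linear_factor:
  assumes "clinear N"
  shows "peval N ([:- a, 1:] * q) v = peval N q (N v - a *s v)"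
proof -
  have deg: "degree ([:- a, 1:] * q) \<le> Suc (degree q)"
    using degree_mult_le[of "[:- a, 1:]" q] by simp
  have "coeff ([:- a, 1:] * q) i = (if i = 0 then 0 else coeff q (i - 1)) - a * coeff q i" for i
    by (cases i) simp_all
  then have "peval N ([:- a, 1:] * q) v =
      (\<Sum>i\<le>Suc (degree q). (if i = 0 then 0 else coeff q (i - 1)) *s (N ^^ i) v)
      - (\<Sum>i\<le>Suc (degree q). (a * coeff q i) *s (N ^^ i) v)"
    unfolding peval_bound[OF deg] by (simp only: vec.scale_left_diff_distrib sum_subtractf)
  also have "(\<Sum>i\<le>Suc (degree q). (if i = 0 then 0 else coeff q (i - 1)) *s (N ^^ i) v) =
      (\<Sum>i\<le>degree q. coeff q i *s (N ^^ i) (N v))"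
    by (subst sum.atMost_Suc_shift) (simp add: funpow_swap1)
  also have "(\<Sum>i\<le>Suc (degree q). (a * coeff q i) *s (N ^^ i) v) =
      (\<Sum>i\<le>degree q. (a * coeff q i) *s (N ^^ i) v)" by (simp add: coeff_eq_0)
  finally show ?thesis
    unfolding peval_def
    by (simp add: sum_subtractf[symmetric] clinear_diff[OF clinear_funpow[OF assms]]
        clinear_scale[OF clinear_funpow[OF assms]] vec.scale_right_diff_distrib mult.commute)
qed

text \<open>Linear factors are split off one at a time. If \<open>N - a\<close> kills the current
  vector, that vector is an eigenvector; otherwise its image is a nonzero vector of \<open>E\<close>
  killed by a polynomial of smaller degree. A nonzero constant kills no nonzero vector, which ends
  the induction.\<close>

lemma eigenvector_of_peval_zero:
  fixes N :: "complex ^ 'n \<Rightarrow> complex ^ 'n"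
  assumes "clinear N" "vec.subspace E" "\<And>v. v \<in> E \<Longrightarrow> N v \<in> E"
    and "p \<noteq> 0" "v \<in> E" "v \<noteq> 0" "peval N p v = 0"
  shows "\<exists>w\<in>E. \<exists>\<mu>. w \<noteq> 0 \<and> N w = \<mu> *s w"
  using assms(4-7)
proof (induction "degree p" arbitrary: p v)
  case 0
  then obtain a where "p = [:a:]" "a \<noteq> 0" using degree_eq_zeroE by (metis pCons_eq_0_iff)
  with 0 show ?case by (simp add: peval_def)
next
  case (Suc n)
  have "\<not> constant (poly p)" using Suc.hyps(2) constant_degree[of p] by simp
  then obtain a where "poly p a = 0" using fundamental_theorem_of_algebra by blast
  then obtain q where q: "p = [:- a, 1:] * q" using poly_eq_0_iff_dvd by (metis dvdE)
  show ?case
  proof (cases "N v = a *s v")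
    case True
    then show ?thesis using Suc.prems by blast
  next
    case False
    have "q \<noteq> 0" using Suc.prems q by auto
    then have "degree q = n" using Suc.hyps(2) q degree_mult_eq[of "[:- a, 1:]" q] by simp
    moreover have "N v - a *s v \<in> E"
      using assms(2,3) Suc.prems by (simp add: vec.subspace_diff vec.subspace_scale)
    ultimately show ?thesis
      using Suc.hyps(1)[of q "N v - a *s v"] \<open>q \<noteq> 0\<close> False Suc.prems(4) peval_linear_factor[OF assms(1)] q
      by simp
  qed
qed

text \<open>The invariant subspace \<open>E\<close> makes common eigenvectors accessible: it can be
  taken as an eigenspace of a commuting operator.\<close>

lemma eigenvector_exists:
  fixes N :: "complex ^ 'n \<Rightarrow> complex ^ 'n"
  assumes "clinear N" "vec.subspace E" "\<And>v. v \<in> E \<Longrightarrow> N v \<in> E" "v \<in> E" "v \<noteq> 0"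
  obtains w \<mu> where "w \<in> E" "w \<noteq> 0" "N w = \<mu> *s w"
proof -
  obtain n c k where c: "k \<le> n" "c k \<noteq> 0" and ann: "\<And>v. (\<Sum>i\<le>n. c i *\<^sub>R (N ^^ i) v) = 0"
    using annihilating_coefficients[OF assms(1)] by metis
  define p where "p = (\<Sum>i\<le>n. monom (complex_of_real (c i)) i)"
  have coeff: "coeff p i = (if i \<le> n then complex_of_real (c i) else 0)" for i
    by (simp add: p_def coeff_sum)
  have "p \<noteq> 0" using coeff[of k] c by auto
  moreover have "degree p \<le> n" by (rule degree_le) (simp add: coeff)
  then have "peval N p v = 0"
    using ann[of v] by (simp add: peval_bound coeff scaleR_eq_vector_scalar_mult)
  ultimately show thesis using eigenvector_of_peval_zero[OF assms(1-3) _ assms(4,5)] that by blast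
qed

text \<open>On an eigenvector an annihilating relation becomes a polynomial equation for the
  eigenvalue.\<close>

lemma finite_eigenvalues:
  fixes N :: "complex ^ 'n \<Rightarrow> complex ^ 'n"
  assumes "clinear N"
  shows "finite {\<mu>. \<exists>v. v \<noteq> 0 \<and> N v = \<mu> *s v}"
proof -
  obtain n c k where c: "k \<le> n" "c k \<noteq> 0" and ann: "\<And>v. (\<Sum>i\<le>n. c i *\<^sub>R (N ^^ i) v) = 0"
    using annihilating_coefficients[OF assms(1)] by metis
  have "(\<Sum>i\<le>n. complex_of_real (c i) * \<mu> ^ i) = 0" if "v \<noteq> 0" "N v = \<mu> *s v" for \<mu> v
  proof -
    have "(N ^^ i) v = \<mu> ^ i *s v" for i
      by (induction i) (simp_all add: clinear_scale[OF assms] that(2) mult.commute)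
    then have "(\<Sum>i\<le>n. complex_of_real (c i) * \<mu> ^ i) *s v = 0"
      using ann[of v] by (simp add: scaleR_eq_vector_scalar_mult vec.scale_sum_left)
    then show ?thesis using that(1) by simp
  qed
  then have "{\<mu>. \<exists>v. v \<noteq> 0 \<and> N v = \<mu> *s v} \<subseteq> {z. (\<Sum>i\<le>n. complex_of_real (c i) * z ^ i) = 0}" by blast
  moreover have "finite {z. (\<Sum>i\<le>n. complex_of_real (c i) * z ^ i) = 0}"
    by (rule polyfun_roots_finite[of _ k]) (use c in auto)
  ultimately show ?thesis by (rule finite_subset)
qed

section \<open>Compact real forms\<close>

text \<open>Formulated for arbitrary maps, so that compositions with the antilinear \<tau> can be
  written down without passing through matrices.\<close>

definition ctrace :: "(complex ^ 'n::finite \<Rightarrow> complex ^ 'n) \<Rightarrow> complex" where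
  "ctrace T = (\<Sum>i\<in>UNIV. T (axis i 1) $ i)"

lemma trace_matrix: "trace (matrix T) = ctrace T"
  by (simp add: trace_def matrix_def ctrace_def)

lemma ctrace_commute:
  assumes "clinear f" "clinear g"
  shows "ctrace (\<lambda>x. f (g x)) = ctrace (\<lambda>x. g (f x))"
  using matrix_compose_gen[OF assms] matrix_compose_gen[OF assms(2,1)]
    trace_mul_sym[of "matrix f" "matrix g"]
  by (simp add: trace_matrix[symmetric] comp_def)

lemma ctrace_add: "ctrace (\<lambda>x. f x + g x) = ctrace f + ctrace g"
  by (simp add: ctrace_def sum.distrib)

lemma ctrace_diff: "ctrace (\<lambda>x. f x - g x) = ctrace f - ctrace g"
  by (simp add: ctrace_def sum_subtractf)

lemma ctrace_scale: "ctrace (\<lambda>x. c *s f x) = c * ctrace f"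
  by (simp add: ctrace_def sum_distrib_left)

text \<open>A conjugation \<open>\<tau>\<close> is similar to the standard one \<open>\<kappa>\<close> by the linear map \<open>\<tau> \<circ> \<kappa>\<close>.\<close>

lemma ctrace_conjugate:
  fixes \<tau> :: "complex ^ 'n \<Rightarrow> complex ^ 'n"
  assumes add: "\<And>x y. \<tau> (x + y) = \<tau> x + \<tau> y" and scale: "\<And>c x. \<tau> (c *s x) = cnj c *s \<tau> x"
    and invol: "\<And>x. \<tau> (\<tau> x) = x" and T: "clinear T"
  shows "ctrace (\<lambda>x. \<tau> (T (\<tau> x))) = cnj (ctrace T)"
proof -
  define \<kappa> :: "complex ^ 'n \<Rightarrow> complex ^ 'n" where "\<kappa> = (\<lambda>x. \<chi> i. cnj (x $ i))"
  have \<kappa>: "\<kappa> (x + y) = \<kappa> x + \<kappa> y" "\<kappa> (c *s x) = cnj c *s \<kappa> x" "\<kappa> (\<kappa> x) = x" for c x y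
    by (simp_all add: \<kappa>_def vec_eq_iff)
  have f: "clinear (\<lambda>x. \<tau> (\<kappa> x))" and g: "clinear (\<lambda>x. \<kappa> (T (\<tau> x)))"
    by (rule clinearI; simp add: \<kappa> add scale clinear_add[OF T] clinear_scale[OF T])+
  have "ctrace (\<lambda>x. \<tau> (T (\<tau> x))) = ctrace (\<lambda>x. \<kappa> (T (\<kappa> x)))"
    using ctrace_commute[OF f g] by (simp add: \<kappa> invol)
  also have "\<dots> = cnj (ctrace T)"
  proof -
    have "\<kappa> (axis i 1) = axis i 1" for i by (simp add: \<kappa>_def axis_def vec_eq_iff)
    then show ?thesis by (simp add: ctrace_def) (simp add: \<kappa>_def)
  qed
  finally show ?thesis .
qed

locale compact_form =
  fixes br :: "complex ^ 'n \<Rightarrow> complex ^ 'n \<Rightarrow> complex ^ 'n" and u :: "(complex ^ 'n) set"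
  assumes lie: "complex_lie_algebra br" and compact: "compact_real_form br u"
begin

abbreviation iu :: "(complex ^ 'n) set" where "iu \<equiv> i_times u"
abbreviation \<tau> :: "complex ^ 'n \<Rightarrow> complex ^ 'n" where "\<tau> \<equiv> cartan_involution u"
abbreviation K :: "complex ^ 'n \<Rightarrow> complex ^ 'n \<Rightarrow> complex" where "K \<equiv> killing br"

lemma clinear_br: "clinear (br x)" and clinear_br_left: "clinear (\<lambda>x. br x y)"
  using lie by (auto simp: complex_lie_algebra_def)

lemma br_simps:
  "br (x + y) z = br x z + br y z" "br z (x + y) = br z x + br z y"
  "br (x - y) z = br x z - br y z" "br z (x - y) = br z x - br z y"
  "br (c *s x) y = c *s br x y" "br x (c *s y) = c *s br x y"
  "br (r *\<^sub>R x) y = r *\<^sub>R br x y" "br x (r *\<^sub>R y) = r *\<^sub>R br x y"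
  "br (- x) y = - br x y" "br x (- y) = - br x y" "br 0 y = 0" "br x 0 = 0"
  using clinear_add[OF clinear_br] clinear_add[OF clinear_br_left] clinear_diff[OF clinear_br]
    clinear_diff[OF clinear_br_left] clinear_scale[OF clinear_br] clinear_scale[OF clinear_br_left]
    clinear_minus[OF clinear_br] clinear_minus[OF clinear_br_left]
    clinear_zero[OF clinear_br] clinear_zero[OF clinear_br_left]
  by (simp_all add: scaleR_eq_vector_scalar_mult)

lemma linear_br: "linear (br x)"
  by (rule clinear_imp_linear[OF clinear_br])

lemma linear_br_left: "linear (\<lambda>x. br x y)"
  by (rule clinear_imp_linear[OF clinear_br_left])

lemma bilinear_br: "bilinear br"
  by (simp add: bilinear_def linear_br linear_br_left)

lemma br_self: "br x x = 0"
  using lie by (auto simp: complex_lie_algebra_def)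

lemma br_anticomm: "br x y = - br y x"
  using br_self[of "x + y"] unfolding br_simps by (simp add: br_self eq_neg_iff_add_eq_0 add.commute)

lemma jacobi: "br x (br y z) = br (br x y) z + br y (br x z)"
proof -
  have "br x (br y z) + br y (br z x) + br z (br x y) = 0"
    using lie by (auto simp: complex_lie_algebra_def)
  then show ?thesis
    using br_anticomm[of z x] br_anticomm[of z "br x y"] by (simp add: br_simps algebra_simps)
qed

section \<open>The Cartan decomposition and its involution\<close>

lemma subspace_u: "subspace u"
  and br_u_u: "X \<in> u \<Longrightarrow> Y \<in> u \<Longrightarrow> br X Y \<in> u"
  and u_Int_iu: "u \<inter> iu = {0}"
  and decomp: "\<exists>X\<in>u. \<exists>Y\<in>iu. Z = X + Y"
  and negative: "X \<in> u \<Longrightarrow> X \<noteq> 0 \<Longrightarrow> Re (K X X) < 0"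
  using compact by (auto simp: compact_real_form_def real_form_def)

text \<open>Membership in an image becomes membership in \<open>u\<close>; the bracket rules of the
  Cartan decomposition then reduce to the closure of \<open>u\<close> under brackets.\<close>

lemma iu_iff: "x \<in> iu \<longleftrightarrow> \<i> *s x \<in> u"
proof
  assume "x \<in> iu"
  then obtain y where "y \<in> u" "x = \<i> *s y" by (auto simp: i_times_def)
  then show "\<i> *s x \<in> u" using subspace_neg[OF subspace_u] by (simp add: vector_smult_lneg)
next
  assume "\<i> *s x \<in> u"
  then have "- (\<i> *s x) \<in> u" by (rule subspace_neg[OF subspace_u])
  moreover have "x = \<i> *s (- (\<i> *s x))" by (simp add: vec_eq_iff)
  ultimately show "x \<in> iu" unfolding i_times_def by (rule rev_image_eqI)
qed

lemma i_times_iff: "\<i> *s x \<in> iu \<longleftrightarrow> x \<in> u"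
proof -
  have "\<i> *s (\<i> *s x) = - x" by (simp add: vec_eq_iff)
  then show ?thesis using iu_iff[of "\<i> *s x"] subspace_neg[OF subspace_u, of x] subspace_neg[OF subspace_u, of "- x"]
    by auto
qed

lemma subspace_iu: "subspace iu"
proof -
  have "\<i> *s (c *\<^sub>R x) = c *\<^sub>R (\<i> *s x)" for c and x :: "complex ^ 'n"
    by (simp add: vec_eq_iff)
  then show ?thesis using subspace_u
    by (auto simp: subspace_def iu_iff vector_add_ldistrib)
qed

lemma br_u_iu: "X \<in> u \<Longrightarrow> Y \<in> iu \<Longrightarrow> br X Y \<in> iu"
  using br_u_u[of X "\<i> *s Y"] by (simp add: iu_iff br_simps)

lemma br_iu_u: "X \<in> iu \<Longrightarrow> Y \<in> u \<Longrightarrow> br X Y \<in> iu"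
  using br_u_u[of "\<i> *s X" Y] by (simp add: iu_iff br_simps)

lemma br_iu_iu: "X \<in> iu \<Longrightarrow> Y \<in> iu \<Longrightarrow> br X Y \<in> u"
proof -
  assume "X \<in> iu" "Y \<in> iu"
  then have "br (\<i> *s X) (\<i> *s Y) \<in> u" using br_u_u by (simp add: iu_iff)
  then have "- br (\<i> *s X) (\<i> *s Y) \<in> u" by (rule subspace_neg[OF subspace_u])
  moreover have "- br (\<i> *s X) (\<i> *s Y) = br X Y" by (simp add: br_simps vec_eq_iff)
  ultimately show ?thesis by simp
qed

lemma decomp_unique:
  assumes "X \<in> u" "X' \<in> u" "Y \<in> iu" "Y' \<in> iu" "X + Y = X' + Y'"
  shows "X = X'" "Y = Y'"
proof -
  have "X - X' = Y' - Y" using assms(5) by (simp add: algebra_simps)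
  moreover have "X - X' \<in> u" "Y' - Y \<in> iu"
    using assms subspace_diff[OF subspace_u] subspace_diff[OF subspace_iu] by auto
  ultimately have "X - X' \<in> u \<inter> iu" by simp
  then show "X = X'" unfolding u_Int_iu by simp
  then show "Y = Y'" using assms(5) by simp
qed

lemma \<tau>_decomp: "X \<in> u \<Longrightarrow> Y \<in> iu \<Longrightarrow> \<tau> (X + Y) = X - Y"
  unfolding cartan_involution_def using decomp_unique by (intro the_equality) blast+

lemma \<tau>_u: "X \<in> u \<Longrightarrow> \<tau> X = X"
  using \<tau>_decomp[of X 0] subspace_0[OF subspace_iu] by simp

lemma \<tau>_iu: "Y \<in> iu \<Longrightarrow> \<tau> Y = - Y"
  using \<tau>_decomp[of 0 Y] subspace_0[OF subspace_u] by simp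

lemma \<tau>_\<tau>: "\<tau> (\<tau> Z) = Z"
proof -
  obtain X Y where "X \<in> u" "Y \<in> iu" "Z = X + Y" using decomp by blast
  then show ?thesis using \<tau>_decomp[of X Y] \<tau>_decomp[of X "- Y"] subspace_neg[OF subspace_iu] by simp
qed

lemma \<tau>_add: "\<tau> (Z + Z') = \<tau> Z + \<tau> Z'"
proof -
  obtain X Y where d: "X \<in> u" "Y \<in> iu" "Z = X + Y" using decomp by blast
  obtain X' Y' where d': "X' \<in> u" "Y' \<in> iu" "Z' = X' + Y'" using decomp by blast
  have "Z + Z' = (X + X') + (Y + Y')" by (simp add: d d')
  moreover have "\<tau> ((X + X') + (Y + Y')) = (X + X') - (Y + Y')"
    using d d' by (intro \<tau>_decomp subspace_add[OF subspace_u] subspace_add[OF subspace_iu])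
  ultimately have "\<tau> (Z + Z') = (X + X') - (Y + Y')" by simp
  moreover have "\<tau> Z = X - Y" "\<tau> Z' = X' - Y'"
    unfolding d(3) d'(3) by (rule \<tau>_decomp[OF d(1,2)] \<tau>_decomp[OF d'(1,2)])+
  ultimately show ?thesis by simp
qed

lemma \<tau>_scaleR: "\<tau> (r *\<^sub>R Z) = r *\<^sub>R \<tau> Z"
proof -
  obtain X Y where d: "X \<in> u" "Y \<in> iu" "Z = X + Y" using decomp by blast
  then show ?thesis
    using \<tau>_decomp[of "r *\<^sub>R X" "r *\<^sub>R Y"] \<tau>_decomp[of X Y] subspace_scale[OF subspace_u] subspace_scale[OF subspace_iu]
    by (simp add: scaleR_add_right scaleR_diff_right)
qed

lemma linear_\<tau>: "linear \<tau>"
  by (rule linearI) (simp_all add: \<tau>_add \<tau>_scaleR)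

lemma \<tau>_i: "\<tau> (\<i> *s Z) = - (\<i> *s \<tau> Z)"
proof -
  obtain X Y where d: "X \<in> u" "Y \<in> iu" "Z = X + Y" using decomp by blast
  then have "\<i> *s Y \<in> u" "\<i> *s X \<in> iu" by (simp_all add: iu_iff[symmetric] i_times_iff)
  then show ?thesis
    using \<tau>_decomp[of "\<i> *s Y" "\<i> *s X"] \<tau>_decomp[of X Y] d
    by (simp add: vector_add_ldistrib vector_ssub_ldistrib add.commute)
qed

lemma \<tau>_scale: "\<tau> (c *s Z) = cnj c *s \<tau> Z"
proof -
  have *: "c *s Z = Re c *\<^sub>R Z + Im c *\<^sub>R (\<i> *s Z)" for c and Z :: "complex ^ 'n"
    by (simp add: vec_eq_iff complex_eq_iff)
  show ?thesis
    by (subst *, subst (2) *) (simp add: \<tau>_add \<tau>_scaleR \<tau>_i)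
qed

lemma \<tau>_br: "\<tau> (br Z W) = br (\<tau> Z) (\<tau> W)"
proof -
  obtain X Y where d: "X \<in> u" "Y \<in> iu" "Z = X + Y" using decomp by blast
  obtain X' Y' where d': "X' \<in> u" "Y' \<in> iu" "W = X' + Y'" using decomp by blast
  have "br Z W = (br X X' + br Y Y') + (br X Y' + br Y X')"
    by (simp add: d d' br_simps algebra_simps)
  moreover have "br X X' + br Y Y' \<in> u" "br X Y' + br Y X' \<in> iu"
    using d d' by (simp_all add: subspace_add subspace_u subspace_iu br_u_u br_iu_iu br_u_iu br_iu_u)
  ultimately have "\<tau> (br Z W) = (br X X' + br Y Y') - (br X Y' + br Y X')"
    using \<tau>_decomp by simp
  moreover have "\<tau> Z = X - Y" "\<tau> W = X' - Y'"
    unfolding d(3) d'(3) by (rule \<tau>_decomp[OF d(1,2)] \<tau>_decomp[OF d'(1,2)])+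
  ultimately show ?thesis by (simp add: br_simps)
qed

text \<open>The projection onto \<open>iu\<close> along \<open>u\<close>; on the orbit it is the
  bundle projection, since it maps \<open>x + i v\<close> to \<open>x\<close> for \<open>x\<close>
  and \<open>v\<close> in \<open>iu\<close>. Its complement \<open>Q\<close> reads off the fibre
  component.\<close>

definition P :: "complex ^ 'n \<Rightarrow> complex ^ 'n" where "P z = (1/2) *\<^sub>R (z - \<tau> z)"
definition Q :: "complex ^ 'n \<Rightarrow> complex ^ 'n" where "Q z = (1/2) *\<^sub>R (z + \<tau> z)"

lemma P_plus_Q: "P z + Q z = z"
  by (simp add: P_def Q_def scaleR_add_right[symmetric] scaleR_2[symmetric])

lemma P_decomp: "X \<in> u \<Longrightarrow> Y \<in> iu \<Longrightarrow> P (X + Y) = Y"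
  and Q_decomp: "X \<in> u \<Longrightarrow> Y \<in> iu \<Longrightarrow> Q (X + Y) = X"
  by (simp_all add: P_def Q_def \<tau>_decomp scaleR_2[symmetric])

lemma P_in_iu: "P z \<in> iu" and Q_in_u: "Q z \<in> u"
  using decomp[of z] P_decomp Q_decomp by auto

lemma P_iu: "Y \<in> iu \<Longrightarrow> P Y = Y" and Q_iu: "Y \<in> iu \<Longrightarrow> Q Y = 0"
  using P_decomp[of 0 Y] Q_decomp[of 0 Y] subspace_0[OF subspace_u] by auto

lemma P_u: "X \<in> u \<Longrightarrow> P X = 0" and Q_u: "X \<in> u \<Longrightarrow> Q X = X"
  using P_decomp[of X 0] Q_decomp[of X 0] subspace_0[OF subspace_iu] by auto

lemma linear_P: "linear P" and linear_Q: "linear Q"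
  by (rule linearI; simp add: P_def Q_def \<tau>_add \<tau>_scaleR algebra_simps)+

lemma P_add: "P (x + y) = P x + P y"
  by (rule linear_add[OF linear_P])

section \<open>Invariance and definiteness of the Killing form\<close>

lemma killing_ctrace: "K X Y = ctrace (\<lambda>z. br X (br Y z))"
  unfolding killing_def using matrix_compose_gen[OF clinear_br clinear_br, of X Y]
  by (simp add: trace_matrix[symmetric] comp_def)

lemma killing_sym: "K X Y = K Y X"
  unfolding killing_ctrace by (rule ctrace_commute[OF clinear_br clinear_br])

lemma killing_add: "K (X + X') Y = K X Y + K X' Y"
  by (simp add: killing_ctrace br_simps ctrace_add)

lemma killing_scale: "K (c *s X) Y = c * K X Y"
  by (simp add: killing_ctrace br_simps ctrace_scale)

lemma killing_simps:
  "K (X + X') Y = K X Y + K X' Y" "K Y (X + X') = K Y X + K Y X'"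
  "K (X - X') Y = K X Y - K X' Y" "K Y (X - X') = K Y X - K Y X'"
  "K (c *s X) Y = c * K X Y" "K X (c *s Y) = c * K X Y"
  "K (r *\<^sub>R X) Y = complex_of_real r * K X Y" "K X (r *\<^sub>R Y) = complex_of_real r * K X Y"
  "K (- X) Y = - K X Y" "K X (- Y) = - K X Y" "K 0 Y = 0" "K X 0 = 0"
proof -
  have s: "K Y X = K X Y" for X Y by (rule killing_sym)
  have m: "K (- X) Y = - K X Y" for X Y
    using killing_scale[of "- 1" X Y] by simp
  have d: "K (X - X') Y = K X Y - K X' Y" for X X' Y
    using killing_add[of X "- X'" Y] m by simp
  have z: "K 0 Y = 0" for Y using killing_scale[of 0 0 Y] by simp
  have r: "K (r *\<^sub>R X) Y = complex_of_real r * K X Y" for r X Y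
    by (simp add: scaleR_eq_vector_scalar_mult killing_scale)
  show "K (X + X') Y = K X Y + K X' Y" "K (X - X') Y = K X Y - K X' Y" "K (c *s X) Y = c * K X Y"
    "K (r *\<^sub>R X) Y = complex_of_real r * K X Y" "K (- X) Y = - K X Y" "K 0 Y = 0"
    by (simp_all only: killing_add killing_scale d m z r)
  show "K Y (X + X') = K Y X + K Y X'" "K Y (X - X') = K Y X - K Y X'"
    by (simp_all only: s[of Y] killing_add d)
  show "K X (c *s Y) = c * K X Y" "K X (r *\<^sub>R Y) = complex_of_real r * K X Y"
    "K X (- Y) = - K X Y" "K X 0 = 0"
    by (simp_all only: s[of X] killing_scale m z r)
qed

text \<open>Expanding the brackets by the Jacobi identity leaves one common term on both sides, and
  the other two terms agree by cyclicity of the trace.\<close>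

lemma killing_invariant: "K (br X Y) Z = - K Y (br X Z)"
proof -
  have 1: "br (br X Y) (br Z w) = br X (br Y (br Z w)) - br Y (br X (br Z w))" for w
    using jacobi[of X Y "br Z w"] by (simp add: algebra_simps)
  have 2: "br Y (br (br X Z) w) = br Y (br X (br Z w)) - br Y (br Z (br X w))" for w
    using jacobi[of X Z w] by (simp add: br_simps algebra_simps)
  have "ctrace (\<lambda>w. br X (br Y (br Z w))) = ctrace (\<lambda>w. br Y (br Z (br X w)))"
    by (rule ctrace_commute[OF clinear_br clinear_compose[OF clinear_br clinear_br]])
  then show ?thesis unfolding killing_ctrace 1 2 ctrace_diff by simp
qed

text \<open>Conjugation by \<tau> turns \<open>ad X\<close> into \<open>ad (\<tau> X)\<close>, and
  it conjugates traces. Comparing real or imaginary parts makes the form real on \<open>iu\<close>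
  and makes \<open>u\<close> and \<open>iu\<close> orthogonal for its real part.\<close>

lemma killing_\<tau>: "K (\<tau> X) (\<tau> Y) = cnj (K X Y)"
proof -
  have "br (\<tau> X) (br (\<tau> Y) z) = \<tau> (br X (br Y (\<tau> z)))" for z by (simp add: \<tau>_br \<tau>_\<tau>)
  then show ?thesis unfolding killing_ctrace
    using ctrace_conjugate[OF \<tau>_add \<tau>_scale \<tau>_\<tau> clinear_compose[OF clinear_br clinear_br]] by simp
qed

lemma Im_killing_iu: "X \<in> iu \<Longrightarrow> Y \<in> iu \<Longrightarrow> Im (K X Y) = 0"
  using arg_cong[OF killing_\<tau>[of X Y], of Im] by (simp add: \<tau>_iu killing_simps)

lemma Re_killing_u_iu: "X \<in> u \<Longrightarrow> Y \<in> iu \<Longrightarrow> Re (K X Y) = 0"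
  using arg_cong[OF killing_\<tau>[of X Y], of Re] by (simp add: \<tau>_iu \<tau>_u killing_simps)

lemma positive: "Y \<in> iu \<Longrightarrow> Y \<noteq> 0 \<Longrightarrow> Re (K Y Y) > 0"
  using negative[of "\<i> *s Y"] by (simp add: iu_iff killing_simps vec.scale_eq_0_iff)

text \<open>The real part of the Hermitian form, a real inner product for which \<open>ad x\<close> is symmetric when
  \<open>x \<in> iu\<close>.\<close>

definition B :: "complex ^ 'n \<Rightarrow> complex ^ 'n \<Rightarrow> real" where "B x y = - Re (K x (\<tau> y))"

lemma B_simps: "B (x + y) z = B x z + B y z" "B z (x + y) = B z x + B z y"
  "B (x - y) z = B x z - B y z" "B (r *\<^sub>R x) z = r * B x z" "B z (r *\<^sub>R x) = r * B z x"
  "B 0 x = 0" "B x 0 = 0"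
  by (simp_all add: B_def killing_simps \<tau>_add \<tau>_scaleR linear_0[OF linear_\<tau>])

lemma B_iu: "Y \<in> iu \<Longrightarrow> B x Y = Re (K x Y)"
  by (simp add: B_def \<tau>_iu killing_simps)

text \<open>The involution changes the sign on \<open>iu\<close>, so the negative form on
  \<open>u\<close> and the positive form on \<open>iu\<close> both contribute positively, while the
  mixed terms cancel by symmetry.\<close>

lemma B_pos: "x \<noteq> 0 \<Longrightarrow> B x x > 0"
proof -
  assume "x \<noteq> 0"
  have *: "B x x = Re (K (P x) (P x)) - Re (K (Q x) (Q x))"
  proof -
    have "\<tau> x = Q x - P x" using \<tau>_decomp[OF Q_in_u P_in_iu, of x x] P_plus_Q[of x] by (simp add: add.commute)
    then have "B x x = - Re (K (P x + Q x) (Q x - P x))" by (simp add: B_def P_plus_Q)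
    then show ?thesis by (simp add: killing_simps killing_sym[of "Q x" "P x"])
  qed
  have "P x \<noteq> 0 \<or> Q x \<noteq> 0" using \<open>x \<noteq> 0\<close> P_plus_Q[of x] by auto
  moreover have "Re (K (P x) (P x)) \<ge> 0" "Re (K (Q x) (Q x)) \<le> 0"
    using positive[OF P_in_iu, of x] negative[OF Q_in_u, of x] by (cases "P x = 0"; cases "Q x = 0"; simp add: killing_simps)+
  ultimately show ?thesis using * positive[OF P_in_iu, of x] negative[OF Q_in_u, of x] by auto
qed

lemma B_zero: "B x x = 0 \<Longrightarrow> x = 0"
  using B_pos[of x] by force

lemma B_ad_symmetric: "x \<in> iu \<Longrightarrow> B (br x y) z = B y (br x z)"
  by (simp add: B_def killing_invariant \<tau>_br \<tau>_iu br_simps killing_simps)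

text \<open>For a symmetric operator \<open>A\<close> one has
  \<open>B (A v) (A v) = B v (A (A v))\<close>, so the kernels of \<open>A\<close> and of its square
  coincide; equivalently, kernel and range meet in zero.\<close>

lemma ad_ad_zero: "x \<in> iu \<Longrightarrow> br x (br x v) = 0 \<Longrightarrow> br x v = 0"
  using B_ad_symmetric[of x v "br x v"] by (auto intro!: B_zero simp: B_simps)

lemma exp_ad_op_exp: "exp_ad br X = op_exp (br X)"
  by (simp add: exp_ad_def op_exp_def fun_eq_iff)


subsection \<open>The group generated by the exponentials\<close>

lemma op_exp_br_has_vector_derivative:
  "((\<lambda>s. op_exp (\<lambda>z. s *\<^sub>R br X z) z) has_vector_derivative br X (op_exp (\<lambda>z. s *\<^sub>R br X z) z)) (at s)"
proof -
  have "br X (op_exp (\<lambda>z. s *\<^sub>R br X z) z) = op_exp (\<lambda>z. s *\<^sub>R br X z) (br X z)"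
    by (rule op_exp_intertwine) (simp_all add: linear_compose_scale_right linear_br br_simps)
  then show ?thesis using op_exp_has_vector_derivative[OF linear_br, of X z s] by simp
qed

lemma br_uminus: "br (- X) = (\<lambda>z. - br X z)"
  by (simp add: fun_eq_iff br_simps)

lemma exp_ad_minus: "exp_ad br (- X) (exp_ad br X z) = z"
  using op_exp_minus[OF linear_br, of X z] by (simp add: exp_ad_op_exp br_uminus)

text \<open>By the Jacobi identity the bracket of two solutions of the linear equation given by
  \<open>ad X\<close> is again a solution, hence determined by its initial value.\<close>

lemma exp_ad_br: "exp_ad br X (br y z) = br (exp_ad br X y) (exp_ad br X z)"
proof -
  let ?e = "\<lambda>s. op_exp (\<lambda>z. s *\<^sub>R br X z)"
  define \<gamma> where "\<gamma> = (\<lambda>s. br (?e s y) (?e s z))"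
  have bb: "bounded_bilinear br" using bilinear_br bilinear_conv_bounded_bilinear by blast
  have "(\<gamma> has_vector_derivative br X (\<gamma> s)) (at s)" for s
  proof -
    have "(\<gamma> has_vector_derivative br (?e s y) (br X (?e s z)) + br (br X (?e s y)) (?e s z)) (at s)"
      unfolding \<gamma>_def
      by (intro bounded_bilinear.has_vector_derivative[OF bb] op_exp_br_has_vector_derivative)
    then show ?thesis using jacobi[of X "?e s y" "?e s z"] by (simp add: \<gamma>_def add.commute)
  qed
  from op_exp_ode_unique[OF linear_br this, of 1]
  have "exp_ad br (- X) (br (exp_ad br X y) (exp_ad br X z)) = br y z"
    by (simp add: \<gamma>_def op_exp_0 exp_ad_op_exp br_uminus)
  then show ?thesis
    using exp_ad_minus[of "- X" "br (exp_ad br X y) (exp_ad br X z)"] by simp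
qed

lemma clinear_exp_ad: "clinear (exp_ad br X)"
proof (rule clinearI)
  show "exp_ad br X (x + y) = exp_ad br X x + exp_ad br X y" for x y
    using linear_add[OF linear_op_exp[OF linear_br]] by (simp add: exp_ad_op_exp)
  show "exp_ad br X (c *s x) = c *s exp_ad br X x" for c x
    unfolding exp_ad_op_exp
    by (rule op_exp_intertwine[symmetric])
      (auto simp: linear_br br_simps linear_iff scaleR_eq_vector_scalar_mult mult.commute vector_add_ldistrib)
qed

lemma U_group_exp: "X \<in> u \<Longrightarrow> exp_ad br X \<in> U_group br u"
  using U_group.intros(2)[OF _ U_group.intros(1)] by simp

lemma U_group_comp: "\<theta> \<in> U_group br u \<Longrightarrow> \<theta>' \<in> U_group br u \<Longrightarrow> \<theta> \<circ> \<theta>' \<in> U_group br u"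
  by (induction rule: U_group.induct) (auto simp: comp_assoc intro: U_group.intros)

lemma U_group_inverse:
  "\<theta> \<in> U_group br u \<Longrightarrow> \<exists>\<theta>'\<in>U_group br u. (\<forall>x. \<theta>' (\<theta> x) = x) \<and> (\<forall>x. \<theta> (\<theta>' x) = x)"
proof (induction rule: U_group.induct)
  case 1
  show ?case using U_group.intros(1) by (intro bexI[of _ id]) auto
next
  case (2 X \<theta>)
  then obtain \<theta>' where \<theta>': "\<theta>' \<in> U_group br u" "\<And>x. \<theta>' (\<theta> x) = x" "\<And>x. \<theta> (\<theta>' x) = x" by blast
  have "exp_ad br (- X) \<in> U_group br u" using 2 subspace_neg[OF subspace_u] by (intro U_group_exp)
  then have "\<theta>' \<circ> exp_ad br (- X) \<in> U_group br u" using \<theta>' U_group_comp by blast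
  then show ?case
    using exp_ad_minus[of X] exp_ad_minus[of "- X"] \<theta>' by (intro bexI[of _ "\<theta>' \<circ> exp_ad br (- X)"]) auto
qed

lemma U_group_clinear: "\<theta> \<in> U_group br u \<Longrightarrow> clinear \<theta>"
proof (induction rule: U_group.induct)
  case 1
  show ?case by (rule clinearI) auto
next
  case (2 X \<theta>)
  then show ?case using clinear_compose[OF clinear_exp_ad] by (simp add: comp_def)
qed

lemma U_group_br: "\<theta> \<in> U_group br u \<Longrightarrow> \<theta> (br x y) = br (\<theta> x) (\<theta> y)"
  by (induction rule: U_group.induct) (auto simp: exp_ad_br)

lemma U_group_u: "\<theta> \<in> U_group br u \<Longrightarrow> x \<in> u \<Longrightarrow> \<theta> x \<in> u"
proof (induction rule: U_group.induct)
  case (2 X \<theta>)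
  then show ?case using op_exp_in_subspace[OF linear_br subspace_u] br_u_u by (simp add: exp_ad_op_exp)
qed simp

lemma U_group_iu: "\<theta> \<in> U_group br u \<Longrightarrow> x \<in> iu \<Longrightarrow> \<theta> x \<in> iu"
  using U_group_u[of \<theta> "\<i> *s x"] by (simp add: iu_iff clinear_scale[OF U_group_clinear])

lemma flag_self: "x \<in> flag br u x"
  unfolding flag_def using U_group.intros(1) by (metis (mono_tags, lifting) CollectI id_apply)

lemma flag_invariant: "\<theta> \<in> U_group br u \<Longrightarrow> \<theta> x \<in> flag br u H \<longleftrightarrow> x \<in> flag br u H"
proof -
  assume \<theta>: "\<theta> \<in> U_group br u"
  have *: "\<theta> x \<in> flag br u H" if "\<theta> \<in> U_group br u" "x \<in> flag br u H" for \<theta> x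
    using that U_group_comp by (auto simp: flag_def) (metis comp_apply)
  obtain \<theta>' where "\<theta>' \<in> U_group br u" "\<And>x. \<theta>' (\<theta> x) = x" using U_group_inverse[OF \<theta>] by blast
  then show ?thesis using *[OF \<theta>, of x] *[of \<theta>' "\<theta> x"] by auto
qed

text \<open>Makes the base point arbitrary: a local statement proved at \<open>H\<close> holds at
  every point \<open>x\<close> of the flag by reading it with \<open>x\<close> in place of
  \<open>H\<close>.\<close>

lemma flag_eq: "x \<in> flag br u H \<Longrightarrow> flag br u x = flag br u H"
proof -
  have sub: "flag br u y \<subseteq> flag br u z" if "y \<in> flag br u z" for y z
    using flag_invariant that by (auto simp: flag_def[of br u y])
  assume x: "x \<in> flag br u H"
  then obtain \<theta> where \<theta>: "\<theta> \<in> U_group br u" "x = \<theta> H" by (auto simp: flag_def)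
  have "\<theta> H \<in> flag br u (\<theta> H)" by (rule flag_self)
  then have "H \<in> flag br u x" using flag_invariant[OF \<theta>(1)] \<theta>(2) by simp
  then show ?thesis using sub[OF x] sub by blast
qed

lemma flag_iu: "H \<in> iu \<Longrightarrow> x \<in> flag br u H \<Longrightarrow> x \<in> iu"
  using U_group_iu by (auto simp: flag_def)

section \<open>The algebraic tangent spaces \<open>[u, x]\<close> and the description of the orbit
  by them\<close>

definition tangent :: "complex ^ 'n \<Rightarrow> (complex ^ 'n) set" where
  "tangent x = (\<lambda>X. br X x) ` u"

lemma subspace_tangent: "subspace (tangent x)"
  unfolding tangent_def by (rule linear_subspace_image[OF linear_br_left subspace_u])

lemma tangent_iu: "x \<in> iu \<Longrightarrow> v \<in> tangent x \<Longrightarrow> v \<in> iu"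
  using br_u_iu by (auto simp: tangent_def)

lemma br_u_tangent: "X \<in> u \<Longrightarrow> br x X \<in> tangent x"
  unfolding tangent_def using subspace_neg[OF subspace_u]
  by (intro rev_image_eqI[of "- X"]) (auto simp: br_simps br_anticomm[of x X])

lemma tangent_translate:
  assumes "\<theta> \<in> U_group br u"
  shows "tangent (\<theta> x) = \<theta> ` tangent x"
proof -
  obtain \<theta>' where \<theta>': "\<theta>' \<in> U_group br u" "\<And>x. \<theta>' (\<theta> x) = x" "\<And>x. \<theta> (\<theta>' x) = x"
    using U_group_inverse[OF assms] by blast
  have "br X (\<theta> x) = \<theta> (br (\<theta>' X) x)" for X by (simp add: U_group_br[OF assms] \<theta>')
  then have "tangent (\<theta> x) = (\<lambda>X. \<theta> (br X x)) ` \<theta>' ` u"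
    by (simp add: tangent_def image_image)
  moreover have "\<theta>' ` u = u"
  proof (intro equalityI subsetI)
    fix X assume "X \<in> u"
    then show "X \<in> \<theta>' ` u"
      using U_group_u[OF assms, of X] \<theta>'(2)[of X] by (intro image_eqI[of _ _ "\<theta> X"]) auto
  qed (use U_group_u[OF \<theta>'(1)] in auto)
  ultimately show ?thesis by (simp add: tangent_def image_image)
qed

lemma dim_tangent: "x \<in> flag br u H \<Longrightarrow> dim (tangent x) = dim (tangent H)"
proof -
  assume "x \<in> flag br u H"
  then obtain \<theta> where \<theta>: "\<theta> \<in> U_group br u" "x = \<theta> H" by (auto simp: flag_def)
  then have "inj \<theta>" using U_group_inverse[OF \<theta>(1)] by (metis injI)
  then show ?thesis
    using \<theta> tangent_translate dim_image_eq[OF clinear_imp_linear[OF U_group_clinear[OF \<theta>(1)]], of "tangent H"]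
    by (simp add: inj_on_subset)
qed

lemma br_iu_image: "br x ` iu = (\<lambda>v. \<i> *s v) ` tangent x"
proof -
  have "br x (\<i> *s X) = \<i> *s br (- X) x" for X by (simp add: br_simps br_anticomm[of X x])
  then have "br x ` iu = (\<lambda>X. \<i> *s br (- X) x) ` u" by (simp add: i_times_def image_image)
  also have "\<dots> = (\<lambda>X. \<i> *s br X x) ` uminus ` u" by (simp add: image_image)
  also have "uminus ` u = u"
    using subspace_neg[OF subspace_u] by (force intro: rev_image_eqI)
  finally show ?thesis by (simp add: tangent_def image_image)
qed

lemma Uad_orbit_iff:
  "p \<in> Uad_orbit br u H \<longleftrightarrow> (\<exists>x\<in>flag br u H. \<exists>v\<in>tangent x. p = x + \<i> *s v)"
  by (auto simp: Uad_orbit_def br_iu_image)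

lemma Uad_orbit_invariant:
  assumes "\<theta> \<in> U_group br u"
  shows "\<theta> p \<in> Uad_orbit br u H \<longleftrightarrow> p \<in> Uad_orbit br u H"
proof -
  have *: "\<theta> p \<in> Uad_orbit br u H" if \<theta>: "\<theta> \<in> U_group br u" and p: "p \<in> Uad_orbit br u H" for \<theta> p
  proof -
    obtain x v where x: "x \<in> flag br u H" "v \<in> tangent x" "p = x + \<i> *s v"
      using p by (auto simp: Uad_orbit_iff)
    have "\<theta> p = \<theta> x + \<i> *s \<theta> v"
      by (simp add: x clinear_add[OF U_group_clinear[OF \<theta>]] clinear_scale[OF U_group_clinear[OF \<theta>]])
    moreover have "\<theta> x \<in> flag br u H" using x flag_invariant[OF \<theta>] by simp
    moreover have "\<theta> v \<in> tangent (\<theta> x)" using x tangent_translate[OF \<theta>] by simp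
    ultimately show ?thesis by (auto simp: Uad_orbit_iff)
  qed
  obtain \<theta>' where "\<theta>' \<in> U_group br u" "\<And>x. \<theta>' (\<theta> x) = x" using U_group_inverse[OF assms] by blast
  then show ?thesis using *[OF assms, of p] *[of \<theta>' "\<theta> p"] by auto
qed

subsection \<open>The transversal to the flag\<close>

lemma eigenvalue_flag:
  assumes "x \<in> flag br u H" "v \<noteq> 0" "br x v = \<mu> *s v"
  shows "\<exists>v. v \<noteq> 0 \<and> br H v = \<mu> *s v"
proof -
  obtain \<theta> where \<theta>: "\<theta> \<in> U_group br u" "x = \<theta> H" using assms by (auto simp: flag_def)
  obtain \<theta>' where \<theta>': "\<theta>' \<in> U_group br u" "\<And>x. \<theta>' (\<theta> x) = x" "\<And>x. \<theta> (\<theta>' x) = x"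
    using U_group_inverse[OF \<theta>(1)] by blast
  have "br H (\<theta>' v) = \<mu> *s \<theta>' v"
    using arg_cong[OF assms(3), of \<theta>'] \<theta>(2)
    by (simp add: U_group_br[OF \<theta>'(1)] \<theta>' clinear_scale[OF U_group_clinear[OF \<theta>'(1)]])
  moreover have "\<theta>' v \<noteq> 0" using assms(2) \<theta>'(3)[of v] clinear_zero[OF U_group_clinear[OF \<theta>(1)]] by metis
  ultimately show ?thesis by blast
qed

lemma norm_vector_scalar_mult: "norm (c *s v) = norm c * norm (v :: complex ^ 'n)"
  by (simp add: norm_vec_def norm_mult L2_set_right_distrib)

text \<open>If \<open>Z\<close> commutes with \<open>H\<close>, then the eigenvalues of \<open>ad (H + Z)\<close> on a common eigenvector are sums
  \<open>\<lambda> + \<mu>\<close>; when \<open>H + Z\<close> is conjugate to \<open>H\<close>, both \<open>\<lambda>\<close> and \<open>\<lambda> + \<mu>\<close> lie in the finite spectrum of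
  \<open>ad H\<close>, so a small \<open>\<mu>\<close> vanishes.\<close>

lemma flag_isolated_in_centralizer:
  assumes "H \<in> iu"
  obtains \<epsilon> where "\<epsilon> > 0"
    "\<And>Z. Z \<in> iu \<Longrightarrow> br H Z = 0 \<Longrightarrow> H + Z \<in> flag br u H \<Longrightarrow> norm Z < \<epsilon> \<Longrightarrow> Z = 0"
proof -
  define F where "F = {\<mu>. \<exists>v. v \<noteq> 0 \<and> br H v = \<mu> *s v}"
  \<comment> \<open>The differences of eigenvalues form a finite set, so distinct eigenvalues of
    \<open>ad H\<close> have a least distance; it supplies \<delta>.\<close>
  have "finite ((\<lambda>(a, b). a - b) ` (F \<times> F))"
    using finite_eigenvalues[OF clinear_br, of H] by (intro finite_imageI) (simp add: F_def)
  then obtain \<delta> where \<delta>: "\<delta> > 0" "\<And>a b. a \<in> F \<Longrightarrow> b \<in> F \<Longrightarrow> a \<noteq> b \<Longrightarrow> \<delta> \<le> norm (a - b)"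
    using finite_set_avoid[of _ "0 :: complex"] by (force simp: dist_norm norm_minus_commute)
  obtain C where C: "C > 0" "\<And>x y. norm (br x y) \<le> C * norm x * norm y"
    using bilinear_bounded_pos[OF bilinear_br] by blast
  show thesis
  proof (rule that[of "\<delta> / C"])
    show "\<delta> / C > 0" using \<delta> C by simp
    fix Z assume Z: "Z \<in> iu" "br H Z = 0" "H + Z \<in> flag br u H" "norm Z < \<delta> / C"
    show "Z = 0"
    proof (rule ccontr)
      assume "Z \<noteq> 0"
      \<comment> \<open>Definiteness on \<open>iu\<close> shows that \<open>ad Z\<close> is not
        zero: if its square vanished, so would the trace \<open>K Z Z\<close>.\<close>
      then have "K Z Z \<noteq> 0" using positive[OF Z(1)] by auto
      moreover have "K Z Z = 0" if "\<forall>v. br Z (br Z v) = 0"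
        using that by (simp add: killing_ctrace ctrace_def)
      ultimately obtain w1 where "br Z (br Z w1) \<noteq> 0" by blast
      then obtain w0 where w0: "br Z w0 \<noteq> 0" by (metis br_simps(12))
      have "vec.subspace (range (br Z))"
        by (rule vec.linear_subspace_image[OF clinear_br vec.subspace_UNIV])
      then obtain w \<mu> where w: "w \<in> range (br Z)" "w \<noteq> 0" "br Z w = \<mu> *s w"
        using eigenvector_exists[OF clinear_br[of Z], of "range (br Z)" "br Z w0"] w0 by blast
      \<comment> \<open>This is why the eigenvector is sought in the range of \<open>ad Z\<close>:
        kernel and range meet in zero.\<close>
      have "\<mu> \<noteq> 0" using w ad_ad_zero[OF Z(1)] by auto
      have ZH: "br Z H = 0" using Z(2) br_anticomm[of Z H] by simp
      have "vec.subspace {v. br Z v = \<mu> *s v}"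
        by (auto simp: vec.subspace_def br_simps vector_add_ldistrib mult.commute)
      moreover have "br Z (br H v) = \<mu> *s br H v" if "br Z v = \<mu> *s v" for v
        using jacobi[of Z H v] that by (simp add: ZH br_simps)
      ultimately obtain v \<nu> where v: "br Z v = \<mu> *s v" "v \<noteq> 0" "br H v = \<nu> *s v"
        using eigenvector_exists[OF clinear_br[of H], of "{v. br Z v = \<mu> *s v}" w] w by blast
      have "br (H + Z) v = (\<nu> + \<mu>) *s v" by (simp add: br_simps v vector_sadd_rdistrib)
      then have "\<nu> + \<mu> \<in> F" "\<nu> \<in> F"
        using eigenvalue_flag[OF Z(3) v(2), of "\<nu> + \<mu>"] v(2,3) unfolding F_def by blast+
      then have "\<delta> \<le> norm \<mu>" using \<delta>(2)[of "\<nu> + \<mu>" \<nu>] \<open>\<mu> \<noteq> 0\<close> by simp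
      moreover have "norm \<mu> * norm v \<le> C * norm Z * norm v"
        using C(2)[of Z v] by (simp add: v norm_vector_scalar_mult)
      then have "norm \<mu> \<le> C * norm Z" using v(2) by simp
      moreover have "C * norm Z < \<delta>" using Z(4) C(1) by (simp add: pos_less_divide_eq mult.commute)
      ultimately show False by simp
    qed
  qed
qed

text \<open>\<open>ad x\<close> is symmetric, so the projection onto its range is a polynomial in \<open>(ad x)\<^sup>2\<close> without constant
  term; by conjugation the same polynomial serves for all points \<open>x\<close> of the flag.\<close>

lemma tangent_projection:
  assumes "H \<in> iu"
  obtains S :: "complex ^ 'n \<Rightarrow> complex ^ 'n \<Rightarrow> complex ^ 'n" where
    "\<And>x. linear (S x)" "\<And>x v. x \<in> iu \<Longrightarrow> v \<in> iu \<Longrightarrow> S x v \<in> u"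
    "\<And>x v. x \<in> flag br u H \<Longrightarrow> br x (v - br x (S x v)) = 0"
    "\<And>(f :: complex ^ 'n \<Rightarrow> complex ^ 'n) g W. open W \<Longrightarrow> smooth_on f W \<Longrightarrow> smooth_on g W \<Longrightarrow>
      smooth_on (\<lambda>y. S (f y) (g y)) W"
proof -
  define N where "N = (\<lambda>x v. br x (br x v))"
  have cN: "clinear (N x)" for x unfolding N_def by (rule clinear_compose[OF clinear_br clinear_br])
  have NN: "N H v = 0" if "N H (N H v) = 0" for v
    using that ad_ad_zero[OF assms] unfolding N_def by blast
  obtain m :: nat and d :: "nat \<Rightarrow> real" where d: "\<And>v. N H (v - (\<Sum>i<m. d i *\<^sub>R (N H ^^ Suc i) v)) = 0"
    using range_projection_coefficients[OF cN[of H] NN] by blast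
  \<comment> \<open>One factor \<open>ad x\<close> is left out of the polynomial, so that
    \<open>br x (S x v)\<close> is the projection and \<open>S x v\<close> itself is a generator.
    For \<open>x\<close> and \<open>v\<close> in \<open>iu\<close>, the powers of the square
    \<open>N x\<close> stay in \<open>iu\<close> and the remaining bracket leads to
    \<open>u\<close>.\<close>
  define S where "S = (\<lambda>x v. \<Sum>i<m. d i *\<^sub>R br x ((N x ^^ i) v))"
  have linNi: "linear (N x ^^ i)" for x i by (rule linear_funpow[OF clinear_imp_linear[OF cN]])
  have brS: "br x (S x v) = (\<Sum>i<m. d i *\<^sub>R (N x ^^ Suc i) v)" for x v
    by (simp add: S_def linear_sum[OF linear_br] br_simps) (simp add: N_def)
  show thesis
  proof (rule that[of S])
    show "linear (S x)" for x
      by (rule linearI)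
        (simp_all add: S_def linear_add[OF linNi] linear_scale[OF linNi] br_simps scaleR_add_right
          sum.distrib scaleR_sum_right mult.commute)
    show "S x v \<in> u" if "x \<in> iu" "v \<in> iu" for x v
    proof -
      have "(N x ^^ i) v \<in> iu" for i
        using that by (induction i) (simp_all add: N_def br_iu_u br_iu_iu)
      then show ?thesis unfolding S_def
        using that by (intro subspace_sum[OF subspace_u] subspace_scale[OF subspace_u] br_iu_iu)
    qed
    show "br x (v - br x (S x v)) = 0" if x: "x \<in> flag br u H" for x v
    proof -
      obtain \<theta> where \<theta>: "\<theta> \<in> U_group br u" "x = \<theta> H" using x by (auto simp: flag_def)
      obtain \<theta>' where \<theta>': "\<And>x. \<theta> (\<theta>' x) = x" using U_group_inverse[OF \<theta>(1)] by blast
      note lin = clinear_imp_linear[OF U_group_clinear[OF \<theta>(1)]]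
      have comm: "\<theta> (N H w) = N x (\<theta> w)" for w by (simp add: N_def U_group_br[OF \<theta>(1)] \<theta>(2))
      have pow: "\<theta> ((N H ^^ i) w) = (N x ^^ i) (\<theta> w)" for i w by (induction i) (auto simp: comm)
      have "\<theta> (N H (\<theta>' v - br H (S H (\<theta>' v)))) = N x (v - br x (S x v))"
        unfolding brS by (simp only: comm linear_diff[OF lin] linear_sum[OF lin] linear_scale[OF lin] pow \<theta>')
      then have "N x (v - br x (S x v)) = 0"
        using d[of "\<theta>' v"] by (simp only: brS linear_0[OF lin])
      then show ?thesis using ad_ad_zero[OF flag_iu[OF assms x]] by (simp add: N_def)
    qed
    fix f g :: "complex ^ 'n \<Rightarrow> complex ^ 'n" and W
    assume W: "open W" "smooth_on f W" "smooth_on g W"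
    have "smooth_on (\<lambda>y. (N (f y) ^^ i) (g y)) W" for i
    proof (induction i)
      case (Suc i)
      then show ?case
        using smooth_on_bilinear[OF W(1) bilinear_br W(2) smooth_on_bilinear[OF W(1) bilinear_br W(2) Suc]]
        by (simp add: N_def)
    qed (simp add: W)
    then show "smooth_on (\<lambda>y. S (f y) (g y)) W"
      unfolding S_def using W
      by (intro smooth_on_sum smooth_on_scaleR smooth_on_const smooth_on_bilinear[OF _ bilinear_br])
  qed
qed


section \<open>Coordinates straightening the flag and the orbit\<close>

primrec exp_product :: "(complex ^ 'n \<Rightarrow> complex ^ 'n) \<Rightarrow> (complex ^ 'n) list \<Rightarrow> complex ^ 'n \<Rightarrow> complex ^ 'n \<Rightarrow> complex ^ 'n" where
  "exp_product X [] y z = z"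
| "exp_product X (b # bs) y z = op_exp (\<lambda>w. (y \<bullet> b) *\<^sub>R br (X b) w) (exp_product X bs y z)"

lemma exp_product_U_group:
  assumes "\<And>b. X b \<in> u"
  shows "\<exists>\<theta>\<in>U_group br u. \<forall>z. exp_product X bs y z = \<theta> z"
proof (induction bs)
  case Nil
  show ?case using U_group.intros(1) by (intro bexI[of _ id]) auto
next
  case (Cons b bs)
  then obtain \<theta> where \<theta>: "\<theta> \<in> U_group br u" "\<And>z. exp_product X bs y z = \<theta> z" by blast
  have "(\<lambda>w. (y \<bullet> b) *\<^sub>R br (X b) w) = br ((y \<bullet> b) *\<^sub>R X b)" by (simp add: br_simps fun_eq_iff)
  then have "exp_product X (b # bs) y z = (exp_ad br ((y \<bullet> b) *\<^sub>R X b) \<circ> \<theta>) z" for z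
    by (simp add: exp_ad_op_exp \<theta>)
  moreover have "exp_ad br ((y \<bullet> b) *\<^sub>R X b) \<circ> \<theta> \<in> U_group br u"
    by (rule U_group.intros(2)[OF _ \<theta>(1)]) (simp add: assms subspace_scale subspace_u)
  ultimately show ?case by blast
qed

lemma exp_product_0: "exp_product X bs 0 z = z"
  by (induction bs) (simp_all add: op_exp_0)

lemma smooth_on_exp_product:
  assumes "open W" "smooth_on w W"
  shows "smooth_on (\<lambda>y. exp_product X bs (y - c) (w y)) W"
proof (induction bs)
  case Nil
  then show ?case using assms by simp
next
  case (Cons b bs)
  have "smooth_on (\<lambda>y. y + - c) W" using assms(1) by (intro smooth_on_add smooth_on_id smooth_on_const)
  then have "smooth_on (\<lambda>y. (y - c) \<bullet> b) W"
    using smooth_on_linear[OF assms(1) linear_inner_basis[of b]] by simp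
  from smooth_on_op_exp[OF linear_br assms(1) this Cons] show ?case by simp
qed

text \<open>At \<open>y = c\<close> all exponents vanish and every factor is the identity, so to
  first order the order of the noncommuting factors is invisible and their generators simply add
  up.\<close>

lemma exp_product_has_derivative:
  assumes "(w has_derivative w') (at c)"
  shows "((\<lambda>y. exp_product X bs (y - c) (w y)) has_derivative
    (\<lambda>h. (\<Sum>b\<leftarrow>bs. (h \<bullet> b) *\<^sub>R br (X b) (w c)) + w' h)) (at c)"
proof (induction bs)
  case Nil
  then show ?case using assms by simp
next
  case (Cons b bs)
  have "((\<lambda>y. (y - c) \<bullet> b) has_derivative (\<lambda>h. h \<bullet> b)) (at c)"
    by (auto intro!: derivative_eq_intros)
  from op_exp_has_derivative[OF linear_br this Cons]
  show ?case by (simp add: exp_product_0 op_exp_0 add.assoc)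
qed

text \<open>The generator \<open>X = - s o P\<close> satisfies
  \<open>[X h, H] = [H, s (P h)]\<close>, so the group motion restores to first order what
  \<open>w\<close> has removed. The same motion also rotates the base value \<open>c\<close>, which
  leaves the correction \<open>- [s (P h), c]\<close>.\<close>

lemma chart:
  assumes "linear s" "\<And>v. v \<in> iu \<Longrightarrow> s v \<in> u" "c \<in> u"
  obtains \<psi> where "smooth_on \<psi> UNIV" "\<psi> c = H + c"
    "\<And>y. \<exists>\<theta>\<in>U_group br u. \<psi> y = \<theta> (H + (y - br H (s (P y))))"
    "(\<psi> has_derivative (\<lambda>h. h - br (s (P h)) c)) (at c)"
proof -
  obtain bs :: "(complex ^ 'n) list" where bs: "set bs = Basis" "distinct bs"
    using finite_distinct_list[OF finite_Basis] by blast
  define X where "X = (\<lambda>b. - s (P b))"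
  define w where "w = (\<lambda>y. H + (y - br H (s (P y))))"
  define \<psi> where "\<psi> = (\<lambda>y. exp_product X bs (y - c) (w y))"
  have linX: "linear X"
    unfolding X_def
    using linear_compose_neg[OF linear_compose[OF linear_P assms(1)]] by (simp add: comp_def)
  have Xu: "X b \<in> u" for b
    unfolding X_def by (rule subspace_neg[OF subspace_u assms(2)[OF P_in_iu]])
  have linb: "linear (\<lambda>y. br H (s (P y)))"
    using linear_compose[OF linear_compose[OF linear_P assms(1)] linear_br[of H]] by (simp add: comp_def)
  have linR: "linear (\<lambda>y. y - br H (s (P y)))"
    by (rule linear_compose_sub[OF linear_ident linb])
  have dw: "(w has_derivative (\<lambda>h. h - br H (s (P h)))) (at c)"
    unfolding w_def
    using has_derivative_add[OF has_derivative_const linear_imp_has_derivative[OF linR]] by simp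
  have sw: "smooth_on w UNIV"
    unfolding w_def
    by (intro smooth_on_add smooth_on_const smooth_on_linear[OF _ linR] smooth_on_id) auto
  have Pc: "P c = 0" by (rule P_u[OF assms(3)])
  have wc: "w c = H + c" by (simp add: w_def Pc linear_0[OF assms(1)] br_simps)
  show thesis
  proof (rule that[of \<psi>])
    show "smooth_on \<psi> UNIV" unfolding \<psi>_def by (rule smooth_on_exp_product[OF open_UNIV sw])
    show "\<psi> c = H + c" by (simp add: \<psi>_def exp_product_0 wc)
    show "\<exists>\<theta>\<in>U_group br u. \<psi> y = \<theta> (H + (y - br H (s (P y))))" for y
      unfolding \<psi>_def w_def[symmetric] using exp_product_U_group[of X bs "y - c"] Xu by (metis w_def)
    have e: "(\<Sum>b\<leftarrow>bs. (h \<bullet> b) *\<^sub>R br (X b) (w c)) + (h - br H (s (P h))) = h - br (s (P h)) c" for h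
    proof -
      have "(\<Sum>b\<leftarrow>bs. (h \<bullet> b) *\<^sub>R br (X b) (w c)) = (\<Sum>b\<in>Basis. (h \<bullet> b) *\<^sub>R br (X b) (w c))"
        using bs by (simp add: sum_list_distinct_conv_sum_set)
      also have "\<dots> = br (X h) (w c)"
        using linear_basis_expansion[OF linear_compose[OF linX linear_br_left[of "w c"]], of h]
        by (simp add: comp_def)
      finally show ?thesis
        by (simp add: X_def wc br_simps br_anticomm[of H "s (P h)"])
    qed
    show "(\<psi> has_derivative (\<lambda>h. h - br (s (P h)) c)) (at c)"
      unfolding \<psi>_def using exp_product_has_derivative[OF dw, of X bs] by (simp only: e)
  qed
qed

text \<open>The residue \<open>v - [H, s v]\<close> lies both in the range and in the kernel of
  \<open>ad H\<close>, hence vanishes.\<close>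

lemma tangent_fixed:
  assumes "H \<in> iu" "\<And>v. br H (v - br H (s v)) = 0" "v \<in> tangent H" "s v \<in> u"
  shows "br H (s v) = v"
proof -
  have "v - br H (s v) \<in> tangent H"
    by (rule subspace_diff[OF subspace_tangent assms(3) br_u_tangent[OF assms(4)]])
  then obtain X where X: "v - br H (s v) = br X H" by (auto simp: tangent_def)
  then have X': "v - br H (s v) = br H (- X)" by (simp add: br_anticomm[of X H] br_simps)
  have "br H (br H (- X)) = 0" using assms(2)[of v] unfolding X' .
  then have "br H (- X) = 0" by (rule ad_ad_zero[OF assms(1)])
  then show ?thesis using X' by simp
qed

text \<open>The same map serves the flag and the orbit. The parameter \<open>c\<close> selects the
  point \<open>H + c\<close> over \<open>H\<close>: charts of the orbit are needed along the whole
  fibre, those of the flag at \<open>c = 0\<close>.\<close>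

lemma orbit_charts:
  assumes "H \<in> iu" "c \<in> u"
  obtains N \<psi> s where "open N" "c \<in> N" "linear s" "\<And>v. v \<in> iu \<Longrightarrow> s v \<in> u"
    "smooth_on \<psi> UNIV" "\<psi> c = H + c" "(\<psi> has_derivative (\<lambda>h. h - br (s (P h)) c)) (at c)"
    "\<And>y. y \<in> N \<Longrightarrow> \<psi> y \<in> flag br u H \<longleftrightarrow> y \<in> tangent H"
    "\<And>y. y \<in> N \<Longrightarrow> \<psi> y \<in> Uad_orbit br u H \<longleftrightarrow> (\<exists>a\<in>tangent H. \<exists>b\<in>tangent H. y = a + \<i> *s b)"
proof -
  obtain \<epsilon> where \<epsilon>: "\<epsilon> > 0"
    "\<And>Z. Z \<in> iu \<Longrightarrow> br H Z = 0 \<Longrightarrow> H + Z \<in> flag br u H \<Longrightarrow> norm Z < \<epsilon> \<Longrightarrow> Z = 0"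
    using flag_isolated_in_centralizer[OF assms(1)] by blast
  obtain s where lins: "linear s" and su: "\<And>v. v \<in> iu \<Longrightarrow> s v \<in> u"
    and proj: "\<And>v. br H (v - br H (s v)) = 0"
    using tangent_projection[OF assms(1)] flag_self[of H] assms(1) by metis
  obtain \<psi> where \<psi>: "smooth_on \<psi> UNIV" "\<psi> c = H + c"
    "\<And>y. \<exists>\<theta>\<in>U_group br u. \<psi> y = \<theta> (H + (y - br H (s (P y))))"
    "(\<psi> has_derivative (\<lambda>h. h - br (s (P h)) c)) (at c)"
    using chart[OF lins su assms(2), of H] by blast
  define Z where "Z = (\<lambda>y. P y - br H (s (P y)))"
  have linZ: "linear Z"
  proof -
    have "linear (\<lambda>y. br H (s (P y)))"
      using linear_compose[OF linear_compose[OF linear_P lins] linear_br[of H]] by (simp add: comp_def)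
    then show ?thesis unfolding Z_def by (rule linear_compose_sub[OF linear_P])
  qed
  have bT: "br H (s (P y)) \<in> tangent H" for y by (rule br_u_tangent[OF su[OF P_in_iu]])
  have Ziu: "Z y \<in> iu" for y
    unfolding Z_def by (rule subspace_diff[OF subspace_iu P_in_iu tangent_iu[OF assms(1) bT]])
  have Z0: "Z y = 0 \<longleftrightarrow> P y \<in> tangent H" for y
  proof
    show "P y \<in> tangent H" if "Z y = 0" using that bT[of y] by (simp add: Z_def)
    show "Z y = 0" if "P y \<in> tangent H"
      using tangent_fixed[OF assms(1) proj that su[OF P_in_iu]] by (simp add: Z_def)
  qed
  have R: "y - br H (s (P y)) = Z y + Q y" for y
    using P_plus_Q[of y] by (simp add: Z_def algebra_simps)
  \<comment> \<open>Only the transversal component has to be small; it vanishes at \<open>c\<close>,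
    and the fibre component \<open>Q y\<close> stays unrestricted.\<close>
  define N where "N = {y. norm (Z y) < \<epsilon>}"
  have ker: "Z y = 0" if "y \<in> N" "H + Z y \<in> flag br u H" for y
    using \<epsilon>(2)[OF Ziu _ that(2)] that(1) proj[of "P y"] by (simp add: N_def Z_def)
  show thesis
  proof (rule that[of N s \<psi>])
    have "continuous_on UNIV Z" by (rule linear_continuous_on[OF linear_conv_bounded_linear[THEN iffD1, OF linZ]])
    then show "open N" unfolding N_def by (intro open_Collect_less continuous_intros)
    show "c \<in> N"
      by (simp add: N_def Z_def P_u[OF assms(2)] linear_0[OF lins] br_simps \<epsilon>)
    fix y assume y: "y \<in> N"
    obtain \<theta> where \<theta>: "\<theta> \<in> U_group br u" "\<psi> y = \<theta> (H + (Z y + Q y))" using \<psi>(3)[of y] R by metis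
    show "\<psi> y \<in> flag br u H \<longleftrightarrow> y \<in> tangent H"
    proof -
      have "\<psi> y \<in> flag br u H \<longleftrightarrow> H + (Z y + Q y) \<in> flag br u H" by (simp add: \<theta> flag_invariant)
      also have "\<dots> \<longleftrightarrow> y \<in> tangent H"
      proof
        assume f: "H + (Z y + Q y) \<in> flag br u H"
        have "Q y = 0"
        proof -
          have "Q y + (H + Z y) = 0 + (H + (Z y + Q y))" by simp
          then show ?thesis
            by (rule decomp_unique(1)[rotated -1])
              (use Q_in_u subspace_0[OF subspace_u] flag_iu[OF assms(1) f] subspace_add[OF subspace_iu assms(1) Ziu] in auto)
        qed
        then have "Z y = 0" using ker[OF y] f by simp
        then show "y \<in> tangent H" using Z0 \<open>Q y = 0\<close> P_plus_Q[of y] by simp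
      next
        assume t: "y \<in> tangent H"
        then have "y \<in> iu" by (rule tangent_iu[OF assms(1)])
        then have "Q y = 0" "P y = y" by (simp_all add: Q_iu P_iu)
        then show "H + (Z y + Q y) \<in> flag br u H" using Z0[of y] t flag_self by simp
      qed
      finally show ?thesis .
    qed
    show "\<psi> y \<in> Uad_orbit br u H \<longleftrightarrow> (\<exists>a\<in>tangent H. \<exists>b\<in>tangent H. y = a + \<i> *s b)"
    proof -
      have "\<psi> y \<in> Uad_orbit br u H \<longleftrightarrow> H + (Z y + Q y) \<in> Uad_orbit br u H"
        by (simp add: \<theta> Uad_orbit_invariant)
      also have "\<dots> \<longleftrightarrow> (\<exists>a\<in>tangent H. \<exists>b\<in>tangent H. y = a + \<i> *s b)"
      proof
        assume "H + (Z y + Q y) \<in> Uad_orbit br u H"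
        then obtain x v where x: "x \<in> flag br u H" "v \<in> tangent x" "H + (Z y + Q y) = x + \<i> *s v"
          by (auto simp: Uad_orbit_iff)
        have xiu: "x \<in> iu" by (rule flag_iu[OF assms(1) x(1)])
        have vu: "\<i> *s v \<in> u" using tangent_iu[OF xiu x(2)] by (simp add: iu_iff)
        \<comment> \<open>Comparing the parts in \<open>u\<close> and \<open>iu\<close> identifies
          the base point as \<open>H + Z y\<close>; the isolation of \<open>H\<close> in its
          centralizer then gives \<open>Z y = 0\<close>, so \<open>v\<close> is tangent at
          \<open>H\<close> itself.\<close>
        have "Q y + (H + Z y) = \<i> *s v + x" using x(3) by (simp add: algebra_simps)
        note eq = decomp_unique[OF Q_in_u vu subspace_add[OF subspace_iu assms(1) Ziu] xiu this]
        have 0: "Z y = 0" using ker[OF y] x(1) eq(2) by simp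
        then have "P y \<in> tangent H" using Z0 by blast
        moreover have "v \<in> tangent H" using x(2) eq(2) 0 by simp
        ultimately show "\<exists>a\<in>tangent H. \<exists>b\<in>tangent H. y = a + \<i> *s b" using eq(1) P_plus_Q[of y] by metis
      next
        assume "\<exists>a\<in>tangent H. \<exists>b\<in>tangent H. y = a + \<i> *s b"
        then obtain a b where ab: "a \<in> tangent H" "b \<in> tangent H" "y = a + \<i> *s b" by blast
        have "\<i> *s b \<in> u" using tangent_iu[OF assms(1) ab(2)] by (simp add: iu_iff)
        then have "P y = a" "Q y = \<i> *s b"
          using P_decomp[of "\<i> *s b" a] Q_decomp[of "\<i> *s b" a] tangent_iu[OF assms(1) ab(1)]
          by (simp_all add: ab(3) add.commute)
        then show "H + (Z y + Q y) \<in> Uad_orbit br u H"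
          using Z0[of y] ab flag_self[of H] by (auto simp: Uad_orbit_iff)
      qed
      finally show ?thesis .
    qed
  qed (use \<psi> lins su in auto)
qed

text \<open>With \<open>c = 0\<close> the correction term disappears and the chart has the identity
  as derivative. The base point is moved to \<open>x\<close> beforehand.\<close>

lemma tangent_space_flag:
  assumes "H \<in> iu" "x \<in> flag br u H"
  shows "tangent_space (flag br u H) x = tangent x"
proof -
  have x: "x \<in> iu" by (rule flag_iu[OF assms])
  obtain N \<psi> s where c: "open N" "0 \<in> N" "linear s" "\<And>v. v \<in> iu \<Longrightarrow> s v \<in> u"
    "smooth_on \<psi> UNIV" "\<psi> 0 = x + 0" "(\<psi> has_derivative (\<lambda>h. h - br (s (P h)) 0)) (at 0)"
    "\<And>y. y \<in> N \<Longrightarrow> \<psi> y \<in> flag br u x \<longleftrightarrow> y \<in> tangent x"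
    "\<And>y. y \<in> N \<Longrightarrow> \<psi> y \<in> Uad_orbit br u x \<longleftrightarrow> (\<exists>a\<in>tangent x. \<exists>b\<in>tangent x. y = a + \<i> *s b)"
    by (rule orbit_charts[OF x subspace_0[OF subspace_u]]) (rule that)
  have "tangent_space (flag br u x) (\<psi> 0) = (\<lambda>h. h) ` tangent x"
  proof (rule slice_chart(2)[OF c(1,2) smooth_on_subset[OF c(5)] _ _ subspace_tangent _ c(8)])
    show "(\<psi> has_derivative (\<lambda>h. h)) (at 0)" using c(7) by (simp add: br_simps)
  qed (auto simp: subspace_0 subspace_tangent)
  then show ?thesis by (simp add: c(6) flag_eq[OF assms(2)])
qed

text \<open>The correction has values in \<open>u\<close> and depends on \<open>P h\<close> alone: a
  kernel vector lies in \<open>u\<close>, has \<open>P h = 0\<close>, and so is zero.\<close>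

lemma Uad_tangent_inj:
  assumes "linear s" "\<And>v. v \<in> iu \<Longrightarrow> s v \<in> u" "c \<in> u"
  shows "inj (\<lambda>h. h - br (s (P h)) c)"
proof (rule injI)
  fix h k assume "h - br (s (P h)) c = k - br (s (P k)) c"
  then have eq: "h - k = br (s (P (h - k))) c"
    by (simp add: linear_diff[OF linear_P] linear_diff[OF assms(1)] br_simps algebra_simps)
  have "br (s (P (h - k))) c \<in> u" by (intro br_u_u assms P_in_iu)
  then have "P (h - k) = 0" using eq P_u by metis
  then show "h = k" using eq by (simp add: linear_0[OF assms(1)] br_simps)
qed

text \<open>The model space is \<open>[u, H] + i [u, H]\<close>; its summands lie in
  \<open>iu\<close> and \<open>u\<close>, so the dimension doubles. The term
  \<open>- br (s a) (\<i> *s v)\<close> is the vertical motion that accompanies a displacement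
  \<open>a\<close> of the base point.\<close>

lemma Uad_orbit_slice:
  assumes "H \<in> iu" "v \<in> tangent H"
  shows "\<exists>W W' \<phi> \<psi> V. smooth_diffeo \<phi> \<psi> W W' \<and> H + \<i> *s v \<in> W \<and> subspace V \<and> dim V = 2 * dim (tangent H) \<and>
      \<phi> ` (W \<inter> Uad_orbit br u H) = W' \<inter> V" (is ?slice)
    and "\<exists>s. linear s \<and> (\<forall>v\<in>iu. s v \<in> u) \<and> tangent_space (Uad_orbit br u H) (H + \<i> *s v) =
      {a + \<i> *s b - br (s a) (\<i> *s v) | a b. a \<in> tangent H \<and> b \<in> tangent H}" (is ?tangent)
proof -
  let ?c = "\<i> *s v"
  define V where "V = {a + b | a b. a \<in> tangent H \<and> b \<in> (\<lambda>b. \<i> *s b) ` tangent H}"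
  have iu: "a \<in> iu" "\<i> *s a \<in> u" if "a \<in> tangent H" for a
    using tangent_iu[OF assms(1) that] by (auto simp: iu_iff)
  have lini: "linear (\<lambda>b :: complex ^ 'n. \<i> *s b)"
    by (rule linearI) (simp_all add: vector_add_ldistrib vec_eq_iff)
  have inji: "inj (\<lambda>b :: complex ^ 'n. \<i> *s b)" by (rule injI) (simp add: vec_eq_iff)
  have subi: "subspace ((\<lambda>b. \<i> *s b) ` tangent H)"
    by (rule linear_subspace_image[OF lini subspace_tangent])
  have V: "subspace V" unfolding V_def by (rule subspace_sums[OF subspace_tangent subi])
  have "tangent H \<inter> (\<lambda>b. \<i> *s b) ` tangent H \<subseteq> {0}" using iu u_Int_iu by blast
  then have "dim (tangent H \<inter> (\<lambda>b. \<i> *s b) ` tangent H) = 0" by (simp add: dim_eq_0)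
  moreover have "dim ((\<lambda>b. \<i> *s b) ` tangent H) = dim (tangent H)"
    by (rule dim_image_eq[OF lini]) (use inji in \<open>auto intro: inj_on_subset\<close>)
  ultimately have dimV: "dim V = 2 * dim (tangent H)"
    using dim_sums_Int[OF subspace_tangent[of H] subi] unfolding V_def by linarith
  have cu: "?c \<in> u" using iu assms(2) by blast
  obtain N \<psi> s where c: "open N" "?c \<in> N" "linear s" "\<And>v. v \<in> iu \<Longrightarrow> s v \<in> u"
    "smooth_on \<psi> UNIV" "\<psi> ?c = H + ?c" "(\<psi> has_derivative (\<lambda>h. h - br (s (P h)) ?c)) (at ?c)"
    "\<And>y. y \<in> N \<Longrightarrow> \<psi> y \<in> flag br u H \<longleftrightarrow> y \<in> tangent H"
    "\<And>y. y \<in> N \<Longrightarrow> \<psi> y \<in> Uad_orbit br u H \<longleftrightarrow> (\<exists>a\<in>tangent H. \<exists>b\<in>tangent H. y = a + \<i> *s b)"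
    by (rule orbit_charts[OF assms(1) cu]) (rule that)
  have sl: "\<psi> y \<in> Uad_orbit br u H \<longleftrightarrow> y \<in> V" if "y \<in> N" for y
    using c(9)[OF that] by (auto simp: V_def)
  have cV: "?c \<in> V"
    unfolding V_def using assms(2) subspace_0[OF subspace_tangent[of H]] by force
  have "smooth_on \<psi> N" by (rule smooth_on_subset[OF c(5)]) simp
  moreover have "inj (\<lambda>h. h - br (s (P h)) ?c)" by (rule Uad_tangent_inj[OF c(3) _ cu]) (rule c(4))
  ultimately have slice: "\<exists>W W' \<phi> \<psi>'. smooth_diffeo \<phi> \<psi>' W W' \<and> H + ?c \<in> W \<and> \<phi> ` (W \<inter> Uad_orbit br u H) = W' \<inter> V"
      "tangent_space (Uad_orbit br u H) (H + ?c) = (\<lambda>h. h - br (s (P h)) ?c) ` V"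
    using slice_chart[OF c(1,2) _ c(7) _ V cV sl] unfolding c(6) by blast+
  show ?slice using slice(1) V dimV by blast
  have "(\<lambda>h. h - br (s (P h)) ?c) ` V = {a + \<i> *s b - br (s a) ?c | a b. a \<in> tangent H \<and> b \<in> tangent H}"
  proof -
    have "P (a + \<i> *s b) = a" if "a \<in> tangent H" "b \<in> tangent H" for a b
      using P_decomp[of "\<i> *s b" a] iu that by (simp add: add.commute)
    then show ?thesis unfolding V_def by (auto simp: image_iff) (metis (no_types, lifting))+
  qed
  then show ?tangent using slice(2) c(3,4) by auto
qed

section \<open>The symplectic form on the orbit\<close>

lemma Omega_eq:
  assumes "a \<in> iu" "b \<in> iu" "a' \<in> iu" "b' \<in> iu"
  shows "Omega br u (a + \<i> *s b) (a' + \<i> *s b') = Re (K b a') - Re (K a b')"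
proof -
  have "\<tau> (a' + \<i> *s b') = \<i> *s b' - a'"
    using \<tau>_decomp[of "\<i> *s b'" a'] assms by (simp add: iu_iff[symmetric] add.commute)
  then show ?thesis
    using Im_killing_iu assms
    by (simp add: Omega_def hermitian_form_def killing_simps)
qed

lemma bilinear_Omega: "bilinear (Omega br u)"
  unfolding bilinear_def
  by (auto intro!: linearI simp: Omega_def hermitian_form_def killing_simps \<tau>_add \<tau>_scaleR)

lemma Omega_self: "Omega br u v v = 0"
proof -
  have "Q v = \<i> *s (- (\<i> *s Q v))" by (simp add: vec_eq_iff)
  moreover have "- (\<i> *s Q v) \<in> iu" by (simp add: subspace_neg subspace_iu i_times_iff Q_in_u)
  ultimately obtain b where "b \<in> iu" "v = P v + \<i> *s b" using P_plus_Q[of v] by metis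
  then show ?thesis using Omega_eq[of "P v" b "P v" b] P_in_iu[of v] killing_sym[of b "P v"] by simp
qed

lemma symplectic_Uad_orbit:
  assumes "H \<in> iu"
  shows "symplectic_on (Omega br u) (Uad_orbit br u H)"
  unfolding symplectic_on_def
proof (intro conjI allI ballI impI bilinear_Omega Omega_self)
  fix p w
  assume p: "p \<in> Uad_orbit br u H" and w: "w \<in> tangent_space (Uad_orbit br u H) p"
    and ort: "\<forall>z\<in>tangent_space (Uad_orbit br u H) p. Omega br u w z = 0"
  obtain x v where x: "x \<in> flag br u H" "v \<in> tangent x" "p = x + \<i> *s v"
    using p by (auto simp: Uad_orbit_iff)
  have xiu: "x \<in> iu" by (rule flag_iu[OF assms x(1)])
  have M: "Uad_orbit br u x = Uad_orbit br u H" by (simp add: Uad_orbit_def flag_eq[OF x(1)])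
  obtain s where s: "linear s" "\<And>v. v \<in> iu \<Longrightarrow> s v \<in> u"
    "tangent_space (Uad_orbit br u H) p = {a + \<i> *s b - br (s a) (\<i> *s v) | a b. a \<in> tangent x \<and> b \<in> tangent x}"
    using Uad_orbit_slice(2)[OF xiu x(2)] unfolding M x(3) by blast
  have T: "a \<in> iu" if "a \<in> tangent x" for a by (rule tangent_iu[OF xiu that])
  have eq: "a + \<i> *s b - br (s a) (\<i> *s v) = a + \<i> *s (b - br (s a) v)" for a b
    by (simp add: br_simps vector_ssub_ldistrib)
  have siu: "b - br (s a) v \<in> iu" if "a \<in> tangent x" "b \<in> tangent x" for a b
    using that T x(2) s(2) by (intro subspace_diff[OF subspace_iu] br_u_iu) auto
  obtain a b where ab: "a \<in> tangent x" "b \<in> tangent x" "w = a + \<i> *s (b - br (s a) v)"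
    using w unfolding s(3) eq by blast
  have test: "Re (K (b - br (s a) v) a') - Re (K a (b' - br (s a') v)) = 0"
    if "a' \<in> tangent x" "b' \<in> tangent x" for a' b'
  proof -
    have "a' + \<i> *s (b' - br (s a') v) \<in> tangent_space (Uad_orbit br u H) p"
      unfolding s(3) eq using that by blast
    then show ?thesis
      using ort ab Omega_eq[OF T[OF ab(1)] siu[OF ab(1,2)] T[OF that(1)] siu[OF that]] by simp
  qed
  have z: "0 \<in> tangent x" by (rule subspace_0[OF subspace_tangent])
  \<comment> \<open>Tested against the vertical vector \<open>i a\<close>, the form yields
    \<open>- K a a\<close>. Once \<open>a = 0\<close>, the correction \<open>[s a, v]\<close> is
    gone as well, and a vector with base component \<open>b\<close> detects
    \<open>b\<close>.\<close>
  have "a = 0"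
    using test[OF z ab(1)] positive[OF T[OF ab(1)]] by (force simp: linear_0[OF s(1)] br_simps killing_simps)
  moreover from this have "b = 0"
    using test[OF ab(2) z] positive[OF T[OF ab(2)]] by (force simp: linear_0[OF s(1)] br_simps killing_simps)
  ultimately show "w = 0" using ab(3) by (simp add: linear_0[OF s(1)] br_simps)
qed


section \<open>Gradient fields and the symmetry of their derivatives\<close>

lemma B_riesz: "\<exists>r. \<forall>y. B r y = b \<bullet> y"
proof -
  define G where "G = (\<lambda>x. \<Sum>e\<in>Basis. B x e *\<^sub>R e)"
  have lin2: "linear (B x)" for x by (rule linearI) (simp_all add: B_simps)
  have linG: "linear G"
    by (rule linearI) (simp_all add: G_def B_simps scaleR_add_left sum.distrib scaleR_sum_right)
  have GB: "G x \<bullet> y = B x y" for x y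
    unfolding linear_basis_expansion[OF lin2, of x y]
    by (simp add: G_def inner_sum_left inner_commute[of y] mult.commute)
  have "inj G"
    unfolding linear_injective_0[OF linG] using GB B_zero by (metis inner_zero_left)
  then have "surj G" using linear_injective_imp_surjective[OF linG] by blast
  then obtain r where "G r = b" by (metis surjD)
  then show ?thesis using GB by metis
qed

text \<open>The gradient for the inner product \<open>B\<close> is a combination of the partial
  derivatives with constant Riesz vectors, hence smooth wherever the function is.\<close>

lemma gradient_vector:
  obtains G :: "(complex ^ 'n \<Rightarrow> real) \<Rightarrow> complex ^ 'n \<Rightarrow> complex ^ 'n" where
    "\<And>g W x y. smooth_on g W \<Longrightarrow> x \<in> W \<Longrightarrow> B (G g x) y = frechet_derivative g (at x) y"
    "\<And>g W. open W \<Longrightarrow> smooth_on g W \<Longrightarrow> smooth_on (G g) W"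
proof -
  obtain r where r: "\<And>b y. B (r b) y = b \<bullet> y" using B_riesz by metis
  define G :: "(complex ^ 'n \<Rightarrow> real) \<Rightarrow> complex ^ 'n \<Rightarrow> complex ^ 'n"
    where "G = (\<lambda>g x. \<Sum>b\<in>Basis. frechet_derivative g (at x) b *\<^sub>R r b)"
  show thesis
  proof (rule that[of G])
    fix g :: "complex ^ 'n \<Rightarrow> real" and W x y
    assume g: "smooth_on g W" "x \<in> W"
    have lin: "linear (\<lambda>z. B z y)" by (rule linearI) (simp_all add: B_simps)
    have "B (G g x) y = (\<Sum>b\<in>Basis. frechet_derivative g (at x) b * (y \<bullet> b))"
      unfolding G_def linear_sum[OF lin] by (simp add: B_simps r inner_commute)
    also have "\<dots> = frechet_derivative g (at x) y"
      using linear_basis_expansion[OF has_derivative_linear[OF smooth_on_has_derivative[OF g]], of y]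
      by (simp add: mult.commute)
    finally show "B (G g x) y = frechet_derivative g (at x) y" .
  next
    fix g :: "complex ^ 'n \<Rightarrow> real" and W assume "open W" "smooth_on g W"
    then show "smooth_on (G g) W" unfolding G_def
      by (intro smooth_on_sum smooth_on_scaleR smooth_on_const smooth_on_frechet_derivative)
  qed
qed

text \<open>The intrinsic gradient is the orthogonal projection of the ambient one to
  \<open>tangent x\<close>, and this projection is \<open>v \<mapsto> br x (S x v)\<close> with
  \<open>S\<close> smooth in \<open>x\<close>. The neighbourhood is saturated along
  \<open>u\<close>, so that it can be tested on base points.\<close>

lemma gradient_extension:
  assumes "H \<in> iu" and f: "smooth_map_on (flag br u H) f"
    and grad: "is_gradient (\<lambda>v w. Re (K v w)) (flag br u H) f Y"
  obtains W Yt g where "open W" "H \<in> W" "\<And>x. P x \<in> W \<longleftrightarrow> x \<in> W" "smooth_on Yt W" "smooth_on g W"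
    "\<And>x. Yt x \<in> iu" "\<And>x. Yt (P x) = Yt x"
    "\<And>x. x \<in> flag br u H \<Longrightarrow> x \<in> W \<Longrightarrow> Y x = Yt x"
    "\<And>x v. x \<in> flag br u H \<Longrightarrow> x \<in> W \<Longrightarrow> v \<in> tangent x \<Longrightarrow>
      Re (K (Y x) v) = frechet_derivative g (at x) v"
proof -
  obtain W0 g where W0g: "open W0 \<and> H \<in> W0 \<and> smooth_on g W0 \<and> (\<forall>x\<in>flag br u H \<inter> W0. f x = g x)"
    using bspec[OF f[unfolded smooth_map_on_def] flag_self] by (elim exE)
  then have W0: "open W0" "H \<in> W0" and g: "smooth_on g W0"
    and fg: "\<And>x. x \<in> flag br u H \<Longrightarrow> x \<in> W0 \<Longrightarrow> f x = g x" by simp_all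
  obtain G :: "(complex ^ 'n \<Rightarrow> real) \<Rightarrow> complex ^ 'n \<Rightarrow> complex ^ 'n" where
    G: "\<And>g W x y. smooth_on g W \<Longrightarrow> x \<in> W \<Longrightarrow> B (G g x) y = frechet_derivative g (at x) y"
    "\<And>g W. open W \<Longrightarrow> smooth_on g W \<Longrightarrow> smooth_on (G g) W"
    by (rule gradient_vector) (rule that)
  obtain S :: "complex ^ 'n \<Rightarrow> complex ^ 'n \<Rightarrow> complex ^ 'n" where S:
    "\<And>x. linear (S x)" "\<And>x v. x \<in> iu \<Longrightarrow> v \<in> iu \<Longrightarrow> S x v \<in> u"
    "\<And>x v. x \<in> flag br u H \<Longrightarrow> br x (v - br x (S x v)) = 0"
    "\<And>(f :: complex ^ 'n \<Rightarrow> complex ^ 'n) g W. open W \<Longrightarrow> smooth_on f W \<Longrightarrow> smooth_on g W \<Longrightarrow>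
      smooth_on (\<lambda>y. S (f y) (g y)) W"
    by (rule tangent_projection[OF assms(1)]) (rule that)
  define W1 where "W1 = {x. P x \<in> W0}"
  \<comment> \<open>The inner \<open>P\<close> makes the extension constant along \<open>u\<close>;
    the outer one makes its values in \<open>iu\<close> immediate.\<close>
  define Yt where "Yt = (\<lambda>x. P (br (P x) (S (P x) (P (G g (P x))))))"
  have PP: "P (P x) = P x" for x by (rule P_iu[OF P_in_iu])
  have oW1: "open W1"
  proof -
    have "continuous_on UNIV P" by (rule linear_continuous_on[OF linear_conv_bounded_linear[THEN iffD1, OF linear_P]])
    from open_vimage[OF W0(1) this] show ?thesis by (simp add: W1_def vimage_def)
  qed
  define g1 where "g1 = (\<lambda>x. g (P x))"
  have sP: "smooth_on P W1" by (rule smooth_on_linear[OF oW1 linear_P smooth_on_id[OF oW1]])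
  have g1: "smooth_on g1 W1"
    unfolding g1_def by (rule smooth_on_compose[OF oW1 W0(1) sP g]) (auto simp: W1_def)
  have sY: "smooth_on Yt W1"
  proof -
    have "smooth_on (\<lambda>x. P (G g (P x))) W1"
      by (intro smooth_on_linear[OF oW1 linear_P] smooth_on_compose[OF oW1 W0(1) sP G(2)[OF W0(1) g]])
        (auto simp: W1_def)
    from S(4)[OF oW1 sP this] show ?thesis
      unfolding Yt_def by (intro smooth_on_linear[OF oW1 linear_P] smooth_on_bilinear[OF oW1 bilinear_br sP])
  qed
  have dg: "Re (K (Y x) v) = frechet_derivative g (at x) v"
    "Re (K (Y x) v) = frechet_derivative g1 (at x) v"
    if x: "x \<in> flag br u H" "x \<in> W1" and v: "v \<in> tangent x" for x v
  proof -
    have xiu: "x \<in> iu" by (rule flag_iu[OF assms(1) x(1)])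
    then have xW0: "x \<in> W0" using x(2) by (simp add: W1_def P_iu)
    have "v \<in> tangent_space (flag br u H) x" using v tangent_space_flag[OF assms(1) x(1)] by simp
    then obtain \<gamma> where \<gamma>: "curve_at (flag br u H) x v \<gamma>" by (auto simp: tangent_space_def)
    then have \<gamma>0: "\<gamma> 0 = x" "(\<gamma> has_vector_derivative v) (at 0)" by (auto simp: curve_at_def)
    have fd: "((\<lambda>s. f (\<gamma> s)) has_real_derivative Re (K (Y x) v)) (at 0)"
      using grad x(1) \<gamma> by (auto simp: is_gradient_def)
    have ev: "eventually (\<lambda>s. \<gamma> s \<in> flag br u H \<inter> W0) (nhds 0)"
      by (rule curve_at_eventually[OF \<gamma> W0(1) xW0])
    \<comment> \<open>Any smooth extension of \<open>f\<close> near \<open>x\<close> has the same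
      derivative in tangential directions, since these are velocities of curves in the flag. It is
      used for \<open>g\<close> and for \<open>g1\<close>, which is defined on the same saturated
      set as \<open>Yt\<close>.\<close>
    have uniq: "Re (K (Y x) v) = frechet_derivative h (at x) v"
      if "smooth_on h V" "x \<in> V" "\<And>y. y \<in> flag br u H \<Longrightarrow> y \<in> W0 \<Longrightarrow> f y = h y" for h V
    proof -
      have "((\<lambda>s. h (\<gamma> s)) has_vector_derivative frechet_derivative h (at x) v) (at 0)"
        using smooth_curve_has_vector_derivative_linear[OF \<gamma>0(2)] smooth_on_has_derivative[OF that(1,2)] \<gamma>0(1) by blast
      then have "((\<lambda>s. h (\<gamma> s)) has_real_derivative frechet_derivative h (at x) v) (at 0)"
        by (simp add: has_real_derivative_iff_has_vector_derivative)
      moreover have "eventually (\<lambda>s. f (\<gamma> s) = h (\<gamma> s)) (nhds 0)"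
        using ev by eventually_elim (use that(3) in auto)
      from DERIV_cong_ev[OF refl this refl] have "((\<lambda>s. h (\<gamma> s)) has_real_derivative Re (K (Y x) v)) (at 0)"
        using fd by blast
      ultimately show ?thesis using DERIV_unique by blast
    qed
    show "Re (K (Y x) v) = frechet_derivative g (at x) v" by (rule uniq[OF g xW0 fg])
    show "Re (K (Y x) v) = frechet_derivative g1 (at x) v"
      by (rule uniq[OF g1 x(2)]) (use fg flag_iu[OF assms(1)] in \<open>auto simp: g1_def P_iu\<close>)
  qed
  have eqY: "Y x = Yt x" if x: "x \<in> flag br u H" "x \<in> W1" for x
  proof -
    have xiu: "x \<in> iu" by (rule flag_iu[OF assms(1) x(1)])
    then have Px: "P x = x" and xW0: "x \<in> W0" using x(2) by (auto simp: W1_def P_iu)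
    define z where "z = P (G g x)"
    define p where "p = br x (S x z)"
    have pT: "p \<in> tangent x" unfolding p_def z_def by (intro br_u_tangent S(2) xiu P_in_iu)
    have piu: "p \<in> iu" by (rule tangent_iu[OF xiu pT])
    have Yt: "Yt x = p" using piu by (simp add: Yt_def Px P_iu p_def z_def)
    have YT: "Y x \<in> tangent x"
      using grad x(1) tangent_space_flag[OF assms(1) x(1)] by (auto simp: is_gradient_def)
    define d where "d = Y x - p"
    have dT: "d \<in> tangent x" unfolding d_def by (rule subspace_diff[OF subspace_tangent YT pT])
    have diu: "d \<in> iu" by (rule tangent_iu[OF xiu dT])
    obtain X where "X \<in> u" "d = br X x" using dT by (auto simp: tangent_def)
    then have dX: "d = br x (- X)" by (simp add: br_anticomm[of X x] br_simps)
    \<comment> \<open>\<open>z - p\<close> is in the kernel of \<open>ad x\<close> and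
      \<open>d\<close> in its range, so symmetry of \<open>ad x\<close> makes them
      orthogonal.\<close>
    have "B (z - p) d = B (br x (z - p)) (- X)" unfolding dX by (rule B_ad_symmetric[OF xiu, symmetric])
    also have "\<dots> = 0" using S(3)[OF x(1), of z] by (simp add: p_def B_simps)
    finally have 1: "B p d = B z d" by (simp add: B_simps)
    have "B (Q (G g x)) d = 0" unfolding B_iu[OF diu] by (rule Re_killing_u_iu[OF Q_in_u diu])
    then have "B z d = B (G g x) d" using P_plus_Q[of "G g x"] B_simps(1)[of z "Q (G g x)" d] by (simp add: z_def)
    also have "\<dots> = frechet_derivative g (at x) d" by (rule G(1)[OF g xW0])
    also have "\<dots> = B (Y x) d" using dg(1)[OF x dT] by (simp add: B_iu[OF diu])
    finally have "B d d = 0" using 1 by (simp add: d_def B_simps)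
    then have "d = 0" by (rule B_zero)
    then show ?thesis using Yt by (simp add: d_def)
  qed
  show thesis
  proof (rule that[of W1 Yt g1])
    show "H \<in> W1" using W0(2) by (simp add: W1_def P_iu assms(1))
  qed (use oW1 sY g1 eqY dg(2) PP in \<open>auto simp: W1_def Yt_def P_in_iu\<close>)
qed

lemma gradient_derivative_symmetric:
  assumes "H \<in> iu" "open W" "H \<in> W" "smooth_on Yt W" "smooth_on g W"
    and YY: "\<And>x. x \<in> flag br u H \<Longrightarrow> x \<in> W \<Longrightarrow> Y x = Yt x"
    and dg: "\<And>x v. x \<in> flag br u H \<Longrightarrow> x \<in> W \<Longrightarrow> v \<in> tangent x \<Longrightarrow>
      Re (K (Y x) v) = frechet_derivative g (at x) v"
    and "a \<in> tangent H" "b \<in> tangent H"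
  shows "Re (K (frechet_derivative Yt (at H) a) b) = Re (K (frechet_derivative Yt (at H) b) a)"
proof -
  let ?Y' = "frechet_derivative Yt (at H)" and ?g' = "frechet_derivative g (at H)"
  let ?g'' = "\<lambda>v. frechet_derivative (\<lambda>y. frechet_derivative g (at y) v) (at H)"
  have bil: "bounded_bilinear (\<lambda>v w. Re (K v w))"
    unfolding bilinear_conv_bounded_bilinear[symmetric] bilinear_def
    by (auto intro!: linearI simp: killing_simps)
  have key: "Re (K (?Y' w) (br A H)) + Re (K (Yt H) (br A w)) = ?g'' (br A H) w + ?g' (br A w)"
    if A: "A \<in> u" and w: "w \<in> tangent H" for A w
  proof -
    \<comment> \<open>This function vanishes on the flag near \<open>H\<close>, not in the ambient
      space; hence its derivative is known to vanish along tangent vectors \<open>w\<close>, through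
      curves in the flag.\<close>
    define \<phi> where "\<phi> = (\<lambda>x. Re (K (Yt x) (br A x)) - frechet_derivative g (at x) (br A x))"
    define \<phi>' where "\<phi>' = (\<lambda>h. (Re (K (Yt H) (br A h)) + Re (K (?Y' h) (br A H)))
      - (?g'' (br A H) h + ?g' (br A h)))"
    have dA: "(br A has_derivative br A) (at H)" by (rule linear_imp_has_derivative[OF linear_br])
    have d: "(\<phi> has_derivative \<phi>') (at H)"
      unfolding \<phi>_def \<phi>'_def
      by (intro has_derivative_diff bounded_bilinear.FDERIV[OF bil]
          has_derivative_frechet_derivative_apply[OF assms(5,2,3)] smooth_on_has_derivative[OF assms(4,3)] dA)
    have "w \<in> tangent_space (flag br u H) H" using w tangent_space_flag[OF assms(1) flag_self] by simp
    then obtain \<gamma> where \<gamma>: "curve_at (flag br u H) H w \<gamma>" by (auto simp: tangent_space_def)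
    then have \<gamma>0: "\<gamma> 0 = H" "(\<gamma> has_vector_derivative w) (at 0)" by (auto simp: curve_at_def)
    have "\<phi> x = 0" if "x \<in> flag br u H \<inter> W" for x
    proof -
      have "br A x \<in> tangent x" using A by (auto simp: tangent_def)
      then show ?thesis using dg[of x "br A x"] YY[of x] that by (simp add: \<phi>_def)
    qed
    then have "eventually (\<lambda>s. \<phi> (\<gamma> s) = 0) (nhds 0)"
      using curve_at_eventually[OF \<gamma> assms(2,3)] by (auto elim: eventually_mono)
    then have "((\<lambda>s. \<phi> (\<gamma> s)) has_real_derivative 0) (at 0)"
      using DERIV_cong_ev[OF refl _ refl, of "\<lambda>s. \<phi> (\<gamma> s)" "\<lambda>s. 0" 0 0] by simp
    moreover have "((\<lambda>s. \<phi> (\<gamma> s)) has_vector_derivative \<phi>' w) (at 0)"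
      by (rule smooth_curve_has_vector_derivative_linear[OF \<gamma>0(2)]) (simp add: d \<gamma>0(1))
    then have "((\<lambda>s. \<phi> (\<gamma> s)) has_real_derivative \<phi>' w) (at 0)"
      by (simp add: has_real_derivative_iff_has_vector_derivative)
    ultimately have "\<phi>' w = 0" using DERIV_unique by blast
    then show ?thesis by (simp add: \<phi>'_def)
  qed
  obtain A A' where A: "A \<in> u" "a = br A H" and A': "A' \<in> u" "b = br A' H"
    using assms(8,9) by (auto simp: tangent_def)
  have "br (br A A') H \<in> tangent H" using A A' br_u_u by (auto simp: tangent_def)
  then have 1: "Re (K (Yt H) (br (br A A') H)) = ?g' (br (br A A') H)"
    using dg[OF flag_self assms(3)] YY[OF flag_self assms(3)] by simp
  \<comment> \<open>The Jacobi identity relates the second arguments of the two instances of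
    \<open>key\<close>: they differ by \<open>[[A, A'], H]\<close>, a tangent vector to which the
    gradient identity applies at \<open>H\<close>.\<close>
  have J: "br A b = br (br A A') H + br A' a" unfolding A(2) A'(2) by (rule jacobi)
  have "?g' (br A b) = ?g' (br (br A A') H) + ?g' (br A' a)"
    unfolding J by (rule linear_add[OF has_derivative_linear[OF smooth_on_has_derivative[OF assms(5,3)]]])
  moreover have "Re (K (Yt H) (br A b)) = Re (K (Yt H) (br (br A A') H)) + Re (K (Yt H) (br A' a))"
    unfolding J by (simp add: killing_simps)
  moreover have "?g'' a b = ?g'' b a" by (rule symmetric_second_derivative[OF assms(5,2,3)])
  ultimately show ?thesis
    using key[OF A(1) assms(9)] key[OF A'(1) assms(8)] 1 unfolding A(2)[symmetric] A'(2)[symmetric] by linarith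
qed

section \<open>The image of the section near a point\<close>

lemma section_slice:
  fixes t :: real
  assumes "H \<in> iu" and f: "smooth_map_on (flag br u H) f"
    and grad: "is_gradient (\<lambda>v w. Re (K v w)) (flag br u H) f Y"
  defines "\<sigma> \<equiv> sigma_section t Y" and "L \<equiv> sigma_section t Y ` flag br u H"
  shows "\<exists>W h. open W \<and> H \<in> W \<and> smooth_on h W \<and> (\<forall>x\<in>flag br u H \<inter> W. \<sigma> x = h x)" (is ?ext)
    and "\<exists>W W' \<phi> \<psi> V. smooth_diffeo \<phi> \<psi> W W' \<and> \<sigma> H \<in> W \<and> subspace V \<and> dim V = dim (tangent H) \<and>
      \<phi> ` (W \<inter> L) = W' \<inter> V" (is ?slice)
    and "v \<in> tangent_space L (\<sigma> H) \<Longrightarrow> w \<in> tangent_space L (\<sigma> H) \<Longrightarrow> Omega br u v w = 0"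
proof -
  obtain W Yt g where W: "open W" "H \<in> W" "\<And>x. P x \<in> W \<longleftrightarrow> x \<in> W" and Yt: "smooth_on Yt W" and g: "smooth_on g W"
    and Ytiu: "\<And>x. Yt x \<in> iu" and YtP: "\<And>x. Yt (P x) = Yt x"
    and YY: "\<And>x. x \<in> flag br u H \<Longrightarrow> x \<in> W \<Longrightarrow> Y x = Yt x"
    and dg: "\<And>x v. x \<in> flag br u H \<Longrightarrow> x \<in> W \<Longrightarrow> v \<in> tangent x \<Longrightarrow>
      Re (K (Y x) v) = frechet_derivative g (at x) v"
    by (rule gradient_extension[OF assms(1) f grad]) (rule that)
  let ?Y' = "frechet_derivative Yt (at H)"
  define T where "T = (\<lambda>y :: complex ^ 'n. \<i> *s (t *\<^sub>R y))"
  define h where "h = (\<lambda>x. x + T (Yt x))"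
  have linT: "linear T"
    unfolding T_def by (rule linearI) (simp_all add: vec_eq_iff algebra_simps)
  have Tu: "T y \<in> u" if "y \<in> iu" for y
    unfolding T_def using subspace_scale[OF subspace_iu that] by (simp add: iu_iff[symmetric])
  have \<sigma>: "\<sigma> x = x + T (Y x)" for x
    by (simp add: \<sigma>_def sigma_section_def T_def vec_eq_iff)
  have sh: "smooth_on h W"
    unfolding h_def by (intro smooth_on_add smooth_on_id smooth_on_linear[OF _ linT] Yt W(1))
  have h\<sigma>: "\<sigma> x = h x" if "x \<in> flag br u H" "x \<in> W" for x
    using YY[OF that] by (simp add: \<sigma> h_def)
  show ?ext using W(1,2) sh h\<sigma> by blast
  have dY: "(Yt has_derivative ?Y') (at H)" by (rule smooth_on_has_derivative[OF Yt W(2)])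
  \<comment> \<open>The extension is constant along \<open>u\<close>, so its derivative factors
    through \<open>P\<close>; together with its values in \<open>iu\<close> this makes
    \<open>D\<close> the identity plus a part that is \<open>u\<close>-valued and depends on
    \<open>P k\<close>, hence injective.\<close>
  have Y'P: "?Y' (P k) = ?Y' k" for k
  proof -
    have "(Yt has_derivative ?Y') (at (P H))" using dY by (simp add: P_iu assms(1))
    from diff_chain_at[OF linear_imp_has_derivative[OF linear_P] this]
    have "(Yt has_derivative (\<lambda>k. ?Y' (P k))) (at H)" by (simp add: comp_def YtP)
    then have "(\<lambda>k. ?Y' (P k)) = ?Y'" using dY by (rule has_derivative_unique)
    then show ?thesis by metis
  qed
  have Y'iu: "?Y' k \<in> iu" for k
  proof -
    have "((\<lambda>x. P (Yt x)) has_derivative (\<lambda>k. P (?Y' k))) (at H)"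
      by (rule bounded_linear.has_derivative[OF linear_conv_bounded_linear[THEN iffD1, OF linear_P] dY])
    then have "(Yt has_derivative (\<lambda>k. P (?Y' k))) (at H)" using Ytiu by (simp add: P_iu)
    then have "(\<lambda>k. P (?Y' k)) = ?Y'" using dY by (rule has_derivative_unique)
    then show ?thesis using P_in_iu by metis
  qed
  obtain N \<psi> s where c: "open N" "0 \<in> N" "linear s" "\<And>v. v \<in> iu \<Longrightarrow> s v \<in> u"
    "smooth_on \<psi> UNIV" "\<psi> 0 = H + 0" "(\<psi> has_derivative (\<lambda>h. h - br (s (P h)) 0)) (at 0)"
    "\<And>y. y \<in> N \<Longrightarrow> \<psi> y \<in> flag br u H \<longleftrightarrow> y \<in> tangent H"
    "\<And>y. y \<in> N \<Longrightarrow> \<psi> y \<in> Uad_orbit br u H \<longleftrightarrow> (\<exists>a\<in>tangent H. \<exists>b\<in>tangent H. y = a + \<i> *s b)"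
    by (rule orbit_charts[OF assms(1) subspace_0[OF subspace_u]]) (rule that)
  define N' where "N' = N \<inter> \<psi> -` W"
  define \<Phi> where "\<Phi> = (\<lambda>y. h (\<psi> y))"
  define D where "D = (\<lambda>k. k + T (?Y' k))"
  have oN': "open N'"
    unfolding N'_def using open_vimage[OF W(1) smooth_on_continuous[OF c(5)]] c(1) by blast
  have s\<Phi>: "smooth_on \<Phi> N'"
    unfolding \<Phi>_def
    by (rule smooth_on_compose[OF oN' W(1) smooth_on_subset[OF c(5)] sh]) (auto simp: N'_def)
  have d\<Phi>: "(\<Phi> has_derivative D) (at 0)"
  proof -
    have "(h has_derivative D) (at H)"
      unfolding h_def D_def
      by (intro has_derivative_add has_derivative_ident
          bounded_linear.has_derivative[OF linear_conv_bounded_linear[THEN iffD1, OF linT] dY])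
    then have "(h has_derivative D) (at (\<psi> 0))" by (simp add: c(6))
    moreover have "(\<psi> has_derivative (\<lambda>k. k)) (at 0)" using c(7) by (simp add: br_simps)
    ultimately show ?thesis using diff_chain_at[of \<psi> "\<lambda>k. k" 0 h D] by (simp add: \<Phi>_def comp_def)
  qed
  have injD: "inj D"
    unfolding linear_injective_0[OF has_derivative_linear[OF d\<Phi>]]
  proof (intro allI impI)
    fix k assume k: "D k = 0"
    have "P (D k) = P k" by (simp add: D_def P_add P_u[OF Tu[OF Y'iu]])
    then have "P k = 0" using k linear_0[OF linear_P] by simp
    then have "?Y' k = 0" using Y'P[of k] linear_0[OF has_derivative_linear[OF dY]] by simp
    then show "k = 0" using k by (simp add: D_def linear_0[OF linT])
  qed
  have slice: "\<Phi> y \<in> L \<longleftrightarrow> y \<in> tangent H" if y: "y \<in> N'" for y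
  proof -
    have yN: "y \<in> N" and zW: "\<psi> y \<in> W" using y by (auto simp: N'_def)
    have "\<Phi> y \<in> L \<longleftrightarrow> \<psi> y \<in> flag br u H"
    proof
      assume "\<psi> y \<in> flag br u H"
      then show "\<Phi> y \<in> L" unfolding L_def \<sigma>_def[symmetric] \<Phi>_def using h\<sigma>[OF _ zW] by (metis imageI)
    next
      \<comment> \<open>\<open>P\<close> recovers the base point from a point of the image, so
        remote parts of the flag cannot contribute to \<open>L\<close> here; saturation of
        \<open>W\<close> places that base point in \<open>W\<close>, and constancy of
        \<open>Yt\<close> along \<open>u\<close> identifies it with \<open>\<psi> y\<close>.\<close>
      assume "\<Phi> y \<in> L"
      then obtain x where x: "x \<in> flag br u H" "\<Phi> y = \<sigma> x" unfolding L_def \<sigma>_def by blast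
      have xiu: "x \<in> iu" by (rule flag_iu[OF assms(1) x(1)])
      have "Y x \<in> iu"
        using grad x(1) tangent_space_flag[OF assms(1) x(1)] tangent_iu[OF xiu] by (auto simp: is_gradient_def)
      then have "P (\<sigma> x) = x" by (simp add: \<sigma> P_add P_iu[OF xiu] P_u[OF Tu])
      moreover have "P (\<Phi> y) = P (\<psi> y)" by (simp add: \<Phi>_def h_def P_add P_u[OF Tu[OF Ytiu]])
      ultimately have Pz: "P (\<psi> y) = x" using x(2) by simp
      then have "x \<in> W" using W(3) zW by metis
      then have "Y x = Yt (\<psi> y)" using YY[OF x(1)] YtP[of "\<psi> y"] Pz by simp
      then have "\<psi> y = x" using x(2) by (simp add: \<Phi>_def h_def \<sigma>)
      then show "\<psi> y \<in> flag br u H" using x(1) by simp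
    qed
    then show ?thesis using c(8)[OF yN] by simp
  qed
  have 0: "0 \<in> N'" "0 \<in> tangent H" "\<Phi> 0 = \<sigma> H"
    using c(2,6) W(2) subspace_0[OF subspace_tangent] h\<sigma>[OF flag_self W(2)] by (auto simp: N'_def \<Phi>_def)
  have sl: "\<exists>W W' \<phi> \<psi>'. smooth_diffeo \<phi> \<psi>' W W' \<and> \<sigma> H \<in> W \<and> \<phi> ` (W \<inter> L) = W' \<inter> tangent H"
    "tangent_space L (\<sigma> H) = D ` tangent H"
    using slice_chart[OF oN' 0(1) s\<Phi> d\<Phi> injD subspace_tangent 0(2) slice] unfolding 0(3) by blast+
  show ?slice using sl(1) subspace_tangent by blast
  assume "v \<in> tangent_space L (\<sigma> H)" "w \<in> tangent_space L (\<sigma> H)"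
  then obtain a b where ab: "a \<in> tangent H" "v = D a" "b \<in> tangent H" "w = D b"
    unfolding sl(2) by blast
  have iu: "a \<in> iu" "b \<in> iu" "t *\<^sub>R ?Y' a \<in> iu" "t *\<^sub>R ?Y' b \<in> iu"
    using tangent_iu[OF assms(1)] ab Y'iu subspace_scale[OF subspace_iu] by auto
  have "Re (K (?Y' a) b) = Re (K (?Y' b) a)"
    by (rule gradient_derivative_symmetric[OF assms(1) W(1,2) Yt g YY dg ab(1,3)])
  then show "Omega br u v w = 0"
    unfolding ab(2,4) D_def T_def Omega_eq[OF iu(1,3,2,4)]
    by (simp add: killing_simps killing_sym[of a])
qed

lemma gradient_tangent:
  assumes "H \<in> iu" "is_gradient (\<lambda>v w. Re (K v w)) (flag br u H) f Y" "x \<in> flag br u H"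
  shows "Y x \<in> tangent x"
  using assms(2,3) tangent_space_flag[OF assms(1,3)] by (auto simp: is_gradient_def)

lemma smooth_section_sigma:
  assumes "H \<in> iu" "gradient_field br u H Y"
  shows "smooth_section (Uad_proj br u H) (Uad_orbit br u H) (flag br u H) (sigma_section t Y)"
proof -
  obtain f where f: "smooth_map_on (flag br u H) f" "is_gradient (\<lambda>v w. Re (K v w)) (flag br u H) f Y"
    using assms(2) by (auto simp: gradient_field_def)
  have "smooth_map_on (flag br u H) (sigma_section t Y)"
    unfolding smooth_map_on_def
  proof
    fix x assume x: "x \<in> flag br u H"
    show "\<exists>W g. open W \<and> x \<in> W \<and> smooth_on g W \<and> (\<forall>z\<in>flag br u H \<inter> W. sigma_section t Y z = g z)"
      using section_slice(1)[OF flag_iu[OF assms(1) x], where f = f and Y = Y and t = t] f unfolding flag_eq[OF x] by blast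
  qed
  moreover have "sigma_section t Y x \<in> Uad_orbit br u H \<and> Uad_proj br u H (sigma_section t Y x) = x"
    if x: "x \<in> flag br u H" for x
  proof -
    have "t *\<^sub>R Y x \<in> tangent x"
      by (rule subspace_scale[OF subspace_tangent gradient_tangent[OF assms(1) f(2) x]])
    moreover have \<sigma>: "sigma_section t Y x = x + \<i> *s (t *\<^sub>R Y x)"
      by (simp add: sigma_section_def vec_eq_iff)
    ultimately have ex: "\<exists>X\<in>br x ` iu. sigma_section t Y x = x + X" unfolding br_iu_image by blast
    \<comment> \<open>Base points lie in \<open>iu\<close> and fibre components in \<open>u\<close>,
      so the Cartan decomposition determines the base point and the description in
      \<open>Uad_proj\<close> is unique.\<close>
    have "z = x" if z: "z \<in> flag br u H" "\<exists>X\<in>br z ` iu. sigma_section t Y x = z + X" for z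
    proof -
      obtain X Z where XZ: "X \<in> br x ` iu" "sigma_section t Y x = x + X"
        "Z \<in> br z ` iu" "sigma_section t Y x = z + Z" using ex z(2) by blast
      have iu: "x \<in> iu" "z \<in> iu" using flag_iu[OF assms(1)] x z(1) by auto
      then have "X \<in> u" "Z \<in> u" using XZ br_iu_iu by auto
      moreover have "X + x = Z + z" using XZ by (simp add: add.commute)
      ultimately show ?thesis using decomp_unique(2) iu by metis
    qed
    then have "Uad_proj br u H (sigma_section t Y x) = x"
      unfolding Uad_proj_def using x ex by (intro the_equality) auto
    moreover have "sigma_section t Y x \<in> Uad_orbit br u H"
      using x ex by (auto simp: Uad_orbit_def)
    ultimately show ?thesis by blast
  qed
  ultimately show ?thesis by (simp add: smooth_section_def)
qed

lemma lagrangian_sigma: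
  assumes "H \<in> iu" "gradient_field br u H Y"
  shows "lagrangian_submanifold (Omega br u) (Uad_orbit br u H) (sigma_section t Y ` flag br u H)"
proof -
  obtain f where f: "smooth_map_on (flag br u H) f" "is_gradient (\<lambda>v w. Re (K v w)) (flag br u H) f Y"
    using assms(2) by (auto simp: gradient_field_def)
  let ?L = "sigma_section t Y ` flag br u H"
  have M: "submanifold (2 * dim (tangent H)) (Uad_orbit br u H)"
    unfolding submanifold_def
  proof
    fix p assume "p \<in> Uad_orbit br u H"
    then obtain x v where x: "x \<in> flag br u H" "v \<in> tangent x" "p = x + \<i> *s v" by (auto simp: Uad_orbit_iff)
    have "Uad_orbit br u x = Uad_orbit br u H" by (simp add: Uad_orbit_def flag_eq[OF x(1)])
    then show "\<exists>W W' \<phi> \<psi> V. smooth_diffeo \<phi> \<psi> W W' \<and> p \<in> W \<and> subspace V \<and> dim V = 2 * dim (tangent H) \<and>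
        \<phi> ` (W \<inter> Uad_orbit br u H) = W' \<inter> V"
      using Uad_orbit_slice(1)[OF flag_iu[OF assms(1) x(1)] x(2)] unfolding dim_tangent[OF x(1)] x(3) by simp
  qed
  have L: "submanifold (dim (tangent H)) ?L"
    unfolding submanifold_def
  proof
    fix p assume "p \<in> ?L"
    then obtain x where x: "x \<in> flag br u H" "p = sigma_section t Y x" by blast
    show "\<exists>W W' \<phi> \<psi> V. smooth_diffeo \<phi> \<psi> W W' \<and> p \<in> W \<and> subspace V \<and> dim V = dim (tangent H) \<and>
        \<phi> ` (W \<inter> ?L) = W' \<inter> V"
      using section_slice(2)[OF flag_iu[OF assms(1) x(1)], where f = f and Y = Y and t = t] f
      unfolding flag_eq[OF x(1)] dim_tangent[OF x(1)] x(2) by blast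
  qed
  have "Omega br u v w = 0" if "p \<in> ?L" "v \<in> tangent_space ?L p" "w \<in> tangent_space ?L p" for p v w
  proof -
    obtain x where x: "x \<in> flag br u H" "p = sigma_section t Y x" using \<open>p \<in> ?L\<close> by blast
    show ?thesis
      using section_slice(3)[OF flag_iu[OF assms(1) x(1)], where f = f and Y = Y and t = t and v = v and w = w] f that(2,3)
      unfolding flag_eq[OF x(1)] x(2) by blast
  qed
  moreover have "?L \<subseteq> Uad_orbit br u H"
    using smooth_section_sigma[OF assms] by (auto simp: smooth_section_def)
  ultimately show ?thesis
    unfolding lagrangian_submanifold_def using symplectic_Uad_orbit[OF assms(1)] M L by blast
qed

end

theorem corollary16:
  fixes br :: "complex ^ 'n \<Rightarrow> complex ^ 'n \<Rightarrow> complex ^ 'n"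
    and u a aplus :: "(complex ^ 'n) set"
    and H :: "complex ^ 'n"
    and Y :: "complex ^ 'n \<Rightarrow> complex ^ 'n"
    and t :: real
  assumes "complex_lie_algebra br"
    and "semisimple br"
    and "compact_real_form br u"
    and "maximal_abelian br (i_times u) a"
    and "weyl_chamber br a aplus"
    and "H \<in> closure aplus"
    and "gradient_field br u H Y"
  shows "smooth_section (Uad_proj br u H) (Uad_orbit br u H) (flag br u H) (sigma_section t Y) \<and>
    lagrangian_submanifold (Omega br u) (Uad_orbit br u H) (sigma_section t Y ` flag br u H)"
proof -
  interpret compact_form br u using assms by unfold_locales
  \<comment> \<open>The chamber data provide \<open>H\<close> in \<open>i u\<close>: the chamber
    lies in \<open>a\<close>, and the real subspace \<open>i u\<close> is closed, so it contains the
    closure too.\<close>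
  have "aplus \<subseteq> a" using in_components_subset assms(5) unfolding weyl_chamber_def by blast
  moreover have "a \<subseteq> i_times u" using assms(4) by (simp add: maximal_abelian_def)
  ultimately have "closure aplus \<subseteq> i_times u"
    by (intro closure_minimal closed_subspace subspace_iu) auto
  then have "H \<in> i_times u" using assms(6) by blast
  then show ?thesis using smooth_section_sigma lagrangian_sigma assms(7) by blast
qed

end
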